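(* Let $A$ be as in the context, with fraction field $K$, and let $L$ be a finite extension of $K$. Then, up to isomorphism over $L$, there are at most finitely many rank $1$ Drinfeld $A$-modules $\phi$ over $L$ for which $({}^{\phi}L)_{\mathrm{tors}} \neq 0$.
   Context: $A$ denotes the ring of regular functions on the affine curve obtained by deleting a closed point $\infty$ from a nonsingular projective (irreducible) curve $X$ over a finite field $\mathbb{F}_q$; $K$ is the fraction field of $A$. For a field $L \supseteq K$ (always equipped with the inclusion homomorphism $A\to L$), a Drinfeld $A$-module of rank $r\ge 1$ over $L$ is an $\mathbb{F}_q$-algebra homomorphism $a\mapsto \phi_a$ from $A$ to the ring (under addition and composition) of $\mathbb{F}_q$-linear polynomials over $L$, such that for each nonzero $a\in A$, $\phi_a(x) = ax + (\text{higher powers of } x)$ has degree $(\# A/aA)^r$ in $x$. Two Drinfeld modules $\phi,\psi$ are isomorphic over a field $M\supseteq L$ if there is $u\in M^{*}$ with $\phi_a(ux) = u\,\psi_a(x)$ for all $a\in A$. The module ${}^{\phi}L$ is the additive group of $L$ with the $A$-module structure $a\cdot\alpha = \phi_a(\alpha)$, and $({}^{\phi}L)_{\mathrm{tors}} = \{\alpha\in L : \phi_a(\alpha)=0 \text{ for some nonzero } a\in A\}$. *)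

theory Defs
  imports "HOL-Algebra.Algebraic_Closure_Type" "HOL-Algebra.Generated_Fields" "HOL-Algebra.QuotRing"
begin

text \<open>
  The field \<open>L\<close> is the whole type \<open>'l :: field\<close>; the finite field \<open>k\<close>, the ring \<open>A\<close> and its
  fraction field are subsets of it, so that the homomorphism from \<open>A\<close> to \<open>L\<close> is the inclusion.
\<close>

abbreviation field_L :: "'l::field ring" where
  "field_L \<equiv> ring_of_type_algebra"

abbreviation ring_on :: "'l::field set \<Rightarrow> 'l ring" where
  "ring_on S \<equiv> field_L\<lparr>carrier := S\<rparr>"

definition localization :: "'l::field set \<Rightarrow> 'l set \<Rightarrow> 'l set" where
  "localization R \<pp> = {a / s | a s. a \<in> R \<and> s \<in> R - \<pp>}"

definition fraction_field :: "'l::field set \<Rightarrow> 'l set" where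
  "fraction_field R = localization R {0}"


section \<open>Projective curves\<close>

text \<open>
  An integral closed subscheme \<open>X\<close> of projective \<open>n\<close>-space over \<open>k\<close> is the closure of its
  generic point, which is given by homogeneous coordinates \<open>t 0, ..., t n\<close>, not all zero, in a
  field containing the function field of \<open>X\<close>. The function field is generated over \<open>k\<close> by the ratios
  of the coordinates, and for \<open>t i \<noteq> 0\<close> the intersection of \<open>X\<close> with the standard affine
  open set where the \<open>i\<close>-th coordinate does not vanish is the spectrum of
  \<open>affine_chart k n t i\<close>. (If \<open>t i = 0\<close>, this intersection is empty.)
\<close>

definition function_field :: "'l::field set \<Rightarrow> nat \<Rightarrow> (nat \<Rightarrow> 'l) \<Rightarrow> 'l set" where
  "function_field k n t =
     generate_field field_L (k \<union> {t j / t i | i j. i \<le> n \<and> j \<le> n \<and> t i \<noteq> 0})"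

definition affine_chart :: "'l::field set \<Rightarrow> nat \<Rightarrow> (nat \<Rightarrow> 'l) \<Rightarrow> nat \<Rightarrow> 'l set" where
  "affine_chart k n t i = generate_ring field_L (k \<union> {t j / t i | j. j \<le> n})"

text \<open>
  A closed point is represented by its local ring inside the function field. This is harmless:
  \<open>X\<close> is separated and integral, so different points have different local rings, and the same
  point seen in two charts has the same local ring.
\<close>

definition closed_points :: "'l::field set \<Rightarrow> nat \<Rightarrow> (nat \<Rightarrow> 'l) \<Rightarrow> 'l set set" where
  "closed_points k n t =
     {localization (affine_chart k n t i) \<mm> | i \<mm>.
        i \<le> n \<and> t i \<noteq> 0 \<and> maximalideal \<mm> (ring_on (affine_chart k n t i))}"

text \<open>The dimension of \<open>X\<close> is the transcendence degree of its function field.\<close>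

definition projective_curve :: "'l::field set \<Rightarrow> nat \<Rightarrow> (nat \<Rightarrow> 'l) \<Rightarrow> bool" where
  "projective_curve k n t \<longleftrightarrow>
     subfield k field_L \<and> (\<exists>i\<le>n. t i \<noteq> 0) \<and>
     (\<exists>x\<in>function_field k n t.
        (ring.transcendental field_L over k) x \<and>
        (\<forall>y\<in>function_field k n t.
           (ring.algebraic field_L over generate_field field_L (insert x k)) y))"

text \<open>
  The local ring of a curve at a closed point has dimension one, hence it is regular iff its
  maximal ideal can be generated by one element.
\<close>

definition nonsingular_projective_curve :: "'l::field set \<Rightarrow> nat \<Rightarrow> (nat \<Rightarrow> 'l) \<Rightarrow> bool" where
  "nonsingular_projective_curve k n t \<longleftrightarrow>
     projective_curve k n t \<and>
     (\<forall>P\<in>closed_points k n t. \<forall>\<mm>. maximalideal \<mm> (ring_on P) \<longrightarrow> principalideal \<mm> (ring_on P))"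

definition regular_functions_away_from ::
  "'l::field set \<Rightarrow> nat \<Rightarrow> (nat \<Rightarrow> 'l) \<Rightarrow> 'l set \<Rightarrow> 'l set" where
  "regular_functions_away_from k n t Pinf =
     {f \<in> function_field k n t. \<forall>P\<in>closed_points k n t. P \<noteq> Pinf \<longrightarrow> f \<in> P}"


section \<open>Drinfeld modules\<close>

text \<open>The polynomials that are \<open>k\<close>-linear for a field \<open>k\<close> with \<open>q\<close> elements, i.e. the
  polynomials \<open>c\<^sub>0 x + c\<^sub>1 x^q + c\<^sub>2 x^(q^2) + ...\<close>\<close>

definition linear_polys :: "nat \<Rightarrow> 'l::field poly set" where
  "linear_polys q = {f. \<forall>i. Polynomial.coeff f i \<noteq> 0 \<longrightarrow> (\<exists>j. i = q ^ j)}"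

text \<open>
  The values of \<open>\<phi>\<close> outside \<open>A\<close> are irrelevant; they do not affect isomorphism classes below.
  The scalar \<open>c \<in> k\<close> of the \<open>k\<close>-algebra of linear polynomials is the polynomial \<open>c x\<close>.
\<close>

definition drinfeld_module :: "'l::field set \<Rightarrow> 'l set \<Rightarrow> nat \<Rightarrow> ('l \<Rightarrow> 'l poly) \<Rightarrow> bool" where
  "drinfeld_module k A r \<phi> \<longleftrightarrow>
     r \<ge> 1 \<and>
     (\<forall>a\<in>A. \<phi> a \<in> linear_polys (card k)) \<and>
     (\<forall>a\<in>A. \<forall>b\<in>A. \<phi> (a + b) = \<phi> a + \<phi> b \<and> \<phi> (a * b) = pcompose (\<phi> a) (\<phi> b)) \<and>
     (\<forall>c\<in>k. \<phi> c = [:0, c:]) \<and>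
     (\<forall>a\<in>A. a \<noteq> 0 \<longrightarrow>
        Polynomial.coeff (\<phi> a) 1 = a \<and>
        Polynomial.degree (\<phi> a) =
          card (carrier (ring_on A Quot (PIdl\<^bsub>ring_on A\<^esub> a))) ^ r)"

text \<open>Isomorphism over \<open>L\<close>: \<open>\<phi>\<^sub>a(u x) = u \<psi>\<^sub>a(x)\<close> for some nonzero \<open>u\<close> in \<open>L\<close>.\<close>

definition drinfeld_iso ::
  "'l::field set \<Rightarrow> 'l set \<Rightarrow> nat \<Rightarrow> (('l \<Rightarrow> 'l poly) \<times> ('l \<Rightarrow> 'l poly)) set" where
  "drinfeld_iso k A r =
     {(\<phi>, \<psi>). drinfeld_module k A r \<phi> \<and> drinfeld_module k A r \<psi> \<and>
        (\<exists>u. u \<noteq> 0 \<and> (\<forall>a\<in>A. pcompose (\<phi> a) [:0, u:] = Polynomial.smult u (\<psi> a)))}"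

definition torsion :: "'l::field set \<Rightarrow> ('l \<Rightarrow> 'l poly) \<Rightarrow> 'l set" where
  "torsion A \<phi> = {\<alpha>. \<exists>a\<in>A. a \<noteq> 0 \<and> poly (\<phi> a) \<alpha> = 0}"

lemma equiv_drinfeld_iso: "equiv {\<phi>. drinfeld_module k A r \<phi>} (drinfeld_iso k A r)"
proof (rule equivI)
  show "drinfeld_iso k A r \<subseteq> {\<phi>. drinfeld_module k A r \<phi>} \<times> {\<phi>. drinfeld_module k A r \<phi>}"
    by (auto simp: drinfeld_iso_def)
  show "refl_on {\<phi>. drinfeld_module k A r \<phi>} (drinfeld_iso k A r)"
    by (auto simp: refl_on_def drinfeld_iso_def intro!: exI[of _ 1])
  show "sym (drinfeld_iso k A r)"
  proof (rule symI)
    fix \<phi> \<psi> assume "(\<phi>, \<psi>) \<in> drinfeld_iso k A r"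
    then obtain u where D: "drinfeld_module k A r \<phi>" "drinfeld_module k A r \<psi>" and u: "u \<noteq> 0"
      and eq: "\<And>a. a \<in> A \<Longrightarrow> pcompose (\<phi> a) [:0, u:] = Polynomial.smult u (\<psi> a)"
      by (auto simp: drinfeld_iso_def)
    have "pcompose (\<psi> a) [:0, inverse u:] = Polynomial.smult (inverse u) (\<phi> a)" if a: "a \<in> A" for a
    proof -
      have "\<psi> a = Polynomial.smult (inverse u) (pcompose (\<phi> a) [:0, u:])"
        using eq[OF a] u by simp
      moreover have "pcompose (pcompose (\<phi> a) [:0, u:]) [:0, inverse u:] = \<phi> a"
        using u by (simp add: pcompose_assoc [symmetric] pcompose_pCons)
      ultimately show ?thesis by (simp add: pcompose_smult)
    qed
    with D u show "(\<psi>, \<phi>) \<in> drinfeld_iso k A r"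
      by (auto simp: drinfeld_iso_def intro!: exI[of _ "inverse u"])
  qed
  show "trans (drinfeld_iso k A r)"
  proof (rule transI)
    fix \<phi> \<psi> \<chi> assume "(\<phi>, \<psi>) \<in> drinfeld_iso k A r" "(\<psi>, \<chi>) \<in> drinfeld_iso k A r"
    then obtain u v where D: "drinfeld_module k A r \<phi>" "drinfeld_module k A r \<chi>"
      and uv: "u \<noteq> 0" "v \<noteq> 0"
      and eq: "\<And>a. a \<in> A \<Longrightarrow> pcompose (\<phi> a) [:0, u:] = Polynomial.smult u (\<psi> a)"
        "\<And>a. a \<in> A \<Longrightarrow> pcompose (\<psi> a) [:0, v:] = Polynomial.smult v (\<chi> a)"
      by (auto simp: drinfeld_iso_def)
    have "pcompose (\<phi> a) [:0, u * v:] = Polynomial.smult (u * v) (\<chi> a)" if a: "a \<in> A" for a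
    proof -
      have "pcompose (\<phi> a) [:0, u * v:] = pcompose (pcompose (\<phi> a) [:0, u:]) [:0, v:]"
        by (simp add: pcompose_assoc [symmetric] pcompose_pCons mult.commute)
      then show ?thesis by (simp add: eq[OF a] pcompose_smult)
    qed
    with D uv show "(\<phi>, \<chi>) \<in> drinfeld_iso k A r"
      by (auto simp: drinfeld_iso_def intro!: exI[of _ "u * v"])
  qed
qed

end

theory Submission
  imports Defs
begin

text \<open>
  After scaling a torsion point to \<open>1\<close>, a Drinfeld module \<open>\<phi>\<close> over \<open>L\<close> is described by the
  coefficients \<open>c a i\<close> of \<open>x^(q^i)\<close> in \<open>\<phi> a\<close>. They satisfy a twisted convolution law
  (\<open>twisted_hom\<close>), and it must be shown that they take only finitely many values. There are three
  ideas.

  \<^emph>\<open>A module of rank one keeps its rank under reduction\<close> (\<open>card_residues_le\<close>). Let the coefficients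
  lie in a valuation ring whose maximal ideal does not meet \<open>A - {0}\<close>, and let the reduction be more
  than \<open>a x\<close>. Then the reduction of \<open>\<phi> a\<close> has degree at least \<open>#(A/aA)\<close>, so it has lost nothing.
  For let \<open>g\<close> be the gcd of the exponents \<open>n\<close> for which a reduction of degree \<open>q^n\<close> occurs. As \<open>A\<close> is
  commutative, the quotient of two leading coefficients of the same degree lies in the field with
  \<open>q^g\<close> elements, whence at most \<open>q^(N + g)\<close> elements of \<open>A\<close> have a reduction of degree less than
  \<open>q^N\<close>. On the other hand, digits from a system of representatives of \<open>A/aA\<close> give \<open>#(A/aA)^j\<close>
  elements \<open>w\<^sub>0 + w\<^sub>1 a + ... + w\<^sub>j\<^sub>-\<^sub>1 a^(j-1)\<close>, and the exponents of their degrees grow like \<open>j\<close>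
  times that of \<open>\<phi> a\<close>. Let \<open>j\<close> tend to infinity. For the trivial valuation the same count shows that
  only finitely many elements of \<open>A\<close> have degree below a given bound; if \<open>T \<in> A\<close> is not a unit, it follows that
  \<open>A\<close> is finite over \<open>k[T]\<close>.

  \<^emph>\<open>Up to scaling there are finitely many modules of rank one over the algebraic closure \<open>M\<close> of \<open>L\<close>\<close>
  (\<open>finite_normalised_coefficients\<close>). Scale a zero of \<open>\<phi> T\<close> to \<open>1\<close>. If some coefficient still took
  infinitely many values, then an ultrapower of \<open>M\<close> would carry a module of rank one with a
  coefficient that is not integral over \<open>M\<close>, and there would be a valuation ring that contains \<open>M\<close>
  but not this coefficient. Scale the module by some \<open>u\<close> to coefficients in the valuation ring, one of
  them a unit. By the first idea the leading coefficient for \<open>T\<close> is a unit as well; hence \<open>u\<close>, a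
  zero of this polynomial, is integral, and so are the coefficients before scaling: a contradiction.

  \<^emph>\<open>Northcott's theorem\<close> (\<open>finite_preperiodic\<close>). The modules over \<open>L\<close> with torsion point \<open>1\<close> that agree
  up to scaling with a given \<open>\<phi>\<^sub>0\<close> are its twists by certain torsion points \<open>u \<in> M\<close> of \<open>\<phi>\<^sub>0\<close>, and some
  fixed power of \<open>u\<close> lies in \<open>L\<close>. Being a torsion point, \<open>u\<close> has a finite orbit under
  the polynomial for \<open>T\<close>, and this bounds \<open>u\<close> in every valuation ring of \<open>M\<close>. Therefore \<open>u\<close> is
  integral, up to fixed denominators, over \<open>k[T]\<close> and over the local ring of \<open>k(T)\<close> at infinity, and it has
  bounded degree over \<open>k(T)\<close>; this leaves finitely many minimal polynomials.

  If all nonzero elements of \<open>A\<close> are units, then \<open>\<phi> a\<close> is \<open>a x\<close> for all \<open>a \<in> A\<close>, and there is at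
  most one isomorphism class.
\<close>

section \<open>Valuation rings of a field\<close>

definition closed_subring :: "'a::comm_ring_1 set \<Rightarrow> bool" where
  "closed_subring R \<longleftrightarrow> 1 \<in> R \<and> (\<forall>x\<in>R. \<forall>y\<in>R. x - y \<in> R \<and> x * y \<in> R)"

definition polys_over :: "'a::comm_ring_1 set \<Rightarrow> 'a poly set" where
  "polys_over R = {p. \<forall>i. coeff p i \<in> R}"

definition integral_over :: "'a::comm_ring_1 set \<Rightarrow> 'a \<Rightarrow> bool" where
  "integral_over R x \<longleftrightarrow> (\<exists>p\<in>polys_over R. lead_coeff p = 1 \<and> poly p x = 0)"

definition valuation_ring :: "'a::field set \<Rightarrow> bool" where
  "valuation_ring V \<longleftrightarrow> closed_subring V \<and> (\<forall>x. x \<in> V \<or> inverse x \<in> V)"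

text \<open>In a valuation ring this is the maximal ideal. Residue fields are not formed below; statements
  about them become congruences modulo this ideal.\<close>
definition nonunits :: "'a::field set \<Rightarrow> 'a set" where
  "nonunits V = {x\<in>V. x = 0 \<or> inverse x \<notin> V}"

lemma closed_subringD:
  assumes "closed_subring R"
  shows "1 \<in> R" "0 \<in> R" "x \<in> R \<Longrightarrow> y \<in> R \<Longrightarrow> x - y \<in> R" "x \<in> R \<Longrightarrow> - x \<in> R"
    "x \<in> R \<Longrightarrow> y \<in> R \<Longrightarrow> x + y \<in> R" "x \<in> R \<Longrightarrow> y \<in> R \<Longrightarrow> x * y \<in> R"
proof -
  show 1: "1 \<in> R" and sub: "\<And>x y. x \<in> R \<Longrightarrow> y \<in> R \<Longrightarrow> x - y \<in> R" and
    "x \<in> R \<Longrightarrow> y \<in> R \<Longrightarrow> x * y \<in> R"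
    using assms by (auto simp: closed_subring_def)
  show 0: "0 \<in> R" using sub[OF 1 1] by simp
  have m: "- x \<in> R" if "x \<in> R" for x using sub[OF 0 that] by simp
  show "x \<in> R \<Longrightarrow> - x \<in> R" by (rule m)
  show "x \<in> R \<Longrightarrow> y \<in> R \<Longrightarrow> x + y \<in> R" using sub[OF _ m] by fastforce
qed

lemma closed_subring_power: "closed_subring R \<Longrightarrow> x \<in> R \<Longrightarrow> x ^ n \<in> R"
  by (induction n) (auto intro: closed_subringD)

lemma closed_subring_sum: "closed_subring R \<Longrightarrow> (\<And>i. i \<in> I \<Longrightarrow> f i \<in> R) \<Longrightarrow> sum f I \<in> R"
  by (induction I rule: infinite_finite_induct) (auto intro: closed_subringD)

lemma closed_subring_polys_over:
  assumes R: "closed_subring R"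
  shows "closed_subring (polys_over R)"
  unfolding closed_subring_def
proof (intro conjI ballI)
  show "1 \<in> polys_over R" using R by (auto simp: polys_over_def closed_subringD)
  fix p q assume pq: "p \<in> polys_over R" "q \<in> polys_over R"
  then show "p - q \<in> polys_over R" using R by (auto simp: polys_over_def closed_subringD)
  show "p * q \<in> polys_over R" using pq R
    by (auto simp: polys_over_def coeff_mult intro!: closed_subring_sum closed_subringD(6))
qed

lemmas polys_over_closed = closed_subringD[OF closed_subring_polys_over]

lemma monom_in_polys_over: "closed_subring R \<Longrightarrow> a \<in> R \<Longrightarrow> monom a n \<in> polys_over R"
  by (auto simp: polys_over_def closed_subringD)

lemma pCons_in_polys_over: "a \<in> R \<Longrightarrow> p \<in> polys_over R \<Longrightarrow> pCons a p \<in> polys_over R"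
  by (auto simp: polys_over_def coeff_pCons split: nat.splits)

lemma smult_in_polys_over: "closed_subring R \<Longrightarrow> a \<in> R \<Longrightarrow> p \<in> polys_over R \<Longrightarrow> smult a p \<in> polys_over R"
  by (auto simp: polys_over_def closed_subringD)

lemma reflect_poly_in_polys_over: "closed_subring R \<Longrightarrow> p \<in> polys_over R \<Longrightarrow> reflect_poly p \<in> polys_over R"
  by (auto simp: polys_over_def coeff_reflect_poly closed_subringD)

lemma polys_over_mono: "R \<subseteq> S \<Longrightarrow> polys_over R \<subseteq> polys_over S"
  by (auto simp: polys_over_def)

lemma poly_in_closed_subring:
  "closed_subring R \<Longrightarrow> p \<in> polys_over R \<Longrightarrow> x \<in> R \<Longrightarrow> poly p x \<in> R"
  by (auto simp: poly_altdef polys_over_def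
      intro!: closed_subring_sum closed_subringD(6) closed_subring_power)

definition adjoin :: "'a::comm_ring_1 set \<Rightarrow> 'a \<Rightarrow> 'a set" where
  "adjoin R t = (\<lambda>p. poly p t) ` polys_over R"

lemma adjoin_subring:
  assumes R: "closed_subring R"
  shows "closed_subring (adjoin R t)" "R \<subseteq> adjoin R t" "t \<in> adjoin R t"
proof -
  show "closed_subring (adjoin R t)"
    unfolding closed_subring_def adjoin_def
  proof (intro conjI ballI)
    show "1 \<in> (\<lambda>p. poly p t) ` polys_over R"
      by (rule image_eqI[of _ _ 1]) (auto simp: polys_over_closed R)
    fix x y assume "x \<in> (\<lambda>p. poly p t) ` polys_over R" "y \<in> (\<lambda>p. poly p t) ` polys_over R"
    then obtain p q where pq: "p \<in> polys_over R" "q \<in> polys_over R" "x = poly p t" "y = poly q t"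
      by auto
    show "x - y \<in> (\<lambda>p. poly p t) ` polys_over R"
      by (rule image_eqI[of _ _ "p - q"]) (auto simp: pq polys_over_closed R)
    show "x * y \<in> (\<lambda>p. poly p t) ` polys_over R"
      by (rule image_eqI[of _ _ "p * q"]) (auto simp: pq polys_over_closed R)
  qed
  show "R \<subseteq> adjoin R t"
  proof
    fix x assume "x \<in> R"
    then show "x \<in> adjoin R t" unfolding adjoin_def
      by (intro image_eqI[of _ _ "monom x 0"]) (auto simp: poly_monom monom_in_polys_over R)
  qed
  show "t \<in> adjoin R t" unfolding adjoin_def
    by (intro image_eqI[of _ _ "monom 1 1"]) (auto simp: poly_monom monom_in_polys_over R closed_subringD)
qed

text \<open>
  Chevalley's reduction step. If \<open>1 - b / x\<close> is a unit for the constant term \<open>b\<close> of \<open>p'\<close>, the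
  representation of \<open>x\<close> by \<open>p'\<close> expresses \<open>z^n\<close> by lower powers of \<open>z\<close> as soon as \<open>n \<ge> degree p'\<close>. This
  eliminates the leading term of \<open>p\<close>.
\<close>
lemma valuation_ring_reduce_degree:
  fixes V :: "'a::field set"
  assumes V: "closed_subring V" and y: "inverse x \<in> V"
    and unit: "\<And>r. r \<in> V \<Longrightarrow> 1 - inverse x * r \<noteq> 0 \<and> inverse (1 - inverse x * r) \<in> V"
    and p: "p \<in> polys_over V" "poly p z = x"
    and p': "p' \<in> polys_over V" "poly p' (inverse z) = x"
    and nz: "x \<noteq> 0" "z \<noteq> 0" and deg: "degree p' \<le> degree p" "degree p \<ge> 1"
  shows "\<exists>r\<in>polys_over V. poly r z = x \<and> degree r < degree p"
proof -
  define n where "n = degree p"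
  define a where "a = coeff p n"
  obtain b p1 where p1: "p' = pCons b p1" by (cases p')
  have b: "b \<in> V" and p1V: "p1 \<in> polys_over V"
    using p'(1) unfolding p1 polys_over_def
    by (auto simp: coeff_pCons split: nat.splits)
  define t where "t = inverse (1 - inverse x * b)"
  have t: "t \<in> V" "t * (1 - inverse x * b) = 1" using unit[OF b] by (auto simp: t_def)
  have "x = b + inverse z * poly p1 (inverse z)" using p' p1 by simp
  then have "inverse x * x = inverse x * b + inverse x * (inverse z * poly p1 (inverse z))"
    by (metis distrib_left)
  then have "1 - inverse x * b = inverse x * (inverse z * poly p1 (inverse z))"
    by (metis add_diff_cancel_left' left_inverse nz(1))
  then have one: "t * (inverse x * (inverse z * poly p1 (inverse z))) = 1" using t by simp
  then have "p1 \<noteq> 0" by auto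
  then have d1: "degree p1 \<le> n - 1" using deg p1 by (auto simp: n_def)
  define e where "e = n - 1 - degree p1"
  define r where "r = p - monom a n + smult (a * t * inverse x) (monom 1 e * reflect_poly p1)"
  have en: "n - 1 = e + degree p1" using d1 by (simp add: e_def)
  have "a \<in> V" using p(1) by (auto simp: a_def polys_over_def)
  then have "r \<in> polys_over V" unfolding r_def using V y t(1) p(1) p1V
    by (intro polys_over_closed smult_in_polys_over monom_in_polys_over reflect_poly_in_polys_over)
       (auto simp: closed_subringD)
  moreover have "poly r z = x"
  proof -
    have "z ^ n = z ^ n * (t * (inverse x * (inverse z * poly p1 (inverse z))))" using one by simp
    also have "\<dots> = t * inverse x * (z ^ (n - 1) * poly p1 (inverse z))"
      using nz deg by (cases n) (auto simp: n_def)
    also have "z ^ (n - 1) * poly p1 (inverse z) = z ^ e * poly (reflect_poly p1) z"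
      unfolding en using nz by (simp add: power_add poly_reflect_poly_nz)
    finally have "a * z ^ n = a * t * inverse x * (z ^ e * poly (reflect_poly p1) z)"
      by (simp add: mult.assoc)
    then show ?thesis using p(2) by (simp only: r_def poly_monom poly_add poly_diff poly_smult poly_mult) simp
  qed
  moreover have "degree r < n"
  proof -
    have "degree (p - monom a n) < n"
    proof (rule le_less_trans[OF degree_le[of "n - 1"]])
      show "\<forall>i>n - 1. coeff (p - monom a n) i = 0"
        by (auto simp: a_def n_def coeff_eq_0)
    qed (use deg in \<open>auto simp: n_def\<close>)
    moreover have "degree (smult (a * t * inverse x) (monom 1 e * reflect_poly p1)) < n"
    proof -
      have "degree (smult (a * t * inverse x) (monom 1 e * reflect_poly p1)) \<le> degree (monom 1 e * reflect_poly p1)"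
        by (rule degree_smult_le)
      also have "\<dots> \<le> degree (monom (1::'a) e) + degree (reflect_poly p1)" by (rule degree_mult_le)
      also have "\<dots> \<le> e + degree p1" by (intro add_mono degree_monom_le degree_reflect_poly_le)
      also have "\<dots> < n" using d1 deg by (auto simp: e_def n_def)
      finally show ?thesis .
    qed
    ultimately show ?thesis unfolding r_def by (rule degree_add_less)
  qed
  ultimately show ?thesis by (auto simp: n_def)
qed

text \<open>
  A subring that is maximal among those containing \<open>R\<close> and \<open>1/x\<close> but not \<open>x\<close> is a valuation ring.
  The starting point of Zorn's lemma is \<open>R[1/x]\<close>, which does not contain \<open>x\<close> because a relation
  \<open>x = p(1/x)\<close> would be an integral equation for \<open>x\<close>.
\<close>
theorem valuation_ring_avoiding:
  fixes R :: "'a::field set"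
  assumes R: "closed_subring R" and x: "\<not> integral_over R x"
  obtains V where "valuation_ring V" "R \<subseteq> V" "x \<notin> V"
proof -
  define y where "y = inverse x"
  have nz: "x \<noteq> 0"
  proof
    assume "x = 0"
    then have "integral_over R x" unfolding integral_over_def
      by (intro bexI[of _ "monom 1 1"]) (auto simp: poly_monom monom_in_polys_over R closed_subringD degree_monom_eq)
    with x show False by simp
  qed
  define \<S> where "\<S> = {S. closed_subring S \<and> R \<subseteq> S \<and> y \<in> S \<and> x \<notin> S}"
  have "x \<notin> adjoin R y"
  proof
    assume "x \<in> adjoin R y"
    then obtain p where p: "p \<in> polys_over R" "poly p y = x" by (auto simp: adjoin_def)
    define n where "n = degree p"
    define q where "q = monom 1 (Suc n) - reflect_poly p"
    have lt: "degree (reflect_poly p) < Suc n"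
      using degree_reflect_poly_le[of p] by (simp add: n_def)
    have deg: "degree q = Suc n"
      unfolding q_def diff_conv_add_uminus
      by (subst degree_add_eq_left) (use lt in \<open>auto simp: degree_monom_eq\<close>)
    have "lead_coeff q = 1" unfolding deg using lt by (simp add: q_def coeff_eq_0)
    moreover have "poly q x = 0"
      using poly_reflect_poly_nz[OF nz, of p] p(2) by (simp add: q_def poly_monom y_def n_def)
    moreover have "q \<in> polys_over R" unfolding q_def
      by (intro polys_over_closed monom_in_polys_over reflect_poly_in_polys_over R p closed_subringD(1))
    ultimately show False using x by (auto simp: integral_over_def)
  qed
  then have ne: "adjoin R y \<in> \<S>" using adjoin_subring[OF R, of y] by (auto simp: \<S>_def)
  have "\<exists>M\<in>\<S>. \<forall>Y\<in>\<S>. M \<subseteq> Y \<longrightarrow> Y = M"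
  proof (rule subset_Zorn_nonempty)
    show "\<S> \<noteq> {}" using ne by auto
    fix \<C> assume C: "\<C> \<noteq> {}" "subset.chain \<S> \<C>"
    then have sub: "\<C> \<subseteq> \<S>" by (auto simp: subset.chain_def)
    have "closed_subring (\<Union>\<C>)" unfolding closed_subring_def
    proof (intro conjI ballI)
      show "1 \<in> \<Union>\<C>" using C(1) sub by (auto simp: \<S>_def dest!: closed_subringD(1))
      fix a b assume "a \<in> \<Union>\<C>" "b \<in> \<Union>\<C>"
      then obtain S T where ST: "S \<in> \<C>" "T \<in> \<C>" "a \<in> S" "b \<in> T" by auto
      with C(2) have "S \<subseteq> T \<or> T \<subseteq> S" by (auto simp: subset.chain_def)
      then obtain S where "S \<in> \<C>" "a \<in> S" "b \<in> S" using ST by blast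
      then show "a - b \<in> \<Union>\<C>" "a * b \<in> \<Union>\<C>"
        using sub by (auto simp: \<S>_def closed_subringD(3,6) intro!: bexI[of _ S])
    qed
    then show "\<Union>\<C> \<in> \<S>" using C(1) sub unfolding \<S>_def by blast
  qed
  then obtain V where VS: "V \<in> \<S>" and max: "\<And>Y. Y \<in> \<S> \<Longrightarrow> V \<subseteq> Y \<Longrightarrow> Y = V" by blast
  have V: "closed_subring V" and RV: "R \<subseteq> V" and yV: "y \<in> V" and xV: "x \<notin> V"
    using VS by (auto simp: \<S>_def)
  have adj: "x \<in> adjoin V t" if "t \<notin> V" for t
  proof (rule ccontr)
    assume "x \<notin> adjoin V t"
    then have "adjoin V t \<in> \<S>" using adjoin_subring[OF V, of t] RV yV by (auto simp: \<S>_def)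
    from max[OF this] adjoin_subring[OF V, of t] that show False by auto
  qed
  have unit: "1 - y * r \<noteq> 0 \<and> inverse (1 - y * r) \<in> V" if r: "r \<in> V" for r
  proof
    define s where "s = 1 - y * r"
    show nz': "1 - y * r \<noteq> 0"
    proof
      assume "1 - y * r = 0"
      then have "x = r" using nz by (simp add: y_def field_simps)
      with xV r show False by simp
    qed
    show "inverse (1 - y * r) \<in> V"
    proof (rule ccontr)
      assume "inverse (1 - y * r) \<notin> V"
      then obtain p where p: "p \<in> polys_over V" "poly p (inverse s) = x"
        using adj by (auto simp: adjoin_def s_def)
      have s: "s \<in> V" "s \<noteq> 0" unfolding s_def using V yV r nz' by (auto intro!: closed_subringD)
      have "\<exists>w\<in>V. s ^ n = 1 - y * w" for n
      proof (induction n)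
        case 0 then show ?case using V by (intro bexI[of _ 0]) (auto simp: closed_subringD)
      next
        case (Suc n)
        then obtain w where w: "w \<in> V" "s ^ n = 1 - y * w" by auto
        have "s ^ Suc n = (1 - y * r) * (1 - y * w)" unfolding power_Suc w(2) by (simp add: s_def)
        also have "\<dots> = 1 - y * (w + r - y * r * w)" by (simp add: algebra_simps)
        finally have "s ^ Suc n = 1 - y * (w + r - y * r * w)" .
        moreover have "w + r - y * r * w \<in> V" using V w yV r by (auto intro!: closed_subringD)
        ultimately show ?case by blast
      qed
      then obtain w where w: "w \<in> V" "s ^ degree p = 1 - y * w" by blast
      have "s ^ degree p * x \<in> V"
        using poly_reflect_poly_nz[OF s(2), of p] p V s
        by (metis poly_in_closed_subring reflect_poly_in_polys_over)
      moreover have "s ^ degree p * x = x - w" using nz by (simp add: w y_def field_simps)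
      ultimately have "x - w + w \<in> V" using V w closed_subringD(5) by metis
      then show False using xV by simp
    qed
  qed
  \<comment> \<open>Otherwise \<open>x\<close> is a polynomial in \<open>z\<close> and one in \<open>1/z\<close>; of two such polynomials of minimal
     degrees, the one of larger degree can be shortened.\<close>
  have "z \<in> V \<or> inverse z \<in> V" for z
  proof (rule ccontr)
    assume neg: "\<not> (z \<in> V \<or> inverse z \<in> V)"
    then have z: "z \<noteq> 0" using V by (auto simp: closed_subringD)
    define P where "P w p \<longleftrightarrow> p \<in> polys_over V \<and> poly p w = x" for w p
    have deg: "degree p \<ge> 1" if "P w p" for w p
    proof (rule ccontr)
      assume "\<not> degree p \<ge> 1"
      then obtain c where "p = [:c:]" by (metis degree_eq_zeroE less_one not_le)
      then have "x = coeff p 0" using that by (auto simp: P_def)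
      then show False using that xV by (auto simp: P_def polys_over_def)
    qed
    have ex: "\<exists>p. P w p \<and> (\<forall>q. P w q \<longrightarrow> degree p \<le> degree q)" if "w \<notin> V" for w
      using adj[OF that] ex_has_least_nat[of "P w" _ degree] by (auto simp: adjoin_def P_def)
    obtain p where p: "P z p" "\<And>q. P z q \<Longrightarrow> degree p \<le> degree q" using ex neg by blast
    obtain p' where p': "P (inverse z) p'" "\<And>q. P (inverse z) q \<Longrightarrow> degree p' \<le> degree q"
      using ex neg by blast
    show False
    proof (cases "degree p' \<le> degree p")
      case True
      then have "\<exists>r\<in>polys_over V. poly r z = x \<and> degree r < degree p"
        using p p' z nz unit yV V deg
        by (intro valuation_ring_reduce_degree[where p' = p']) (auto simp: P_def y_def)
      then show False using p by (auto simp: P_def not_less[symmetric])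
    next
      case False
      then have "\<exists>r\<in>polys_over V. poly r (inverse z) = x \<and> degree r < degree p'"
        using p p' z nz unit yV V deg
        by (intro valuation_ring_reduce_degree[where p' = p]) (auto simp: P_def y_def)
      then show False using p' by (auto simp: P_def not_less[symmetric])
    qed
  qed
  then have "valuation_ring V" using V by (auto simp: valuation_ring_def)
  with RV xV show thesis by (intro that)
qed

lemma valuation_ringD: "valuation_ring V \<Longrightarrow> closed_subring V"
  by (simp add: valuation_ring_def)

lemma nonunits_iff: "valuation_ring V \<Longrightarrow> x \<in> nonunits V \<longleftrightarrow> x = 0 \<or> inverse x \<notin> V"
  by (auto simp: nonunits_def valuation_ring_def closed_subringD)

lemma nonunits_mult:
  assumes V: "valuation_ring V" and a: "a \<in> V" and x: "x \<in> nonunits V"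
  shows "a * x \<in> nonunits V"
proof -
  have "inverse x \<in> V" if "inverse (a * x) \<in> V" "a * x \<noteq> 0"
  proof -
    have "a * inverse (a * x) \<in> V" using a that valuation_ringD[OF V] by (auto intro: closed_subringD)
    then show ?thesis using that by (simp add: field_simps)
  qed
  then show ?thesis using x by (auto simp: nonunits_iff[OF V])
qed

lemma nonunits_add:
  assumes V: "valuation_ring V" and xy: "x \<in> nonunits V" "y \<in> nonunits V"
  shows "x + y \<in> nonunits V"
proof (cases "x = 0 \<or> y = 0")
  case True then show ?thesis using xy by auto
next
  case False
  have *: "x + y \<in> nonunits V" if "x / y \<in> V" "y \<in> nonunits V" "y \<noteq> 0" for x y
  proof -
    have "(x / y + 1) * y \<in> nonunits V"
      using that valuation_ringD[OF V] by (intro nonunits_mult[OF V] closed_subringD)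
    moreover have "(x / y + 1) * y = x + y" using that by (simp add: distrib_right)
    ultimately show ?thesis by simp
  qed
  have "x / y \<in> V \<or> y / x \<in> V" using V unfolding valuation_ring_def by (metis inverse_divide)
  then show ?thesis using *[of x y] *[of y x] xy False by (auto simp: add.commute)
qed

lemma nonunits_uminus: "valuation_ring V \<Longrightarrow> x \<in> nonunits V \<Longrightarrow> - x \<in> nonunits V"
  using nonunits_mult[of V "-1" x] by (auto simp: closed_subringD valuation_ringD)

lemma nonunits_diff: "valuation_ring V \<Longrightarrow> x \<in> nonunits V \<Longrightarrow> y \<in> nonunits V \<Longrightarrow> x - y \<in> nonunits V"
  using nonunits_add[of V x "- y"] nonunits_uminus[of V y] by simp

lemma zero_nonunit: "valuation_ring V \<Longrightarrow> 0 \<in> nonunits V"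
  by (simp add: nonunits_iff)

lemma one_not_nonunit: "valuation_ring V \<Longrightarrow> 1 \<notin> nonunits V"
  by (simp add: nonunits_iff valuation_ringD closed_subringD)

lemma nonunits_sum: "valuation_ring V \<Longrightarrow> (\<And>i. i \<in> I \<Longrightarrow> f i \<in> nonunits V) \<Longrightarrow> sum f I \<in> nonunits V"
  by (induction I rule: infinite_finite_induct) (auto simp: zero_nonunit intro: nonunits_add)

lemma nonunits_subset: "nonunits V \<subseteq> V"
  by (auto simp: nonunits_def)

lemma nonunits_prime:
  assumes V: "valuation_ring V" and "x * y \<in> nonunits V" "x \<in> V" "y \<in> V"
  shows "x \<in> nonunits V \<or> y \<in> nonunits V"
  using assms valuation_ringD[OF V] by (auto simp: nonunits_iff intro: closed_subringD)

lemma inverse_nonunit: "valuation_ring V \<Longrightarrow> x \<notin> V \<Longrightarrow> inverse x \<in> nonunits V"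
  by (simp add: nonunits_iff)

lemma monic_poly_split:
  fixes p :: "'a::comm_ring_1 poly"
  shows "lead_coeff p = 1 \<Longrightarrow> poly p x = x ^ degree p + (\<Sum>i<degree p. coeff p i * x ^ i)"
  unfolding poly_altdef lessThan_Suc_atMost[symmetric] sum.lessThan_Suc by simp

text \<open>Divide the integral equation of degree \<open>n\<close> by \<open>x^(n-1)\<close>.\<close>
lemma integral_in_subring_if_inverse_mem:
  fixes S :: "'a::field set"
  assumes S: "closed_subring S" and ix: "inverse x \<in> S" and int: "integral_over S x"
  shows "x \<in> S"
proof (cases "x = 0")
  case True then show ?thesis using S by (simp add: closed_subringD)
next
  case nz: False
  from int obtain p where p: "p \<in> polys_over S" "lead_coeff p = 1" "poly p x = 0"
    by (auto simp: integral_over_def)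
  define n where "n = degree p"
  have eq: "x ^ n = - (\<Sum>i<n. coeff p i * x ^ i)"
    using monic_poly_split[OF p(2), of x] p(3) by (simp add: n_def eq_neg_iff_add_eq_0)
  have "n \<noteq> 0" using eq by (intro notI) simp
  then obtain m where m: "n = Suc m" using not0_implies_Suc by blast
  have "x = x ^ n * inverse x ^ m" using nz by (simp add: m power_inverse)
  also have "\<dots> = - (\<Sum>i<n. coeff p i * x ^ i * inverse x ^ m)"
    unfolding eq by (simp add: sum_distrib_right)
  also have "\<dots> \<in> S"
  proof (intro closed_subringD(4)[OF S] closed_subring_sum[OF S])
    fix i assume "i \<in> {..<n}"
    then have i: "m = i + (m - i)" by (simp add: m)
    have eq': "coeff p i * x ^ i * inverse x ^ m = coeff p i * inverse x ^ (m - i)"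
      by (subst i, subst power_add) (use nz in \<open>simp add: power_inverse\<close>)
    show "coeff p i * x ^ i * inverse x ^ m \<in> S" unfolding eq' using p(1)
      by (intro closed_subringD(6)[OF S] closed_subring_power[OF S ix]) (auto simp: polys_over_def)
  qed
  finally show ?thesis .
qed

lemma integral_over_valuation_ring:
  "valuation_ring V \<Longrightarrow> integral_over V x \<Longrightarrow> x \<in> V"
  using integral_in_subring_if_inverse_mem unfolding valuation_ring_def by blast

lemma integral_over_mono: "R \<subseteq> S \<Longrightarrow> integral_over R x \<Longrightarrow> integral_over S x"
  using polys_over_mono[of R S] by (auto simp: integral_over_def)

text \<open>This is how integrality is proved and used below. In particular it makes the integral closure a
  ring without any elimination of equations.\<close>
lemma integral_over_iff_valuation_rings:
  fixes R :: "'a::field set"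
  assumes "closed_subring R"
  shows "integral_over R x \<longleftrightarrow> (\<forall>V. valuation_ring V \<and> R \<subseteq> V \<longrightarrow> x \<in> V)"
  using valuation_ring_avoiding[OF assms, of x] integral_over_valuation_ring integral_over_mono
  by metis

text \<open>Divisibility in a valuation ring is a total preorder, so a finite family has an element of largest
  absolute value.\<close>
lemma valuation_ring_dominant:
  assumes V: "valuation_ring V" and fin: "finite I" and nz: "j \<in> I" "f j \<noteq> 0"
  obtains i where "i \<in> I" "f i \<noteq> 0" "\<And>j. j \<in> I \<Longrightarrow> f j / f i \<in> V"
proof -
  define J where "J = {j\<in>I. f j \<noteq> 0}"
  have "finite J" "J \<noteq> {}" using fin nz by (auto simp: J_def)
  moreover have "\<forall>j\<in>J. f j \<noteq> 0" by (auto simp: J_def)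
  ultimately have "\<exists>i\<in>J. \<forall>j\<in>J. f j / f i \<in> V"
  proof (induction J rule: finite_ne_induct)
    case (singleton x) then show ?case using valuation_ringD[OF V] by (auto simp: closed_subringD)
  next
    case (insert x J)
    then obtain i where i: "i \<in> J" "\<And>j. j \<in> J \<Longrightarrow> f j / f i \<in> V" by auto
    have "f x / f i \<in> V \<or> f i / f x \<in> V" using V unfolding valuation_ring_def by (metis inverse_divide)
    then show ?case
    proof
      assume "f x / f i \<in> V" then show ?thesis using i by auto
    next
      assume ix: "f i / f x \<in> V"
      have "f j / f x \<in> V" if "j \<in> J" for j
      proof -
        have "f j / f x = (f j / f i) * (f i / f x)" using insert.prems i(1) by simp
        then show ?thesis using closed_subringD(6)[OF valuation_ringD[OF V] i(2)[OF that] ix] by metis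
      qed
      then show ?thesis using insert.prems valuation_ringD[OF V] by (auto simp: closed_subringD)
    qed
  qed
  then obtain i where i: "i \<in> J" "\<forall>j\<in>J. f j / f i \<in> V" by auto
  show thesis
  proof (rule that)
    show "i \<in> I" "f i \<noteq> 0" using i by (auto simp: J_def)
    show "f j / f i \<in> V" if "j \<in> I" for j
      using i that valuation_ringD[OF V] by (cases "f j = 0") (auto simp: J_def closed_subringD)
  qed
qed

section \<open>Ultrapowers of fields\<close>

text \<open>Infinitely many points of a variety over a field are merged into a single point over an
  ultrapower of the field. Sequences indexed by \<open>nat\<close> suffice.\<close>
definition free_ultrafilter :: "nat set set \<Rightarrow> bool" where
  "free_ultrafilter U \<longleftrightarrow> (\<forall>A. A \<in> U \<or> - A \<in> U) \<and> (\<forall>A\<in>U. \<forall>B\<in>U. A \<inter> B \<in> U)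
     \<and> (\<forall>A\<in>U. \<forall>B. A \<subseteq> B \<longrightarrow> B \<in> U) \<and> (\<forall>A\<in>U. infinite A)"

text \<open>A maximal family all of whose finite intersections are infinite.\<close>
lemma free_ultrafilter_exists: "\<exists>U. free_ultrafilter U"
proof -
  define \<F> where "\<F> = {S::nat set set. \<forall>T. finite T \<longrightarrow> T \<subseteq> S \<longrightarrow> infinite (\<Inter>T)}"
  have "\<exists>M\<in>\<F>. \<forall>Y\<in>\<F>. M \<subseteq> Y \<longrightarrow> Y = M"
  proof (rule subset_Zorn_nonempty)
    show "\<F> \<noteq> {}" by (auto simp: \<F>_def intro!: exI[of _ "{}"])
    fix \<C> assume C: "\<C> \<noteq> {}" "subset.chain \<F> \<C>"
    have "infinite (\<Inter>T)" if T: "finite T" "T \<subseteq> \<Union>\<C>" for T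
    proof -
      obtain S where "S \<in> \<C>" "T \<subseteq> S" using finite_subset_Union_chain[OF T C] by auto
      then show ?thesis using C(2) T(1) by (auto simp: \<F>_def subset.chain_def)
    qed
    then show "\<Union>\<C> \<in> \<F>" by (auto simp: \<F>_def)
  qed
  then obtain U where "U \<in> \<F>" and max: "\<And>Y. Y \<in> \<F> \<Longrightarrow> U \<subseteq> Y \<Longrightarrow> Y = U" by blast
  then have U: "infinite (\<Inter>T)" if "finite T" "T \<subseteq> U" for T using that by (auto simp: \<F>_def)
  have ex: "\<exists>T. finite T \<and> T \<subseteq> U \<and> finite (A \<inter> \<Inter>T)" if A: "A \<notin> U" for A
  proof (rule ccontr)
    assume neg: "\<not> (\<exists>T. finite T \<and> T \<subseteq> U \<and> finite (A \<inter> \<Inter>T))"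
    have "infinite (\<Inter>T)" if T: "finite T" "T \<subseteq> insert A U" for T
    proof -
      have "finite (T - {A})" "T - {A} \<subseteq> U" using T by auto
      with neg[unfolded not_ex, rule_format, of "T - {A}"]
      have "infinite (A \<inter> \<Inter>(T - {A}))" by (simp only: simp_thms)
      moreover have "A \<inter> \<Inter>(T - {A}) \<subseteq> \<Inter>T" by auto
      ultimately show ?thesis using finite_subset by blast
    qed
    then have "insert A U \<in> \<F>" by (auto simp: \<F>_def)
    from max[OF this] A show False by auto
  qed
  have or: "A \<in> U \<or> - A \<in> U" for A
  proof (rule ccontr)
    assume "\<not> ?thesis"
    then obtain S T where "finite S" "S \<subseteq> U" "finite (A \<inter> \<Inter>S)"
      "finite T" "T \<subseteq> U" "finite (- A \<inter> \<Inter>T)" using ex by meson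
    moreover have "\<Inter>(S \<union> T) \<subseteq> (A \<inter> \<Inter>S) \<union> (- A \<inter> \<Inter>T)" by auto
    ultimately have "finite (\<Inter>(S \<union> T))" by (meson finite_UnI finite_subset)
    with U[of "S \<union> T"] \<open>finite S\<close> \<open>finite T\<close> \<open>S \<subseteq> U\<close> \<open>T \<subseteq> U\<close> show False by auto
  qed
  have "free_ultrafilter U" unfolding free_ultrafilter_def
  proof (intro conjI allI ballI impI or)
    fix A B assume A: "A \<in> U"
    show "infinite A" using U[of "{A}"] A by auto
    { assume B: "B \<in> U"
      have "\<Inter>{A, B, - (A \<inter> B)} = {}" by auto
      then show "A \<inter> B \<in> U"
        using or[of "A \<inter> B"] U[of "{A, B, - (A \<inter> B)}"] A B
        by (metis empty_subsetI finite.emptyI finite.insertI insert_subset) }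
    { assume "A \<subseteq> B" 
      then have "\<Inter>{A, - B} = {}" by auto
      then show "B \<in> U"
        using or[of B] U[of "{A, - B}"] A by auto }
  qed
  then show ?thesis by auto
qed

definition ultrafilter :: "nat set set" where "ultrafilter = (SOME U. free_ultrafilter U)"

lemma ultrafilter:
  shows ultrafilter_or: "A \<in> ultrafilter \<or> - A \<in> ultrafilter"
    and ultrafilter_Int: "A \<in> ultrafilter \<Longrightarrow> B \<in> ultrafilter \<Longrightarrow> A \<inter> B \<in> ultrafilter"
    and ultrafilter_mono: "A \<in> ultrafilter \<Longrightarrow> A \<subseteq> B \<Longrightarrow> B \<in> ultrafilter"
    and ultrafilter_infinite: "A \<in> ultrafilter \<Longrightarrow> infinite A"
proof -
  have U: "free_ultrafilter ultrafilter"
    unfolding ultrafilter_def by (rule someI_ex[OF free_ultrafilter_exists])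
  show "A \<in> ultrafilter \<or> - A \<in> ultrafilter"
    using U by (simp add: free_ultrafilter_def)
  show "A \<in> ultrafilter \<Longrightarrow> B \<in> ultrafilter \<Longrightarrow> A \<inter> B \<in> ultrafilter"
    using U by (simp add: free_ultrafilter_def)
  show "A \<in> ultrafilter \<Longrightarrow> A \<subseteq> B \<Longrightarrow> B \<in> ultrafilter"
    using U unfolding free_ultrafilter_def by blast
  show "A \<in> ultrafilter \<Longrightarrow> infinite A"
    using U by (simp add: free_ultrafilter_def)
qed

lemma ultrafilter_mono2:
  "A \<in> ultrafilter \<Longrightarrow> B \<in> ultrafilter \<Longrightarrow> A \<inter> B \<subseteq> C \<Longrightarrow> C \<in> ultrafilter"
  by (rule ultrafilter_mono[OF ultrafilter_Int])

lemma UNIV_in_ultrafilter [simp]: "UNIV \<in> ultrafilter"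
  using ultrafilter_or[of UNIV] ultrafilter_mono by blast

lemma empty_notin_ultrafilter [simp]: "{} \<notin> ultrafilter"
  using ultrafilter_infinite by blast

quotient_type 'a ultrapower = "nat \<Rightarrow> 'a" / "\<lambda>f g. {n. f n = g n} \<in> ultrafilter"
proof (rule equivpI)
  show "reflp (\<lambda>f g. {n. f n = g n} \<in> ultrafilter)" by (auto intro: reflpI)
  show "symp (\<lambda>f g. {n. f n = g n} \<in> ultrafilter)" by (auto intro!: sympI simp: eq_commute)
  show "transp (\<lambda>f g. {n. f n = g n} \<in> ultrafilter)"
    by (rule transpI) (erule (1) ultrafilter_mono2, auto)
qed

instantiation ultrapower :: (field) field
begin

lift_definition zero_ultrapower :: "'a ultrapower" is "\<lambda>n. 0" .
lift_definition one_ultrapower :: "'a ultrapower" is "\<lambda>n. 1" .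
lift_definition plus_ultrapower :: "'a ultrapower \<Rightarrow> 'a ultrapower \<Rightarrow> 'a ultrapower" is "\<lambda>f g n. f n + g n"
  by (erule (1) ultrafilter_mono2) auto
lift_definition minus_ultrapower :: "'a ultrapower \<Rightarrow> 'a ultrapower \<Rightarrow> 'a ultrapower" is "\<lambda>f g n. f n - g n"
  by (erule (1) ultrafilter_mono2) auto
lift_definition times_ultrapower :: "'a ultrapower \<Rightarrow> 'a ultrapower \<Rightarrow> 'a ultrapower" is "\<lambda>f g n. f n * g n"
  by (erule (1) ultrafilter_mono2) auto
lift_definition divide_ultrapower :: "'a ultrapower \<Rightarrow> 'a ultrapower \<Rightarrow> 'a ultrapower" is "\<lambda>f g n. f n / g n"
  by (erule (1) ultrafilter_mono2) auto
lift_definition uminus_ultrapower :: "'a ultrapower \<Rightarrow> 'a ultrapower" is "\<lambda>f n. - f n"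
  by (erule ultrafilter_mono) auto
lift_definition inverse_ultrapower :: "'a ultrapower \<Rightarrow> 'a ultrapower" is "\<lambda>f n. inverse (f n)"
  by (erule ultrafilter_mono) auto

instance
proof
  fix a b c :: "'a ultrapower"
  show "a + b + c = a + (b + c)" by transfer (simp add: add.assoc)
  show "a + b = b + a" by transfer (simp add: add.commute)
  show "0 + a = a" by transfer simp
  show "- a + a = 0" by transfer simp
  show "a - b = a + - b" by transfer simp
  show "a * b * c = a * (b * c)" by transfer (simp add: mult.assoc)
  show "a * b = b * a" by transfer (simp add: mult.commute)
  show "1 * a = a" by transfer simp
  show "(a + b) * c = a * c + b * c" by transfer (simp add: distrib_right)
  show "(0::'a ultrapower) \<noteq> 1" by transfer simp
  show "inverse a * a = 1" if "a \<noteq> 0"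
    using that
  proof transfer
    fix f :: "nat \<Rightarrow> 'a"
    assume "{n. f n = 0} \<notin> ultrafilter"
    then have "- {n. f n = 0} \<in> ultrafilter" using ultrafilter_or by blast
    then show "{n. inverse (f n) * f n = 1} \<in> ultrafilter"
      by (rule ultrafilter_mono) auto
  qed
  show "a div b = a * inverse b" by transfer (simp add: divide_inverse)
  show "inverse (0::'a ultrapower) = 0" by transfer simp
qed

end

lift_definition of_seq :: "(nat \<Rightarrow> 'a) \<Rightarrow> 'a ultrapower" is "\<lambda>f. f" .

lemma of_seq_eq_iff: "of_seq f = of_seq g \<longleftrightarrow> {n. f n = g n} \<in> ultrafilter"
  by transfer simp

lemma of_seq_cases: obtains f where "x = of_seq f"
proof -
  have "\<exists>f. x = of_seq f"
  proof transfer
    fix x :: "nat \<Rightarrow> 'a"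
    show "\<exists>f. {n. x n = f n} \<in> ultrafilter" by (rule exI[of _ x]) simp
  qed
  then show thesis using that by blast
qed

lemma of_seq_simps:
  "of_seq f + of_seq g = of_seq (\<lambda>n. f n + g n)" "of_seq f - of_seq g = of_seq (\<lambda>n. f n - g n)"
  "of_seq f * of_seq g = of_seq (\<lambda>n. f n * g n)" "of_seq f / of_seq g = of_seq (\<lambda>n. f n / g n)"
  "inverse (of_seq f) = of_seq (\<lambda>n. inverse (f n))"
  "of_seq (\<lambda>n. 0) = 0" "of_seq (\<lambda>n. 1) = 1"
  by (transfer; simp)+

lemma of_seq_power: "of_seq f ^ k = of_seq (\<lambda>n. f n ^ k)"
  by (induction k) (simp_all add: of_seq_simps)

lemma of_seq_sum: "(\<Sum>i\<in>I. of_seq (f i)) = of_seq (\<lambda>n. \<Sum>i\<in>I. f i n)"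
  by (induction I rule: infinite_finite_induct) (simp_all add: of_seq_simps)

definition ultra_const :: "'a \<Rightarrow> 'a ultrapower" where
  "ultra_const a = of_seq (\<lambda>n. a)"

lemma poly_of_seq: "poly (map_poly ultra_const p) (of_seq f) = of_seq (\<lambda>n. poly p (f n))"
  for p :: "'a::field poly"
proof -
  have 0: "ultra_const (0::'a) = 0" by (simp add: ultra_const_def of_seq_simps)
  show ?thesis
    by (induction p) (auto simp: map_poly_pCons 0 of_seq_simps ultra_const_def)
qed

lemma ultrapower_root:
  fixes x :: "'a::alg_closed_field ultrapower"
  assumes "k \<ge> 1" shows "\<exists>y. y ^ k = x"
proof -
  obtain f where x: "x = of_seq f" by (rule of_seq_cases)
  have "\<forall>n. \<exists>y. y ^ k = f n" using nth_root_exists[of k] assms by auto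
  then obtain g where "\<And>n. g n ^ k = f n" by metis
  then show ?thesis by (intro exI[of _ "of_seq g"]) (simp add: x of_seq_power)
qed

text \<open>By the transfer of a polynomial equation, almost all members of the sequence would lie in the finite
  set of roots of one polynomial.\<close>

lemma injective_seq_not_integral:
  fixes f :: "nat \<Rightarrow> 'a::field"
  assumes inj: "inj f"
  shows "\<not> integral_over (range ultra_const) (of_seq f)"
proof
  assume "integral_over (range ultra_const) (of_seq f)"
  then obtain p where p: "p \<in> polys_over (range ultra_const)" "lead_coeff p = 1" "poly p (of_seq f) = 0"
    by (auto simp: integral_over_def)
  have inj': "inj (ultra_const :: 'a \<Rightarrow> _)"
    by (rule injI) (auto simp: ultra_const_def of_seq_eq_iff split: if_splits)
  have 0: "ultra_const (0::'a) = 0" by (simp add: ultra_const_def of_seq_simps)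
  define q where "q = map_poly (inv_into UNIV ultra_const) p"
  have inv0: "inv_into UNIV ultra_const 0 = (0::'a)" using inv_f_f[OF inj', of 0] 0 by simp
  have pq: "p = map_poly ultra_const q"
    by (rule poly_eqI)
       (use p(1) in \<open>auto simp: q_def coeff_map_poly 0 inv0 polys_over_def f_inv_into_f\<close>)
  have "q \<noteq> 0" using p(2) pq by auto
  have "of_seq (\<lambda>n. poly q (f n)) = 0" using p(3) pq poly_of_seq by metis
  then have "{n. poly q (f n) = 0} \<in> ultrafilter" by (simp flip: of_seq_simps(6) add: of_seq_eq_iff)
  then have "infinite {n. poly q (f n) = 0}" by (rule ultrafilter_infinite)
  moreover have "finite (f -` {x. poly q x = 0})"
    by (rule finite_vimageI[OF poly_roots_finite inj]) (use \<open>q \<noteq> 0\<close> in simp)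
  ultimately show False by (simp add: vimage_def)
qed

section \<open>Reductions of twisted homomorphisms\<close>

lemma synthetic_div_in_polys_over:
  "closed_subring R \<Longrightarrow> p \<in> polys_over R \<Longrightarrow> x \<in> R \<Longrightarrow> synthetic_div p x \<in> polys_over R"
proof (induction p)
  case 0 then show ?case by simp
next
  case (pCons a p)
  then have p: "p \<in> polys_over R"
    by (auto simp: polys_over_def coeff_pCons split: nat.splits)
  show ?case unfolding synthetic_div_pCons
    by (intro pCons_in_polys_over poly_in_closed_subring pCons.IH p pCons.prems)
qed

text \<open>A polynomial over the residue field has at most as many zeros as its degree.\<close>
lemma card_roots_mod_nonunits:
  fixes V :: "'a::field set"
  assumes V: "valuation_ring V"
  shows "p \<in> polys_over V \<Longrightarrow> lead_coeff p = 1 \<Longrightarrow> finite Z \<Longrightarrow> Z \<subseteq> V \<Longrightarrow>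
    (\<And>x y. x \<in> Z \<Longrightarrow> y \<in> Z \<Longrightarrow> x \<noteq> y \<Longrightarrow> x - y \<notin> nonunits V) \<Longrightarrow>
    (\<And>x. x \<in> Z \<Longrightarrow> poly p x \<in> nonunits V) \<Longrightarrow> card Z \<le> degree p"
proof (induction "degree p" arbitrary: p Z)
  case 0
  then obtain a where "p = [:a:]" by (metis degree_eq_zeroE)
  with "0.prems"(2) have "p = 1" by (simp add: one_pCons)
  then have "Z = {}" using "0.prems"(6) one_not_nonunit[OF V] by auto
  then show ?case by simp
next
  case (Suc d)
  note R = valuation_ringD[OF V]
  show ?case
  proof (cases "Z = {}")
    case False
    then obtain z where z: "z \<in> Z" by auto
    define s where "s = synthetic_div p z"
    have ds: "degree s = d" using Suc.hyps(2) by (simp add: s_def degree_synthetic_div)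
    have eq: "p + smult z s = pCons (poly p z) s" unfolding s_def by (rule synthetic_div_correct)
    have "coeff (p + smult z s) (Suc d) = coeff s d" by (simp add: eq)
    then have ls: "lead_coeff s = 1" using Suc.prems(2) Suc.hyps(2)[symmetric] ds
      by (simp add: coeff_eq_0)
    have "card (Z - {z}) \<le> degree s"
    proof (rule Suc.hyps(1))
      show "d = degree s" by (simp add: ds)
      show "s \<in> polys_over V" unfolding s_def
        using Suc.prems z by (intro synthetic_div_in_polys_over R) auto
      show "lead_coeff s = 1" by (rule ls)
      show "finite (Z - {z})" "Z - {z} \<subseteq> V" using Suc.prems by auto
      show "x - y \<notin> nonunits V" if "x \<in> Z - {z}" "y \<in> Z - {z}" "x \<noteq> y" for x y
        using that Suc.prems(5) by auto
      fix y assume y: "y \<in> Z - {z}"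
      have "poly (p + smult z s) y = poly (pCons (poly p z) s) y" by (simp only: eq)
      then have "(y - z) * poly s y = poly p y - poly p z" by (simp add: algebra_simps)
      then have "(y - z) * poly s y \<in> nonunits V"
        using nonunits_diff[OF V Suc.prems(6) Suc.prems(6)[OF z], of y] y by auto
      moreover have "y - z \<in> V" "poly s y \<in> V"
        using Suc.prems(1,4) y z R \<open>s \<in> polys_over V\<close>
        by (auto intro!: poly_in_closed_subring closed_subringD(3))
      ultimately show "poly s y \<in> nonunits V"
        using nonunits_prime[OF V] Suc.prems(5)[of y z] y z by auto
    qed
    then show ?thesis using z Suc.prems(3) Suc.hyps(2) ds by (simp add: card_Diff_singleton)
  qed simp
qed

text \<open>Such a set consists of the multiples of its least positive element.\<close>
lemma Gcd_mem_of_additive_cancellative: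
  fixes Q S :: "nat set"
  assumes add: "\<And>m n. m \<in> Q \<Longrightarrow> n \<in> Q \<Longrightarrow> m + n \<in> Q"
    and cancel: "\<And>m n. m \<in> Q \<Longrightarrow> m + n \<in> Q \<Longrightarrow> n \<in> Q"
    and 0: "0 \<in> Q" and S: "S \<subseteq> Q"
  shows "Gcd S \<in> Q"
proof (cases "\<exists>n\<in>Q. n > 0")
  case False
  then have "S \<subseteq> {0}" using S by auto
  then have "Gcd S = 0" by auto
  then show ?thesis using 0 by (simp only:)
next
  case True
  define d where "d = (LEAST n. n \<in> Q \<and> n > 0)"
  have d: "d \<in> Q" "d > 0" using LeastI_ex[of "\<lambda>n. n \<in> Q \<and> n > 0"] True by (auto simp: d_def)
  have mult: "d * k \<in> Q" for k by (induction k) (auto intro: 0 add d)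
  have "d dvd n" if "n \<in> Q" for n
  proof -
    have "n mod d \<in> Q" using cancel[OF mult[of "n div d"], of "n mod d"] that by simp
    then have "n mod d = 0" using not_less_Least[of "n mod d" "\<lambda>n. n \<in> Q \<and> n > 0"] d
      by (auto simp: d_def)
    then show ?thesis by auto
  qed
  then have "d dvd Gcd S" using S by (auto intro: Gcd_greatest)
  then show ?thesis using mult by auto
qed

text \<open>
  The coefficients \<open>c a i\<close> of \<open>x^(q^i)\<close> in additive polynomials \<open>f\<^sub>a\<close> with \<open>f\<^sub>a\<^sub>b = f\<^sub>a \<circ> f\<^sub>b\<close>. In this
  form the law of composition passes componentwise to ultrapowers and is compatible with scaling.
\<close>
definition twisted_hom :: "nat \<Rightarrow> 'a::comm_ring_1 set \<Rightarrow> ('a \<Rightarrow> nat \<Rightarrow> 'e::field) \<Rightarrow> bool" where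
  "twisted_hom q A c \<longleftrightarrow>
     (\<forall>a\<in>A. \<forall>b\<in>A. \<forall>n. c (a - b) n = c a n - c b n \<and>
        c (a * b) n = (\<Sum>i\<le>n. c a i * c b (n - i) ^ q ^ i)) \<and>
     (\<forall>a\<in>A. \<exists>N. \<forall>i\<ge>N. c a i = 0)"

lemma power_power_additive:
  fixes x y :: "'e::comm_ring_1"
  assumes "\<And>x y :: 'e. (x + y) ^ q = x ^ q + y ^ q"
  shows "(x + y) ^ q ^ n = x ^ q ^ n + y ^ q ^ n" "(x - y) ^ q ^ n = x ^ q ^ n - y ^ q ^ n"
proof -
  show *: "(x + y) ^ q ^ n = x ^ q ^ n + y ^ q ^ n" for x y :: 'e
    by (induction n) (simp_all add: assms power_mult mult.commute[of q])
  show "(x - y) ^ q ^ n = x ^ q ^ n - y ^ q ^ n" using *[of "x - y" y] by simp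
qed

text \<open>
  The reduction modulo the maximal ideal of \<open>V\<close> is a homomorphism from \<open>A\<close> to the additive polynomials
  over the residue field. By \<open>c_0\<close> it is injective, and by \<open>nonconst\<close> it is not just \<open>a x\<close>.
\<close>
locale twisted_reduction =
  fixes q :: nat and A :: "'a::idom set" and V :: "'e::field set" and c :: "'a \<Rightarrow> nat \<Rightarrow> 'e"
  assumes q: "q \<ge> 2"
    and frob: "\<And>x y :: 'e. (x + y) ^ q = x ^ q + y ^ q"
    and A: "closed_subring A"
    and V: "valuation_ring V"
    and hom: "twisted_hom q A c"
    and c_V: "\<And>a i. a \<in> A \<Longrightarrow> c a i \<in> V"
    and c_0: "\<And>a. a \<in> A \<Longrightarrow> a \<noteq> 0 \<Longrightarrow> c a 0 \<notin> nonunits V"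
    and nonconst: "\<exists>b\<in>A. \<exists>i\<ge>1. c b i \<notin> nonunits V"
begin

abbreviation \<m> where "\<m> \<equiv> nonunits V"

lemma R: "closed_subring V" by (rule valuation_ringD[OF V])

lemma c_diff: "a \<in> A \<Longrightarrow> b \<in> A \<Longrightarrow> c (a - b) i = c a i - c b i"
  and c_mult: "a \<in> A \<Longrightarrow> b \<in> A \<Longrightarrow> c (a * b) n = (\<Sum>i\<le>n. c a i * c b (n - i) ^ q ^ i)"
  and c_fin: "a \<in> A \<Longrightarrow> \<exists>N. \<forall>i\<ge>N. c a i = 0"
  using hom by (auto simp: twisted_hom_def)

lemma q_pow_pos: "q ^ i \<ge> 1" using q by simp

lemma nonunit_power: "x \<in> \<m> \<Longrightarrow> x ^ q ^ i \<in> \<m>"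
proof -
  assume x: "x \<in> \<m>"
  have "x ^ q ^ i = x ^ (q ^ i - 1) * x" using q_pow_pos[of i] by (metis le_add_diff_inverse2 power_add power_one_right)
  then show ?thesis using nonunits_mult[OF V closed_subring_power[OF R] x] x nonunits_subset by auto
qed

text \<open>The elements of \<open>A\<close> whose reduction has degree less than \<open>q^n\<close>.\<close>
definition low :: "nat \<Rightarrow> 'a set" where
  "low n = {a\<in>A. \<forall>i\<ge>n. c a i \<in> \<m>}"

lemma low_mono: "m \<le> n \<Longrightarrow> low m \<subseteq> low n" by (auto simp: low_def)

lemma low_diff: "a \<in> low n \<Longrightarrow> b \<in> low n \<Longrightarrow> a - b \<in> low n"
  using A by (auto simp: low_def c_diff closed_subringD intro!: nonunits_diff[OF V])

lemma zero_low: "0 \<in> low n"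
  using low_diff c_diff[of 0 0] A zero_nonunit[OF V] by (auto simp: low_def closed_subringD)

lemma low_add: "a \<in> low n \<Longrightarrow> b \<in> low n \<Longrightarrow> a + b \<in> low n"
  using low_diff[of a n "0 - b"] low_diff[OF zero_low, of b n] by simp

lemma ex_low: "a \<in> A \<Longrightarrow> \<exists>n. a \<in> low (Suc n)"
proof -
  assume a: "a \<in> A"
  then obtain N where "\<forall>i\<ge>N. c a i = 0" using c_fin by blast
  then have "a \<in> low (Suc N)" using a zero_nonunit[OF V] by (auto simp: low_def)
  then show ?thesis by auto
qed

lemma low_0: "low 0 = {0}"
  using c_0 zero_low by (auto simp: low_def)

text \<open>At and above the top degree \<open>m + n\<close> of a product, the convolution has at most one
  term that survives the reduction: the one with \<open>i = m\<close>, in degree \<open>m + n\<close>.\<close>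
lemma mult_terms_nonunit:
  assumes "a \<in> low (Suc m)" "b \<in> low (Suc n)" and "k \<ge> m + n" "i \<le> k" "k = m + n \<Longrightarrow> i \<noteq> m"
  shows "c a i * c b (k - i) ^ q ^ i \<in> \<m>"
proof (cases "i > m")
  case True
  then have "c a i \<in> \<m>" using assms(1) by (auto simp: low_def)
  then show ?thesis using assms(2) nonunits_mult[OF V closed_subring_power[OF R c_V]]
    by (metis (no_types, lifting) low_def mem_Collect_eq mult.commute)
next
  case False
  then have "k - i \<ge> Suc n" using assms(3-5) by (cases "k = m + n") auto
  then have "c b (k - i) \<in> \<m>" using assms(2) by (auto simp: low_def)
  then show ?thesis using assms(1) by (intro nonunits_mult[OF V c_V] nonunit_power) (auto simp: low_def)
qed

lemma low_mult:
  assumes a: "a \<in> low (Suc m)" and b: "b \<in> low (Suc n)"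
  shows "a * b \<in> low (Suc (m + n))" "c (a * b) (m + n) - c a m * c b n ^ q ^ m \<in> \<m>"
proof -
  have AB: "a \<in> A" "b \<in> A" using a b by (auto simp: low_def)
  have "c (a * b) k \<in> \<m>" if "k \<ge> Suc (m + n)" for k
    unfolding c_mult[OF AB]
    by (intro nonunits_sum V mult_terms_nonunit[OF a b]) (use that in auto)
  then show "a * b \<in> low (Suc (m + n))" using AB A by (auto simp: low_def closed_subringD)
  have "c (a * b) (m + n) = c a m * c b n ^ q ^ m
      + (\<Sum>i\<in>{..m + n} - {m}. c a i * c b (m + n - i) ^ q ^ i)"
    unfolding c_mult[OF AB] by (subst sum.remove[of _ m]) auto
  moreover have "(\<Sum>i\<in>{..m + n} - {m}. c a i * c b (m + n - i) ^ q ^ i) \<in> \<m>"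
    by (intro nonunits_sum V mult_terms_nonunit[OF a b]) auto
  ultimately show "c (a * b) (m + n) - c a m * c b n ^ q ^ m \<in> \<m>" by simp
qed

lemma leading_commute:
  assumes a: "a \<in> low (Suc m)" and b: "b \<in> low (Suc n)"
  shows "c a m * c b n ^ q ^ m - c b n * c a m ^ q ^ n \<in> \<m>"
proof -
  have "(c (b * a) (n + m) - c b n * c a m ^ q ^ n) - (c (a * b) (m + n) - c a m * c b n ^ q ^ m) \<in> \<m>"
    by (rule nonunits_diff[OF V low_mult(2)[OF b a] low_mult(2)[OF a b]])
  then show ?thesis by (simp add: mult.commute[of b a] add.commute[of n m])
qed

text \<open>The exponents \<open>n\<close> such that some reduction has degree exactly \<open>q^n\<close>.\<close>
definition degs :: "nat set" where
  "degs = {n. \<exists>b\<in>low (Suc n). c b n \<notin> \<m>}"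

text \<open>The elements that reduce into the field with \<open>q^g\<close> elements, where \<open>g\<close> is the gcd of all
  degree exponents.\<close>
definition fixed :: "'e set" where
  "fixed = {z\<in>V. z ^ q ^ Gcd degs - z \<in> \<m>}"

lemma unit_mult_cancel: "x \<in> V \<Longrightarrow> x \<notin> \<m> \<Longrightarrow> y \<in> V \<Longrightarrow> x * y \<in> \<m> \<Longrightarrow> y \<in> \<m>"
  using nonunits_prime[OF V] by blast

text \<open>
  Let \<open>z\<close> be the quotient of the leading coefficients of two elements of the same degree. Commuting
  both with a third element of degree exponent \<open>r\<close> shows that \<open>z\<close> is fixed by the \<open>q^r\<close>-th power map. The set of
  such \<open>r\<close> is closed under sums and differences, so it contains the gcd of the exponents.
\<close>
lemma ratio_fixed:
  assumes a: "a \<in> low (Suc n)" and b: "b \<in> low (Suc n)" "c b n \<notin> \<m>"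
  shows "c a n / c b n \<in> fixed"
proof -
  define z where "z = c a n / c b n"
  have bV: "c b n \<in> V" "inverse (c b n) \<in> V" "c b n \<noteq> 0"
    using b c_V by (auto simp: low_def nonunits_iff[OF V])
  have aV: "c a n \<in> V" using a c_V by (auto simp: low_def)
  have zV: "z \<in> V" unfolding z_def divide_inverse by (intro closed_subringD(6) R aV bV)
  define Q where "Q = {r. z ^ q ^ r - z \<in> \<m>}"
  have "Gcd degs \<in> Q"
  proof (rule Gcd_mem_of_additive_cancellative)
    show "0 \<in> Q" using zero_nonunit[OF V] by (simp add: Q_def)
    have pw: "(z ^ q ^ m - z) ^ q ^ n = z ^ q ^ (m + n) - z ^ q ^ n" for m n
      by (simp add: power_power_additive(2)[OF frob] power_add power_mult)
    show "m + n \<in> Q" if "m \<in> Q" "n \<in> Q" for m n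
    proof -
      have "(z ^ q ^ m - z) ^ q ^ n + (z ^ q ^ n - z) \<in> \<m>"
        using that by (intro nonunits_add V nonunit_power) (auto simp: Q_def)
      then show ?thesis unfolding pw by (simp add: Q_def)
    qed
    show "n \<in> Q" if "m \<in> Q" "m + n \<in> Q" for m n
    proof -
      have "z ^ q ^ (m + n) - z \<in> \<m>" "z ^ q ^ m - z \<in> \<m>" using that by (auto simp: Q_def)
      then have "(z ^ q ^ (m + n) - z) - (z ^ q ^ m - z) ^ q ^ n \<in> \<m>"
        using nonunits_diff[OF V _ nonunit_power] by blast
      then show ?thesis unfolding pw by (simp add: Q_def)
    qed
    show "degs \<subseteq> Q"
    proof
      fix r assume "r \<in> degs"
      then obtain l where l: "l \<in> low (Suc r)" "c l r \<notin> \<m>" by (auto simp: degs_def)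
      have lV: "c l r \<in> V" using l c_V by (auto simp: low_def)
      define L x y where "L = c l r" and "x = c a n" and "y = c b n"
      have "y * (x * L ^ q ^ n - L * x ^ q ^ r) - x * (y * L ^ q ^ n - L * y ^ q ^ r) \<in> \<m>"
        unfolding L_def x_def y_def
        by (rule nonunits_diff[OF V nonunits_mult[OF V bV(1) leading_commute[OF a l(1)]]
              nonunits_mult[OF V aV leading_commute[OF b(1) l(1)]]])
      also have "y * (x * L ^ q ^ n - L * x ^ q ^ r) - x * (y * L ^ q ^ n - L * y ^ q ^ r)
        = - (L * (y * x ^ q ^ r - x * y ^ q ^ r))" by (simp add: algebra_simps)
      finally have "L * (y * x ^ q ^ r - x * y ^ q ^ r) \<in> \<m>" using nonunits_uminus[OF V] by fastforce
      then have "y * x ^ q ^ r - x * y ^ q ^ r \<in> \<m>"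
        using l(2) lV aV bV by (elim unit_mult_cancel[of L, rotated 3])
          (auto simp: L_def x_def y_def intro!: closed_subringD(3,6)[OF R] closed_subring_power[OF R])
      then have "inverse y ^ q ^ r * inverse y * (y * x ^ q ^ r - x * y ^ q ^ r) \<in> \<m>"
        using bV by (intro nonunits_mult[OF V])
          (auto simp: y_def intro!: closed_subringD(6)[OF R] closed_subring_power[OF R])
      also have "inverse y ^ q ^ r * inverse y * (y * x ^ q ^ r - x * y ^ q ^ r) = z ^ q ^ r - z"
        using bV(3) unfolding z_def x_def[symmetric] y_def[symmetric]
        by (simp add: field_simps)
      finally show "r \<in> Q" by (simp add: Q_def)
    qed
  qed
  then show ?thesis using zV by (simp add: Q_def fixed_def z_def)
qed

lemma Gcd_degs_pos: "Gcd degs > 0"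
proof -
  obtain b i where b: "b \<in> A" "i \<ge> 1" "c b i \<notin> \<m>" using nonconst by blast
  obtain N where N: "b \<in> low (Suc N)" using ex_low b by blast
  define S where "S = {j. c b j \<notin> \<m>}"
  have "j \<le> N" if "j \<in> S" for j
    using that N by (auto simp: S_def low_def not_less_eq_eq[symmetric] intro: ccontr)
  then have fin: "finite S" by (intro finite_subset[of S "{..N}"]) auto
  have "Max S \<in> S" using fin b by (intro Max_in) (auto simp: S_def)
  moreover have "Max S \<ge> i" using fin b by (intro Max_ge) (auto simp: S_def)
  moreover have "b \<in> low (Suc (Max S))"
    using b(1) Max_ge[OF fin] by (fastforce simp: low_def S_def)
  ultimately have "Max S \<in> degs" "Max S \<noteq> 0" using b by (auto simp: degs_def S_def)
  then show ?thesis using Gcd_dvd[of "Max S" degs] by (metis dvd_0_left gr0I)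
qed

lemma card_fixed_classes:
  assumes "finite Z" "Z \<subseteq> fixed" "\<And>x y. x \<in> Z \<Longrightarrow> y \<in> Z \<Longrightarrow> x \<noteq> y \<Longrightarrow> x - y \<notin> \<m>"
  shows "card Z \<le> q ^ Gcd degs"
proof -
  define Q where "Q = q ^ Gcd degs"
  have Q: "Q \<ge> 2" using q Gcd_degs_pos self_le_power[of q "Gcd degs"] unfolding Q_def by linarith
  define p :: "'e poly" where "p = monom 1 Q - monom 1 1"
  have deg: "degree p = Q"
    unfolding p_def diff_conv_add_uminus
    by (subst degree_add_eq_left) (use Q in \<open>auto simp: degree_monom_eq\<close>)
  have "lead_coeff p = 1" unfolding deg using Q by (simp add: p_def)
  moreover have "p \<in> polys_over V" unfolding p_def
    by (intro polys_over_closed monom_in_polys_over R closed_subringD(1))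
  ultimately have "card Z \<le> degree p"
    using assms by (intro card_roots_mod_nonunits[OF V]) (auto simp: fixed_def p_def poly_monom Q_def)
  then show ?thesis by (simp add: deg Q_def)
qed

text \<open>The residue class of the leading coefficient determines an element up to elements of lower
  degree.\<close>
lemma card_low_Suc:
  assumes fin: "finite (low n)" and n: "n \<in> degs"
  shows "finite (low (Suc n))" "card (low (Suc n)) \<le> q ^ Gcd degs * card (low n)"
proof -
  obtain b where b: "b \<in> low (Suc n)" "c b n \<notin> \<m>" using n by (auto simp: degs_def)
  have b0: "c b n \<noteq> 0" using b zero_nonunit[OF V] by auto
  define f where "f a = c a n / c b n" for a
  define C where "C a = {x. x - f a \<in> \<m>}" for a
  have self: "f a \<in> C a" for a using zero_nonunit[OF V] by (simp add: C_def)
  have CC: "C a = C a'" if "f a - f a' \<in> \<m>" for a a'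
  proof -
    have "x - f a' \<in> \<m>" if "x - f a \<in> \<m>" for x
      using nonunits_add[OF V that \<open>f a - f a' \<in> \<m>\<close>] by simp
    moreover have "x - f a \<in> \<m>" if "x - f a' \<in> \<m>" for x
      using nonunits_diff[OF V that \<open>f a - f a' \<in> \<m>\<close>] by simp
    ultimately show ?thesis by (auto simp: C_def)
  qed
  have "finite (C ` low (Suc n)) \<and> card (C ` low (Suc n)) \<le> q ^ Gcd degs"
  proof (rule finite_if_finite_subsets_card_bdd)
    fix G assume G: "G \<subseteq> C ` low (Suc n)" "finite G"
    obtain B where B: "B \<subseteq> low (Suc n)" "finite B" "G = C ` B" "inj_on C B"
      using G by (metis (no_types, lifting) finite_imageD subset_image_inj)
    have inj: "inj_on f B" using B(4) by (auto simp: inj_on_def C_def)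
    have "card (f ` B) \<le> q ^ Gcd degs"
    proof (rule card_fixed_classes)
      show "finite (f ` B)" using B by simp
      show "f ` B \<subseteq> fixed" using B ratio_fixed[OF _ b] by (auto simp: f_def)
      fix x y assume "x \<in> f ` B" "y \<in> f ` B" "x \<noteq> y"
      then obtain a a' where "a \<in> B" "a' \<in> B" "x = f a" "y = f a'" "a \<noteq> a'" by auto
      then show "x - y \<notin> \<m>" using CC B(4) by (metis inj_on_def)
    qed
    then show "card G \<le> q ^ Gcd degs" using B inj by (simp add: card_image)
  qed
  then have finC: "finite (C ` low (Suc n))" and cardC: "card (C ` low (Suc n)) \<le> q ^ Gcd degs" by auto
  define F where "F K = {a\<in>low (Suc n). C a = K}" for K
  have F: "finite (F K) \<and> card (F K) \<le> card (low n)" if "K \<in> C ` low (Suc n)" for K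
  proof -
    obtain a0 where a0: "a0 \<in> low (Suc n)" "K = C a0" using \<open>K \<in> _\<close> by auto
    have "(\<lambda>a. a - a0) ` F K \<subseteq> low n"
    proof (rule image_subsetI)
      fix a assume "a \<in> F K"
      then have a: "a \<in> low (Suc n)" "C a = C a0" using a0 by (auto simp: F_def)
      have "f a \<in> C a0" using self[of a] unfolding a(2) .
      then have "f a - f a0 \<in> \<m>" by (simp add: C_def)
      then have "c b n * (f a - f a0) \<in> \<m>" using b(1) c_V by (intro nonunits_mult[OF V]) (auto simp: low_def)
      then have "c (a - a0) n \<in> \<m>" using b0 a a0 by (simp add: f_def c_diff low_def right_diff_distrib)
      moreover have "a - a0 \<in> low (Suc n)" using a a0 by (intro low_diff)
      ultimately show "a - a0 \<in> low n" unfolding low_def by (auto simp: Suc_le_eq) (metis le_neq_implies_less)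
    qed
    moreover have "inj_on (\<lambda>a. a - a0) (F K)" by (auto simp: inj_on_def)
    ultimately show ?thesis using fin by (metis card_inj_on_le finite_subset finite_imageD)
  qed
  have U: "low (Suc n) = (\<Union>K\<in>C ` low (Suc n). F K)" by (auto simp: F_def)
  show "finite (low (Suc n))" by (subst U) (use finC F in blast)
  have "card (low (Suc n)) \<le> (\<Sum>K\<in>C ` low (Suc n). card (F K))"
    by (subst U) (rule card_UN_le[OF finC])
  also have "\<dots> \<le> (\<Sum>K\<in>C ` low (Suc n). card (low n))" using F by (intro sum_mono) auto
  also have "\<dots> \<le> q ^ Gcd degs * card (low n)" using cardC by simp
  finally show "card (low (Suc n)) \<le> q ^ Gcd degs * card (low n)" .
qed

text \<open>Only the multiples of the gcd can be degree exponents, so \<open>q^g\<close> is gained at most once in \<open>g\<close>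
  steps.\<close>
lemma card_low: "finite (low n) \<and> card (low n) \<le> q ^ (n + Gcd degs)"
proof -
  define g where "g = Gcd degs"
  have g: "g > 0" using Gcd_degs_pos by (simp add: g_def)
  have *: "finite (low n) \<and> card (low n) \<le> q ^ (g * ((n + g - 1) div g))" for n
  proof (induction n)
    case 0 then show ?case using q by (simp add: low_0)
  next
    case (Suc n)
    show ?case
    proof (cases "n \<in> degs")
      case True
      then have "g dvd n" by (simp add: g_def)
      then obtain k where k: "n = g * k" by auto
      have "n + g - 1 = (g - 1) + g * k" using g by (simp add: k)
      moreover have "(g - 1) div g = 0" using g by simp
      ultimately have d1: "(n + g - 1) div g = k"
        using g div_mult_self2[of g "g - 1" k] by (simp only:)
      have "Suc n + g - 1 = g * Suc k" using g by (simp add: k)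
      then have d2: "(Suc n + g - 1) div g = Suc k" using g by (simp only: div_mult_self1_is_m)
      have "card (low (Suc n)) \<le> q ^ g * card (low n)"
        using card_low_Suc(2)[OF _ True] Suc by (simp only: g_def)
      also have "\<dots> \<le> q ^ g * q ^ (g * k)" using Suc by (simp only: d1 mult_left_mono)
      also have "\<dots> = q ^ (g * Suc k)" by (simp add: power_add)
      finally show ?thesis using card_low_Suc(1)[OF _ True] Suc by (simp only: d2)
    next
      case False
      have "low (Suc n) = low n"
      proof
        show "low (Suc n) \<subseteq> low n"
        proof
          fix a assume a: "a \<in> low (Suc n)"
          then have "c a n \<in> \<m>" using False by (auto simp: degs_def)
          then show "a \<in> low n" using a unfolding low_def by (auto simp: Suc_le_eq) (metis le_neq_implies_less)
        qed
      qed (rule low_mono, simp)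
      moreover have "q ^ (g * ((n + g - 1) div g)) \<le> q ^ (g * ((Suc n + g - 1) div g))"
        using q g by (intro power_increasing mult_le_mono div_le_mono) auto
      ultimately show ?thesis using Suc by auto
    qed
  qed
  have "q ^ (g * ((n + g - 1) div g)) \<le> q ^ (n + g)"
    using q times_div_less_eq_dividend[of g "n + g - 1"] by (intro power_increasing) linarith+
  with *[of n] show ?thesis by (auto simp: g_def)
qed

lemma exponential_growth_le:
  fixes N M K :: nat
  assumes "\<And>j. N ^ j \<le> K * M ^ j" "M \<ge> 1" shows "N \<le> M"
proof (rule ccontr)
  assume "\<not> N \<le> M"
  then have "real N / real M > 1" using assms(2) by (simp add: field_simps)
  then obtain j where j: "real K < (real N / real M) ^ j" using real_arch_pow by blast
  have "real (N ^ j) \<le> real (K * M ^ j)" using assms(1) by (simp only: of_nat_le_iff)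
  then show False using j assms(2) by (simp add: power_divide field_simps)
qed

text \<open>
  Expansions in base \<open>a\<close> with \<open>j\<close> digits from \<open>W\<close> are pairwise different, and their degree exponents
  are at most \<open>C + j n\<close>. So \<open>card W ^ j\<close> is at most a constant times \<open>q^(n j)\<close>, for all \<open>j\<close>.
\<close>
theorem card_residues_le:
  assumes a: "a \<in> low (Suc n)" "a \<noteq> 0" and W: "finite W" "W \<subseteq> A"
    and inj: "\<And>w w' s. w \<in> W \<Longrightarrow> w' \<in> W \<Longrightarrow> s \<in> A \<Longrightarrow> w - w' = a * s \<Longrightarrow> w = w'"
  shows "card W \<le> q ^ n"
proof -
  have "\<exists>C. \<forall>w\<in>W. w \<in> low (Suc C)" using W
  proof (induction W rule: finite_induct)
    case (insert w W)
    then obtain C where C: "\<forall>w\<in>W. w \<in> low (Suc C)" by auto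
    obtain D where D: "w \<in> low (Suc D)" using insert.prems ex_low by blast
    show ?case using C D low_mono[of "Suc C" "Suc (max C D)"] low_mono[of "Suc D" "Suc (max C D)"]
      by (intro exI[of _ "max C D"]) auto
  qed simp
  then obtain C where C: "\<And>w. w \<in> W \<Longrightarrow> w \<in> low (Suc C)" by auto
  have ex: "\<exists>S. finite S \<and> S \<subseteq> low (Suc (C + j * n)) \<and> card S = card W ^ j" for j
  proof (induction j)
    case 0 then show ?case by (intro exI[of _ "{0}"]) (auto simp: zero_low)
  next
    case (Suc j)
    then obtain S where S: "finite S" "S \<subseteq> low (Suc (C + j * n))" "card S = card W ^ j" by auto
    define f where "f = (\<lambda>(w, s). w + a * s)"
    have SA: "S \<subseteq> A" using S by (auto simp: low_def)
    have "inj_on f (W \<times> S)"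
    proof (rule inj_onI, clarify)
      fix w s w' s' assume *: "w \<in> W" "s \<in> S" "w' \<in> W" "s' \<in> S" "f (w, s) = f (w', s')"
      then have "w - w' = a * (s' - s)" by (simp add: f_def algebra_simps)
      then have "w = w'" using inj[of w w' "s' - s"] * SA closed_subringD(3)[OF A, of s' s] by auto
      then show "w = w' \<and> s = s'" using * a(2) by (simp add: f_def)
    qed
    then have "card (f ` (W \<times> S)) = card W ^ Suc j" using S by (simp add: card_image card_cartesian_product)
    moreover have "f (w, s) \<in> low (Suc (C + Suc j * n))" if "w \<in> W" "s \<in> S" for w s
    proof -
      have "a * s \<in> low (Suc (n + (C + j * n)))" using S that by (intro low_mult(1) a) auto
      moreover have "w \<in> low (Suc (n + (C + j * n)))"
        using C[OF that(1)] low_mono[of "Suc C" "Suc (n + (C + j * n))"] by auto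
      ultimately have "w + a * s \<in> low (Suc (n + (C + j * n)))" by (intro low_add)
      then show ?thesis by (simp add: f_def algebra_simps)
    qed
    ultimately show ?case using S W by (intro exI[of _ "f ` (W \<times> S)"]) auto
  qed
  have bound: "card W ^ j \<le> q ^ (Suc C + Gcd degs) * (q ^ n) ^ j" for j
  proof -
    obtain S where S: "finite S" "S \<subseteq> low (Suc (C + j * n))" "card S = card W ^ j" using ex by blast
    have "card W ^ j \<le> card (low (Suc (C + j * n)))" using S card_low by (metis card_mono)
    also have "\<dots> \<le> q ^ (Suc (C + j * n) + Gcd degs)" using card_low by blast
    also have "\<dots> = q ^ (Suc C + Gcd degs) * (q ^ n) ^ j"
      by (simp add: power_add power_mult[symmetric] mult.commute[of j])
    finally show ?thesis .
  qed
  show ?thesis by (rule exponential_growth_le[OF bound q_pow_pos])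
qed

end

section \<open>Linear polynomials over a finite field\<close>

text \<open>This says that \<open>x \<mapsto> x^q\<close> is additive, in a form that passes to polynomial rings and extension
  fields without reference to the characteristic.\<close>
definition vanishing_binomials :: "nat \<Rightarrow> 'a::comm_ring_1 itself \<Rightarrow> bool" where
  "vanishing_binomials q _ \<longleftrightarrow> q \<ge> 2 \<and> (\<forall>i. 0 < i \<longrightarrow> i < q \<longrightarrow> of_nat (q choose i) = (0::'a))"

lemma power_additive:
  fixes x y :: "'a::comm_ring_1"
  assumes "vanishing_binomials q TYPE('a)"
  shows "(x + y) ^ q = x ^ q + y ^ q"
proof -
  have q: "q \<ge> 2" and van: "\<And>i. 0 < i \<Longrightarrow> i < q \<Longrightarrow> of_nat (q choose i) = (0::'a)"
    using assms by (auto simp: vanishing_binomials_def)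
  have "(x + y) ^ q = (\<Sum>i\<le>q. of_nat (q choose i) * x ^ i * y ^ (q - i))"
    by (rule binomial_ring)
  also have "\<dots> = (\<Sum>i\<in>{0, q}. of_nat (q choose i) * x ^ i * y ^ (q - i))"
  proof (rule sum.mono_neutral_right)
    show "\<forall>i\<in>{..q} - {0, q}. of_nat (q choose i) * x ^ i * y ^ (q - i) = 0"
      using van by auto
  qed auto
  also have "\<dots> = x ^ q + y ^ q" using q by simp
  finally show ?thesis .
qed

lemma vanishing_binomials_poly:
  "vanishing_binomials q TYPE('a::comm_ring_1) \<Longrightarrow> vanishing_binomials q TYPE('a poly)"
  by (auto simp: vanishing_binomials_def of_nat_poly)

lemma vanishing_binomials_alg_closure:
  "vanishing_binomials q TYPE('a::field) \<Longrightarrow> vanishing_binomials q TYPE('a alg_closure)"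
  unfolding vanishing_binomials_def by (metis to_ac_0 to_ac_of_nat)

lemma power_additive_ultrapower:
  fixes x y :: "'a::field ultrapower"
  assumes "vanishing_binomials q TYPE('a)"
  shows "(x + y) ^ q = x ^ q + y ^ q"
proof -
  obtain f where f: "x = of_seq f" by (rule of_seq_cases)
  obtain g where g: "y = of_seq g" by (rule of_seq_cases)
  show ?thesis by (simp add: f g of_seq_simps of_seq_power power_additive[OF assms])
qed

text \<open>Multiplication by \<open>a\<close> permutes the nonzero elements of \<open>k\<close>; compare the products.\<close>
lemma finite_subfield_power_card:
  fixes k :: "'a::field set"
  assumes fin: "finite k" and k: "closed_subring k" and inv: "\<And>x. x \<in> k \<Longrightarrow> inverse x \<in> k"
    and a: "a \<in> k"
  shows "a ^ card k = a"
proof (cases "a = 0")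
  case True
  have "card k > 0" using fin a by (auto simp: card_gt_0_iff)
  then show ?thesis using True by simp
next
  case False
  define U where "U = k - {0}"
  have cU: "card k = Suc (card U)"
    using fin closed_subringD(2)[OF k] unfolding U_def by (metis card.remove)
  have bij: "bij_betw ((*) a) U U"
  proof (rule bij_betwI[where g = "(*) (inverse a)"])
    show "(*) a \<in> U \<rightarrow> U" using False a k by (auto simp: U_def closed_subringD)
    show "(*) (inverse a) \<in> U \<rightarrow> U" using False inv[OF a] k by (auto simp: U_def closed_subringD)
  qed (use False in auto)
  have "\<Prod>U = (\<Prod>x\<in>U. a * x)" using prod.reindex_bij_betw[OF bij, of "\<lambda>x. x"] by simp
  also have "\<dots> = a ^ card U * \<Prod>U" by (simp add: prod.distrib)
  finally have "(a ^ card U - 1) * \<Prod>U = 0" by (simp add: algebra_simps)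
  moreover have "\<Prod>U \<noteq> 0" using fin by (simp add: U_def)
  ultimately have "a ^ card U = 1" by simp
  then show ?thesis by (simp add: cU)
qed

text \<open>
  The polynomial \<open>(X + 1)^q - X^q - 1\<close> vanishes at the \<open>q\<close> elements of \<open>k\<close> but has degree less than
  \<open>q\<close>. Hence it is zero, and its coefficients are the binomial coefficients in question.
\<close>
lemma vanishing_binomials_card:
  fixes k :: "'a::field set"
  assumes fin: "finite k" and k: "closed_subring k" and inv: "\<And>x. x \<in> k \<Longrightarrow> inverse x \<in> k"
  shows "vanishing_binomials (card k) TYPE('a)"
proof -
  define q where "q = card k"
  have "{0, 1} \<subseteq> k" using k by (auto simp: closed_subringD)
  then have "card {0, 1 :: 'a} \<le> q" unfolding q_def by (intro card_mono fin)
  then have q: "q \<ge> 2" by simp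
  define f :: "'a poly" where "f = (\<Sum>i\<in>{1..<q}. monom (of_nat (q choose i)) i)"
  have coeff: "coeff f i = (if 0 < i \<and> i < q then of_nat (q choose i) else 0)" for i
    by (auto simp: f_def coeff_sum if_distrib cong: if_cong)
  have "f = 0"
  proof (rule ccontr)
    assume f: "f \<noteq> 0"
    have "degree f \<le> q - 1" by (rule degree_le) (use q in \<open>auto simp: coeff\<close>)
    have "poly f a = 0" if a: "a \<in> k" for a
    proof -
      have "(a + 1) ^ q = (\<Sum>i\<le>q. of_nat (q choose i) * a ^ i)"
        using binomial_ring[of a 1 q] by simp
      also have "{..q} = insert 0 (insert q {1..<q})" using q by auto
      also have "(\<Sum>i\<in>insert 0 (insert q {1..<q}). of_nat (q choose i) * a ^ i)
          = 1 + (a ^ q + (\<Sum>i\<in>{1..<q}. of_nat (q choose i) * a ^ i))"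
        using q by (subst sum.insert; simp)
      also have "(\<Sum>i\<in>{1..<q}. of_nat (q choose i) * a ^ i) = poly f a"
        by (simp add: f_def poly_sum poly_monom)
      finally have "(a + 1) ^ q = 1 + (a ^ q + poly f a)" .
      moreover have "(a + 1) ^ q = a + 1" "a ^ q = a" unfolding q_def
        using a k by (auto intro!: finite_subfield_power_card[OF fin k inv] simp: closed_subringD)
      ultimately show ?thesis by simp
    qed
    then have "k \<subseteq> {x. poly f x = 0}" by auto
    then have "q \<le> card {x. poly f x = 0}" unfolding q_def
      by (intro card_mono poly_roots_finite f)
    also have "\<dots> \<le> degree f" by (rule card_poly_roots_bound[OF f])
    finally show False using \<open>degree f \<le> q - 1\<close> q by simp
  qed
  then have "of_nat (q choose i) = (0::'a)" if "0 < i" "i < q" for i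
    using coeff[of i] that by simp
  then show ?thesis using q by (simp add: vanishing_binomials_def q_def)
qed

lemma sum_power_power:
  fixes f :: "'i \<Rightarrow> 'a::comm_ring_1"
  assumes van: "vanishing_binomials q TYPE('a)"
  shows "sum f I ^ q ^ n = (\<Sum>i\<in>I. f i ^ q ^ n)"
proof -
  have "q ^ n > 0" using van by (simp add: vanishing_binomials_def)
  then have "(0::'a) ^ q ^ n = 0" by (rule zero_power)
  then show ?thesis
    by (induction I rule: infinite_finite_induct)
       (simp_all add: power_power_additive(1)[OF power_additive[OF van]])
qed

lemma linear_poly_expansion:
  assumes f: "f \<in> linear_polys q" and q: "q \<ge> 2" and N: "N \<ge> degree f"
  shows "f = (\<Sum>i\<le>N. monom (coeff f (q ^ i)) (q ^ i))"
proof (rule poly_eqI)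
  fix m
  have inj: "q ^ i = q ^ j \<longleftrightarrow> i = j" for i j using q by simp
  show "coeff f m = coeff (\<Sum>i\<le>N. monom (coeff f (q ^ i)) (q ^ i)) m"
  proof (cases "\<exists>j. m = q ^ j")
    case True
    then obtain j where m: "m = q ^ j" by auto
    have "j \<le> N" if "coeff f m \<noteq> 0"
    proof -
      have "q ^ j \<le> degree f" using le_degree[OF that] m by simp
      moreover have "j < q ^ j" using q by (simp add: power_gt_expt)
      ultimately show ?thesis using N by linarith
    qed
    then show ?thesis by (auto simp: coeff_sum m inj)
  next
    case False
    then have "coeff f m = 0" using f by (auto simp: linear_polys_def)
    moreover have "q ^ i \<noteq> m" for i using False by auto
    ultimately show ?thesis by (simp add: coeff_sum)
  qed
qed

lemma coeff_power_power_linear_poly: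
  fixes g :: "'a::field poly"
  assumes g: "g \<in> linear_polys q" and van: "vanishing_binomials q TYPE('a)"
  shows "coeff (g ^ q ^ i) (q ^ n) = (if i \<le> n then coeff g (q ^ (n - i)) ^ q ^ i else 0)"
proof -
  have q: "q \<ge> 2" using van by (simp add: vanishing_binomials_def)
  have inj: "q ^ i = q ^ j \<longleftrightarrow> i = j" for i j using q by simp
  define N where "N = max (degree g) n"
  have "g ^ q ^ i = (\<Sum>j\<le>N. monom (coeff g (q ^ j)) (q ^ j)) ^ q ^ i"
    using linear_poly_expansion[OF g q, of N] by (simp add: N_def)
  also have "\<dots> = (\<Sum>j\<le>N. monom (coeff g (q ^ j) ^ q ^ i) (q ^ (j + i)))"
    by (simp add: sum_power_power[OF vanishing_binomials_poly[OF van]] monom_power power_add)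
  finally have "coeff (g ^ q ^ i) (q ^ n) = (\<Sum>j\<le>N. if j + i = n then coeff g (q ^ j) ^ q ^ i else 0)"
    by (simp add: coeff_sum inj)
  also have "\<dots> = (\<Sum>j\<in>{j. j \<le> N \<and> j + i = n}. coeff g (q ^ j) ^ q ^ i)"
    by (subst sum.inter_filter[symmetric]) auto
  also have "{j. j \<le> N \<and> j + i = n} = (if i \<le> n then {n - i} else {})" by (auto simp: N_def)
  finally show ?thesis by (simp split: if_splits)
qed

lemma coeff_pcompose_linear_polys:
  fixes f g :: "'a::field poly"
  assumes f: "f \<in> linear_polys q" and g: "g \<in> linear_polys q"
    and van: "vanishing_binomials q TYPE('a)"
  shows "coeff (pcompose f g) (q ^ n) = (\<Sum>i\<le>n. coeff f (q ^ i) * coeff g (q ^ (n - i)) ^ q ^ i)"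
proof -
  have q: "q \<ge> 2" using van by (simp add: vanishing_binomials_def)
  define N where "N = max (degree f) n"
  have mc: "pcompose (monom c m) g = smult c (g ^ m)" for c m
    by (simp add: pcompose_altdef map_poly_monom poly_monom)
  have "pcompose f g = pcompose (\<Sum>i\<le>N. monom (coeff f (q ^ i)) (q ^ i)) g"
    using linear_poly_expansion[OF f q, of N] by (simp add: N_def)
  also have "\<dots> = (\<Sum>i\<le>N. smult (coeff f (q ^ i)) (g ^ q ^ i))"
    by (simp add: pcompose_sum mc)
  finally have "coeff (pcompose f g) (q ^ n)
      = (\<Sum>i\<le>N. coeff f (q ^ i) * (if i \<le> n then coeff g (q ^ (n - i)) ^ q ^ i else 0))"
    by (simp add: coeff_sum coeff_power_power_linear_poly[OF g van])
  also have "\<dots> = (\<Sum>i\<le>n. coeff f (q ^ i) * coeff g (q ^ (n - i)) ^ q ^ i)"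
    by (rule sum.mono_neutral_cong_right) (auto simp: N_def)
  finally show ?thesis .
qed

lemma poly_linear_poly:
  assumes f: "f \<in> linear_polys q" and q: "q \<ge> 2" and N: "\<And>i. i > N \<Longrightarrow> coeff f (q ^ i) = 0"
  shows "poly f x = (\<Sum>i\<le>N. coeff f (q ^ i) * x ^ q ^ i)"
proof -
  have "poly f x = (\<Sum>i\<le>max N (degree f). coeff f (q ^ i) * x ^ q ^ i)"
    by (subst linear_poly_expansion[OF f q, of "max N (degree f)"]) (simp_all add: poly_sum poly_monom)
  also have "\<dots> = (\<Sum>i\<le>N. coeff f (q ^ i) * x ^ q ^ i)"
    by (rule sum.mono_neutral_right) (auto simp: N)
  finally show ?thesis .
qed

section \<open>The ring \<open>A\<close> and its degree\<close>

lemma valuation_ring_UNIV: "valuation_ring UNIV"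
  by (simp add: valuation_ring_def closed_subring_def)

lemma nonunits_UNIV [simp]: "nonunits UNIV = {0}"
  by (auto simp: nonunits_def)

definition residue_card :: "'l::field set \<Rightarrow> 'l \<Rightarrow> nat" where
  "residue_card A a = card (carrier (ring_on A Quot (PIdl\<^bsub>ring_on A\<^esub> a)))"

lemma residue_representatives:
  assumes A: "closed_subring A" and a: "a \<in> A" and pos: "residue_card A a > 0"
  obtains W where "finite W" "W \<subseteq> A" "card W = residue_card A a"
    "\<And>w w' s. w \<in> W \<Longrightarrow> w' \<in> W \<Longrightarrow> s \<in> A \<Longrightarrow> w - w' = a * s \<Longrightarrow> w = w'"
    "\<And>x. x \<in> A \<Longrightarrow> \<exists>w\<in>W. \<exists>s\<in>A. x = w + a * s"
proof -
  define C where "C x = {s * a + x | s. s \<in> A}" for x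
  have car: "carrier (ring_on A Quot (PIdl\<^bsub>ring_on A\<^esub> a)) = C ` A"
    by (auto simp: FactRing_def A_RCOSETS_def' a_r_coset_def' cgenideal_def C_def
        ring_of_type_algebra_def)
  have finC: "finite (C ` A)" using pos unfolding residue_card_def car by (simp add: card_gt_0_iff)
  obtain W where W: "W \<subseteq> A" "inj_on C W" "C ` A = C ` W"
    using subset_image_inj[of "C ` A" C A] by auto
  have self: "x \<in> C x" for x using closed_subringD(2)[OF A] by (force simp: C_def)
  show thesis
  proof (rule that)
    show "finite W" using W finC by (metis finite_imageD)
    show "W \<subseteq> A" by (rule W)
    show "card W = residue_card A a" using W unfolding residue_card_def car by (metis card_image)
    show "\<exists>w\<in>W. \<exists>s\<in>A. x = w + a * s" if x: "x \<in> A" for x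
    proof -
      have "C x \<in> C ` W" using W(3) x by blast
      then obtain w where w: "w \<in> W" "C x = C w" by auto
      then have "x \<in> C w" using self by auto
      then obtain s where "s \<in> A" "x = s * a + w" by (auto simp: C_def)
      then show ?thesis using w by (intro bexI[of _ w] bexI[of _ s]) (auto simp: algebra_simps)
    qed
    show "w = w'" if ww: "w \<in> W" "w' \<in> W" and s: "s \<in> A" "w - w' = a * s" for w w' s
    proof -
      have "C w \<subseteq> C w'"
      proof
        fix y assume "y \<in> C w"
        then obtain r where r: "r \<in> A" "y = r * a + w" by (auto simp: C_def)
        have "y = (r + s) * a + w'" using r s by (simp add: algebra_simps)
        then show "y \<in> C w'" using r s A by (auto simp: C_def closed_subringD)
      qed
      moreover have "C w' \<subseteq> C w"
      proof
        fix y assume "y \<in> C w'"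
        then obtain r where r: "r \<in> A" "y = r * a + w'" by (auto simp: C_def)
        have "w' = w - a * s" using s by (simp add: algebra_simps)
        then have "y = (r - s) * a + w" using r by (simp add: algebra_simps)
        then show "y \<in> C w" using r s A by (auto simp: C_def closed_subringD)
      qed
      ultimately show ?thesis using W(2) ww by (auto dest: inj_onD)
    qed
  qed
qed

text \<open>\<open>A\<close> is contained in the span of \<open>B\<close> over \<open>\<nat>[T]\<close>, stated as an induction principle.\<close>
definition generates :: "'a::comm_ring_1 set \<Rightarrow> 'a \<Rightarrow> 'a set \<Rightarrow> bool" where
  "generates B T A \<longleftrightarrow> (\<forall>S. B \<subseteq> S \<and> (\<forall>x\<in>S. \<forall>y\<in>S. x + y \<in> S) \<and> (\<forall>x\<in>S. T * x \<in> S) \<longrightarrow> A \<subseteq> S)"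

lemma generatesD:
  assumes "generates B T A" "B \<subseteq> S" "\<And>x y. x \<in> S \<Longrightarrow> y \<in> S \<Longrightarrow> x + y \<in> S"
    "\<And>x. x \<in> S \<Longrightarrow> T * x \<in> S"
  shows "A \<subseteq> S"
  using assms unfolding generates_def by blast

locale constant_field =
  fixes k A :: "'l::field set"
  assumes fin_k: "finite k" and k: "closed_subring k" and k_inv: "\<And>x. x \<in> k \<Longrightarrow> inverse x \<in> k"
    and A: "closed_subring A" and kA: "k \<subseteq> A"
begin

definition q where "q = card k"

definition tc :: "('l \<Rightarrow> 'l poly) \<Rightarrow> 'l \<Rightarrow> nat \<Rightarrow> 'l" where
  "tc \<phi> a i = coeff (\<phi> a) (q ^ i)"

lemma van: "vanishing_binomials q TYPE('l)"
  unfolding q_def by (rule vanishing_binomials_card[OF fin_k k k_inv])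

lemma q_ge_2: "q \<ge> 2" using van by (simp add: vanishing_binomials_def)

lemma drinfeld_linear: "drinfeld_module k A 1 \<phi> \<Longrightarrow> a \<in> A \<Longrightarrow> \<phi> a \<in> linear_polys q"
  by (simp add: drinfeld_module_def q_def)

lemma drinfeld_degree:
  assumes "drinfeld_module k A 1 \<phi>" "a \<in> A" "a \<noteq> 0"
  shows "degree (\<phi> a) = residue_card A a"
  using assms by (simp add: drinfeld_module_def residue_card_def)

lemma drinfeld_twisted_hom:
  assumes D: "drinfeld_module k A 1 \<phi>"
  shows "twisted_hom q A (tc \<phi>)"
  unfolding twisted_hom_def
proof (intro conjI ballI allI)
  fix a b n assume ab: "a \<in> A" "b \<in> A"
  have "\<phi> ((a - b) + b) = \<phi> (a - b) + \<phi> b"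
    using D ab A unfolding drinfeld_module_def by (blast intro: closed_subringD)
  then show "tc \<phi> (a - b) n = tc \<phi> a n - tc \<phi> b n" by (simp add: tc_def)
  have "\<phi> (a * b) = pcompose (\<phi> a) (\<phi> b)" using D ab by (simp add: drinfeld_module_def)
  then show "tc \<phi> (a * b) n = (\<Sum>i\<le>n. tc \<phi> a i * tc \<phi> b (n - i) ^ q ^ i)"
    by (simp only: tc_def coeff_pcompose_linear_polys[OF drinfeld_linear[OF D ab(1)] drinfeld_linear[OF D ab(2)] van])
next
  fix a assume a: "a \<in> A"
  have "tc \<phi> a i = 0" if "i \<ge> degree (\<phi> a)" for i
  proof -
    have "i < q ^ i" using q_ge_2 by (simp add: power_gt_expt)
    then show ?thesis using that by (simp add: tc_def coeff_eq_0)
  qed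
  then show "\<exists>N. \<forall>i\<ge>N. tc \<phi> a i = 0" by blast
qed

lemma drinfeld_tc_0:
  assumes D: "drinfeld_module k A 1 \<phi>" and a: "a \<in> A"
  shows "tc \<phi> a 0 = a"
proof (cases "a = 0")
  case True
  have "\<phi> (0 + 0) = \<phi> 0 + \<phi> 0" using D closed_subringD(2)[OF A] unfolding drinfeld_module_def by blast
  then have "\<phi> 0 = 0" by (simp only: add_0_left add_cancel_right_right)
  then show ?thesis using True by (simp add: tc_def)
next
  case False then show ?thesis using D a by (simp add: drinfeld_module_def tc_def)
qed

lemma drinfeld_degree_power:
  assumes D: "drinfeld_module k A 1 \<phi>" and a: "a \<in> A" "a \<noteq> 0"
  obtains d where "residue_card A a = q ^ d"
proof -
  have "\<phi> a \<noteq> 0" using drinfeld_tc_0[OF D a(1)] a by (auto simp: tc_def)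
  then have "coeff (\<phi> a) (degree (\<phi> a)) \<noteq> 0" by simp
  then obtain d where "degree (\<phi> a) = q ^ d"
    using drinfeld_linear[OF D a(1)] unfolding linear_polys_def by blast
  then show thesis using that drinfeld_degree[OF D a] by simp
qed

text \<open>The logarithm of \<open>#(A/aA)\<close> to the base \<open>q\<close>. It depends on \<open>A\<close> alone, hence it is the same for all
  Drinfeld modules; that it is an integer follows from the existence of a Drinfeld module.\<close>
definition deg :: "'l \<Rightarrow> nat" where
  "deg a = (SOME d. residue_card A a = q ^ d)"

lemma residue_card_deg:
  assumes "drinfeld_module k A 1 \<phi>" "a \<in> A" "a \<noteq> 0"
  shows "residue_card A a = q ^ deg a"
  unfolding deg_def by (rule someI_ex) (use drinfeld_degree_power[OF assms] in blast)

lemma tc_lead: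
  assumes D: "drinfeld_module k A 1 \<phi>" and a: "a \<in> A" "a \<noteq> 0"
  shows "tc \<phi> a (deg a) \<noteq> 0" "i > deg a \<Longrightarrow> tc \<phi> a i = 0"
proof -
  have eq: "degree (\<phi> a) = q ^ deg a"
    using drinfeld_degree[OF D a] residue_card_deg[OF D a] by simp
  have "\<phi> a \<noteq> 0" using drinfeld_tc_0[OF D a(1)] a by (auto simp: tc_def)
  then show "tc \<phi> a (deg a) \<noteq> 0" unfolding tc_def eq[symmetric] by simp
  show "tc \<phi> a i = 0" if "i > deg a"
    using q_ge_2 that by (simp add: tc_def coeff_eq_0 eq)
qed

end

text \<open>A Drinfeld module together with a nonunit \<open>T\<close>, which serves as a coordinate. The trivial valuation
  makes it a twisted reduction, so the counting results apply to \<open>A\<close> itself.\<close>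
locale drinfeld = constant_field k A for k A :: "'l::field set" +
  fixes \<phi> :: "'l \<Rightarrow> 'l poly" and T :: 'l
  assumes D: "drinfeld_module k A 1 \<phi>" and T: "T \<in> A" "T \<noteq> 0" and deg_T: "deg T \<ge> 1"
begin

sublocale R: twisted_reduction q A UNIV "tc \<phi>"
proof
  show "q \<ge> 2" by (rule q_ge_2)
  show "closed_subring A" by (rule A)
  show "\<And>x y :: 'l. (x + y) ^ q = x ^ q + y ^ q" by (rule power_additive[OF van])
  show "valuation_ring (UNIV :: 'l set)" by (rule valuation_ring_UNIV)
  show "twisted_hom q A (tc \<phi>)" by (rule drinfeld_twisted_hom[OF D])
  show "tc \<phi> a 0 \<notin> nonunits UNIV" if "a \<in> A" "a \<noteq> 0" for a
    using drinfeld_tc_0[OF D] that by simp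
  show "\<exists>b\<in>A. \<exists>i\<ge>1. tc \<phi> b i \<notin> nonunits UNIV"
    using tc_lead(1)[OF D T] T deg_T by auto
qed auto

lemma T_low: "T \<in> R.low (Suc (deg T))" "tc \<phi> T (deg T) \<noteq> 0"
  using tc_lead[OF D T] T by (auto simp: R.low_def)

lemma T_mult_low:
  assumes s: "s \<in> R.low (Suc e)"
  shows "T * s \<in> R.low (Suc (deg T + e))" "tc \<phi> (T * s) (deg T + e) = tc \<phi> T (deg T) * tc \<phi> s e ^ q ^ deg T"
  using R.low_mult[OF T_low(1) s] by auto

lemma low_of_T_mult:
  assumes s: "s \<in> A" and Ts: "T * s \<in> R.low n"
  shows "s \<in> R.low (n - deg T)"
proof (rule ccontr)
  assume neg: "s \<notin> R.low (n - deg T)"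
  define S where "S = {i. tc \<phi> s i \<noteq> 0}"
  obtain N where "s \<in> R.low (Suc N)" using R.ex_low[OF s] by auto
  then have fin: "finite S" by (intro finite_subset[of S "{..N}"])
    (auto simp: S_def R.low_def not_less_eq_eq[symmetric] intro: ccontr)
  obtain i where i: "i \<ge> n - deg T" "i \<in> S" using neg s by (auto simp: R.low_def S_def)
  have max: "Max S \<in> S" "Max S \<ge> i" using fin i by (auto intro!: Max_in)
  have "s \<in> R.low (Suc (Max S))" using s Max_ge[OF fin] by (fastforce simp: R.low_def S_def)
  from T_mult_low(2)[OF this] max have "tc \<phi> (T * s) (deg T + Max S) \<noteq> 0"
    using T_low(2) by (simp add: S_def)
  moreover have "deg T + Max S \<ge> n" using max i by linarith
  ultimately show False using Ts by (auto simp: R.low_def)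
qed

text \<open>Division by \<open>T\<close> with remainder in a finite set of representatives lowers the degree, as long
  as the degree exceeds that of all remainders.\<close>
theorem generating_set:
  obtains B where "finite B" "B \<subseteq> A" "T \<in> B" "generates B T A"
proof -
  have pos: "residue_card A T > 0" using residue_card_deg[OF D T] q_ge_2 by simp
  obtain W where W: "finite W" "W \<subseteq> A" and rep: "\<And>x. x \<in> A \<Longrightarrow> \<exists>w\<in>W. \<exists>s\<in>A. x = w + T * s"
    using residue_representatives[OF A T(1) pos] by metis
  have "\<exists>N. W \<subseteq> R.low N" using W
  proof (induction W rule: finite_induct)
    case (insert w W)
    then obtain C where C: "W \<subseteq> R.low C" by auto
    obtain E where E: "w \<in> R.low (Suc E)" using insert.prems R.ex_low by blast
    show ?case using C E R.low_mono[of C "max C (Suc E)"] R.low_mono[of "Suc E" "max C (Suc E)"]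
      by (intro exI[of _ "max C (Suc E)"]) auto
  qed simp
  then obtain N where N: "W \<subseteq> R.low N" by auto
  show thesis
  proof (rule that)
    show "finite (insert T (R.low N))" using R.card_low by simp
    show "insert T (R.low N) \<subseteq> A" using T by (auto simp: R.low_def)
    show "T \<in> insert T (R.low N)" by simp
    show "generates (insert T (R.low N)) T A" unfolding generates_def
    proof (intro allI impI, elim conjE)
      fix S assume B: "insert T (R.low N) \<subseteq> S" and add: "\<forall>x\<in>S. \<forall>y\<in>S. x + y \<in> S"
        and mult: "\<forall>x\<in>S. T * x \<in> S"
      have "R.low n \<subseteq> S" for n
      proof (induction n rule: less_induct)
        case (less n)
        show ?case
        proof (cases "n \<le> N")
          case True then show ?thesis using B R.low_mono[of n N] by auto
        next
          case False
          show ?thesis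
          proof
            fix a assume a: "a \<in> R.low n"
            then have "a \<in> A" by (simp add: R.low_def)
            then obtain w s where ws: "w \<in> W" "s \<in> A" "a = w + T * s" using rep by blast
            have wl: "w \<in> R.low n" using ws N R.low_mono[of N n] False by auto
            have "T * s = a - w" using ws by simp
            then have "T * s \<in> R.low n" using R.low_diff[OF a wl] by simp
            then have "s \<in> R.low (n - deg T)" using low_of_T_mult ws by blast
            then have "s \<in> S" using less[of "n - deg T"] False deg_T by auto
            then show "a \<in> S" using ws N B add mult by blast
          qed
        qed
      qed
      then show "A \<subseteq> S" using R.ex_low by blast
    qed
  qed
qed

lemma poly_T_low:
  assumes "p \<in> polys_over k" "p \<noteq> 0"
  shows "poly p T \<in> R.low (Suc (deg T * degree p)) \<and> tc \<phi> (poly p T) (deg T * degree p) \<noteq> 0"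
  using assms
proof (induction p)
  case (pCons a p)
  have a: "a \<in> k" and p: "p \<in> polys_over k"
    using pCons.prems(1) by (auto simp: polys_over_def coeff_pCons split: nat.splits)
  have aA: "a \<in> A" using a kA by auto
  have "\<phi> a = [:0, a:]" using D a by (simp add: drinfeld_module_def)
  then have tca: "tc \<phi> a i = (if i = 0 then a else 0)" for i
    using q_ge_2 by (auto simp: tc_def coeff_pCons coeff_eq_0 split: nat.splits)
  then have la: "a \<in> R.low (Suc 0)" using aA by (auto simp: R.low_def)
  show ?case
  proof (cases "p = 0")
    case True
    then show ?thesis using pCons.prems la tca by auto
  next
    case False
    then have IH: "poly p T \<in> R.low (Suc (deg T * degree p))" "tc \<phi> (poly p T) (deg T * degree p) \<noteq> 0"
      using pCons.IH[OF p] by auto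
    have dp: "deg T * degree (pCons a p) = deg T + deg T * degree p" using False by simp
    have l: "T * poly p T \<in> R.low (Suc (deg T * degree (pCons a p)))"
      using T_mult_low(1)[OF IH(1)] by (simp only: dp)
    have "a \<in> R.low (Suc (deg T * degree (pCons a p)))"
      using la R.low_mono[of "Suc 0"] by auto
    then have "poly (pCons a p) T \<in> R.low (Suc (deg T * degree (pCons a p)))"
      using R.low_add[OF _ l] by simp
    moreover have "tc \<phi> (T * poly p T) (deg T + deg T * degree p) \<noteq> 0"
      unfolding T_mult_low(2)[OF IH(1)] using IH(2) T_low(2) by simp
    moreover have "tc \<phi> (a + T * poly p T) i = tc \<phi> a i + tc \<phi> (T * poly p T) i" for i
    proof -
      have TA: "T * poly p T \<in> A" using l by (auto simp: R.low_def)
      have "tc \<phi> (a + T * poly p T - T * poly p T) i = tc \<phi> (a + T * poly p T) i - tc \<phi> (T * poly p T) i"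
        by (rule R.c_diff[OF closed_subringD(5)[OF A aA TA] TA])
      then show ?thesis by simp
    qed
    ultimately show ?thesis unfolding dp using tca[of "deg T + deg T * degree p"] deg_T by auto
  qed
qed simp

lemma T_transcendental: "p \<in> polys_over k \<Longrightarrow> poly p T = 0 \<Longrightarrow> p = 0"
  using poly_T_low[of p] R.zero_low[of 0] by (auto simp: R.low_def)

text \<open>As \<open>A/sA\<close> is finite, two powers of \<open>T\<close> are congruent modulo \<open>s\<close>.\<close>
lemma multiple_in_kT:
  assumes s: "s \<in> A" "s \<noteq> 0"
  obtains s' p where "s' \<in> A" "p \<in> polys_over k" "p \<noteq> 0" "s * s' = poly p T"
proof -
  have pos: "residue_card A s > 0" using residue_card_deg[OF D s] q_ge_2 by simp
  obtain W where W: "finite W" and rep: "\<And>x. x \<in> A \<Longrightarrow> \<exists>w\<in>W. \<exists>r\<in>A. x = w + s * r"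
    using residue_representatives[OF A s(1) pos] by metis
  have "\<forall>i. \<exists>w r. w \<in> W \<and> r \<in> A \<and> T ^ i = w + s * r"
    using rep closed_subring_power[OF A T(1)] by metis
  then obtain w r where wr: "\<And>i. w i \<in> W" "\<And>i. r i \<in> A" "\<And>i. T ^ i = w i + s * r i" by metis
  have "\<not> inj w"
  proof
    assume "inj w"
    moreover have "range w \<subseteq> W" using wr by auto
    ultimately show False using W finite_subset infinite_UNIV_nat by (metis finite_imageD)
  qed
  then obtain i j where ij: "i \<noteq> j" "w i = w j" by (auto simp: inj_on_def)
  define p :: "'l poly" where "p = monom 1 i - monom 1 j"
  show thesis
  proof (rule that)
    show "r i - r j \<in> A" using wr A by (auto intro: closed_subringD)
    show "p \<in> polys_over k" unfolding p_def
      by (intro polys_over_closed monom_in_polys_over k closed_subringD(1))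
    have "coeff p i = 1" using ij by (simp add: p_def)
    then show "p \<noteq> 0" by auto
    have "s * (r i - r j) = (w i + s * r i) - (w j + s * r j)" using ij by (simp add: algebra_simps)
    then show "s * (r i - r j) = poly p T" using wr(3) by (simp add: p_def poly_monom)
  qed
qed

end

section \<open>Finiteness up to scaling over the algebraic closure\<close>

lemma twisted_homD:
  assumes "twisted_hom q A c" and A: "closed_subring A" and ab: "a \<in> A" "b \<in> A"
  shows "c (a - b) n = c a n - c b n" "c (a * b) n = (\<Sum>i\<le>n. c a i * c b (n - i) ^ q ^ i)"
    "c 0 n = 0" "c (a + b) n = c a n + c b n"
proof -
  have diff: "c (x - y) n = c x n - c y n" if "x \<in> A" "y \<in> A" for x y
    using assms(1) that by (auto simp: twisted_hom_def)
  show "c (a - b) n = c a n - c b n" using diff ab by simp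
  show "c (a * b) n = (\<Sum>i\<le>n. c a i * c b (n - i) ^ q ^ i)"
    using assms(1) ab by (auto simp: twisted_hom_def)
  show 0: "c 0 n = 0" using diff[of 0 0] A by (simp add: closed_subringD)
  have "c (a - (0 - b)) n = c a n - (c 0 n - c b n)"
    using diff[of a "0 - b"] diff[of 0 b] ab A by (simp add: closed_subringD)
  then show "c (a + b) n = c a n + c b n" by (simp add: 0)
qed

text \<open>The coefficients of \<open>x \<mapsto> f\<^sub>a(u x) / u\<close>.\<close>
lemma twisted_hom_scale:
  fixes c :: "'a::comm_ring_1 \<Rightarrow> nat \<Rightarrow> 'e::field"
  assumes c: "twisted_hom q A c" and q: "q \<ge> 1"
  shows "twisted_hom q A (\<lambda>a i. c a i * u ^ (q ^ i - 1))"
  unfolding twisted_hom_def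
proof (intro conjI ballI allI)
  fix a b n assume ab: "a \<in> A" "b \<in> A"
  show "c (a - b) n * u ^ (q ^ n - 1) = c a n * u ^ (q ^ n - 1) - c b n * u ^ (q ^ n - 1)"
    using c ab by (simp add: twisted_hom_def left_diff_distrib)
  have "c (a * b) n * u ^ (q ^ n - 1) = (\<Sum>i\<le>n. c a i * c b (n - i) ^ q ^ i * u ^ (q ^ n - 1))"
    using c ab by (simp add: twisted_hom_def sum_distrib_right)
  also have "\<dots> = (\<Sum>i\<le>n. c a i * u ^ (q ^ i - 1) * (c b (n - i) * u ^ (q ^ (n - i) - 1)) ^ q ^ i)"
  proof (rule sum.cong)
    fix i assume "i \<in> {..n}"
    then have i: "i \<le> n" by simp
    have "q ^ i \<ge> 1" "q ^ n \<ge> 1" using q by simp_all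
    moreover have "q ^ (n - i) * q ^ i = q ^ n" using i by (simp add: power_add[symmetric])
    ultimately have "q ^ n - 1 = (q ^ i - 1) + (q ^ (n - i) - 1) * q ^ i"
      using mult_le_mono1[of 1 "q ^ (n - i)" "q ^ i"] q by (simp add: diff_mult_distrib)
    then show "c a i * c b (n - i) ^ q ^ i * u ^ (q ^ n - 1)
        = c a i * u ^ (q ^ i - 1) * (c b (n - i) * u ^ (q ^ (n - i) - 1)) ^ q ^ i"
      by (simp add: power_add power_mult power_mult_distrib)
  qed simp
  finally show "c (a * b) n * u ^ (q ^ n - 1)
      = (\<Sum>i\<le>n. c a i * u ^ (q ^ i - 1) * (c b (n - i) * u ^ (q ^ (n - i) - 1)) ^ q ^ i)" .
next
  fix a assume "a \<in> A"
  then obtain N where "\<forall>i\<ge>N. c a i = 0" using c by (auto simp: twisted_hom_def)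
  then show "\<exists>N. \<forall>i\<ge>N. c a i * u ^ (q ^ i - 1) = 0" by auto
qed

lemma twisted_hom_to_ac:
  "twisted_hom q A c \<Longrightarrow> twisted_hom q A (\<lambda>a i. to_ac (c a i))"
  unfolding twisted_hom_def
  by (auto simp: to_ac_sum)

lemma twisted_hom_of_seq:
  fixes c :: "nat \<Rightarrow> 'a::comm_ring_1 \<Rightarrow> nat \<Rightarrow> 'e::field"
  assumes c: "\<And>n. twisted_hom q A (c n)" and N: "\<And>a. a \<in> A \<Longrightarrow> \<exists>N. \<forall>i\<ge>N. \<forall>n. c n a i = 0"
  shows "twisted_hom q A (\<lambda>a i. of_seq (\<lambda>n. c n a i))"
  unfolding twisted_hom_def
proof (intro conjI ballI allI)
  fix a b m assume ab: "a \<in> A" "b \<in> A"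
  show "of_seq (\<lambda>n. c n (a - b) m) = of_seq (\<lambda>n. c n a m) - of_seq (\<lambda>n. c n b m)"
    using c ab by (simp add: twisted_hom_def of_seq_simps)
  show "of_seq (\<lambda>n. c n (a * b) m)
      = (\<Sum>i\<le>m. of_seq (\<lambda>n. c n a i) * of_seq (\<lambda>n. c n b (m - i)) ^ q ^ i)"
    using c ab by (simp add: twisted_hom_def of_seq_simps of_seq_power of_seq_sum)
next
  fix a assume "a \<in> A"
  then obtain N where "\<forall>i\<ge>N. \<forall>n. c n a i = 0" using N by blast
  then show "\<exists>N. \<forall>i\<ge>N. of_seq (\<lambda>n. c n a i) = 0" by (auto simp: of_seq_simps intro!: exI[of _ N])
qed

lemma twisted_hom_values_in_subring:
  assumes c: "twisted_hom q A c" and A: "closed_subring A" and V: "closed_subring V"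
    and B: "B \<subseteq> A" "\<And>b i. b \<in> B \<Longrightarrow> c b i \<in> V" and T: "T \<in> B"
    and gen: "generates B T A"
    and a: "a \<in> A"
  shows "c a i \<in> V"
proof -
  define S where "S = {a\<in>A. \<forall>i. c a i \<in> V}"
  have "A \<subseteq> S"
  proof (rule generatesD[OF gen])
    show "B \<subseteq> S" using B by (auto simp: S_def)
    show "x + y \<in> S" if "x \<in> S" "y \<in> S" for x y
      using that A V by (auto simp: S_def twisted_homD(4)[OF c A] closed_subringD)
    show "T * x \<in> S" if "x \<in> S" for x
      using that A V B T by (auto simp: S_def twisted_homD(2)[OF c A] closed_subringD(6) subset_iff
          intro!: closed_subring_sum closed_subringD(6)[OF V] closed_subring_power)
  qed
  then show ?thesis using a by (auto simp: S_def)
qed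

context constant_field
begin

lemma poly_drinfeld_to_ac:
  assumes D: "drinfeld_module k A 1 \<phi>" and a: "a \<in> A" "a \<noteq> 0"
  shows "poly (map_poly to_ac (\<phi> a)) x = (\<Sum>i\<le>deg a. to_ac (tc \<phi> a i) * x ^ q ^ i)"
proof -
  have "map_poly to_ac (\<phi> a) \<in> linear_polys q"
    using drinfeld_linear[OF D a(1)] by (auto simp: linear_polys_def coeff_map_poly)
  moreover have "coeff (map_poly to_ac (\<phi> a)) (q ^ i) = to_ac (tc \<phi> a i)" for i
    by (simp add: coeff_map_poly tc_def)
  ultimately show ?thesis
    using poly_linear_poly[of "map_poly to_ac (\<phi> a)" q "deg a" x] q_ge_2 tc_lead(2)[OF D a] by simp
qed

end

context drinfeld
begin

text \<open>
  The coefficients of all \<open>x \<mapsto> \<psi>\<^sub>a(\<alpha> x) / \<alpha>\<close>, where \<open>\<alpha>\<close> is a nonzero zero of \<open>\<psi>\<^sub>T\<close>. Since \<open>\<alpha>\<close> is a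
  torsion point for the fixed element \<open>T\<close>, the relation \<open>\<psi>\<^sub>T(\<alpha>) = 0\<close> survives the passage to an
  ultrapower. For torsion points without such a bound the statement would be false.
\<close>
theorem finite_normalised_coefficients:
  assumes b: "b \<in> A"
  shows "finite {to_ac (tc \<psi> b j) * \<alpha> ^ (q ^ j - 1) | \<psi> \<alpha>.
     drinfeld_module k A 1 \<psi> \<and> \<alpha> \<noteq> 0 \<and> poly (map_poly to_ac (\<psi> T)) \<alpha> = 0}" (is "finite ?S")
proof (rule ccontr)
  assume "infinite ?S"
  then obtain f :: "nat \<Rightarrow> 'l alg_closure" where f: "inj f" "range f \<subseteq> ?S"
    using infinite_countable_subset by blast
  then have "\<forall>n. \<exists>\<psi> \<alpha>. f n = to_ac (tc \<psi> b j) * \<alpha> ^ (q ^ j - 1) \<and> drinfeld_module k A 1 \<psi> \<and>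
     \<alpha> \<noteq> 0 \<and> poly (map_poly to_ac (\<psi> T)) \<alpha> = 0"
    unfolding image_subset_iff by blast
  then obtain \<Psi> \<alpha> where fn: "\<And>n. f n = to_ac (tc (\<Psi> n) b j) * \<alpha> n ^ (q ^ j - 1)"
    and \<Psi>: "\<And>n. drinfeld_module k A 1 (\<Psi> n)" and \<alpha>: "\<And>n. \<alpha> n \<noteq> 0"
    and root: "\<And>n. poly (map_poly to_ac (\<Psi> n T)) (\<alpha> n) = 0" by metis
  define c where "c n a i = to_ac (tc (\<Psi> n) a i) * \<alpha> n ^ (q ^ i - 1)" for n a i
  define C where "C a i = of_seq (\<lambda>n. c n a i)" for a i
  have c: "twisted_hom q A (c n)" for n
    unfolding c_def using q_ge_2
    by (intro twisted_hom_scale twisted_hom_to_ac drinfeld_twisted_hom \<Psi>) auto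
  have c_gt: "c n a i = 0" if "a \<in> A" "a \<noteq> 0" "i > deg a" for n a i
    using tc_lead(2)[OF \<Psi> that] by (simp add: c_def)
  have c_zero: "c n 0 i = 0" for n i
    by (rule twisted_homD(3)[OF c A T(1) T(1)])
  have C_gt: "C a i = 0" if "a \<in> A" "i > deg a" for a i
    unfolding C_def using c_gt[of a i] c_zero that by (cases "a = 0") (simp_all add: of_seq_simps)
  have c_0: "c n a 0 = to_ac a" if "a \<in> A" for n a
    using drinfeld_tc_0[OF \<Psi> that] by (simp add: c_def)
  have C_0: "C a 0 = ultra_const (to_ac a)" if "a \<in> A" for a
    unfolding C_def using c_0[OF that] by (simp add: ultra_const_def)
  have C: "twisted_hom q A C" unfolding C_def
  proof (rule twisted_hom_of_seq[OF c])
    fix a assume a: "a \<in> A"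
    have "c n a i = 0" if "i \<ge> Suc (deg a)" for n i
      using c_gt[OF a, of i n] c_zero that by (cases "a = 0") auto
    then show "\<exists>N. \<forall>i\<ge>N. \<forall>n. c n a i = 0" by blast
  qed
  define R where "R = range (ultra_const :: 'l alg_closure \<Rightarrow> _)"
  have uc: "ultra_const x - ultra_const y = ultra_const (x - y)" "ultra_const x * ultra_const y = ultra_const (x * y)"
    "ultra_const 1 = 1" "inverse (ultra_const x) = ultra_const (inverse x)" for x y :: "'l alg_closure"
    by (simp_all add: ultra_const_def of_seq_simps)
  have R: "closed_subring R" unfolding closed_subring_def R_def
    by (auto simp: uc) (metis rangeI uc(3))
  have fC: "of_seq f = C b j" unfolding C_def c_def fn[symmetric] by simp
  obtain V where V: "valuation_ring V" "R \<subseteq> V" "C b j \<notin> V"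
    using valuation_ring_avoiding[OF R, of "C b j"] injective_seq_not_integral[OF f(1)]
    unfolding fC R_def by metis
  note VR = valuation_ringD[OF V(1)]
  obtain B where B: "finite B" "B \<subseteq> A" "T \<in> B"
    and gen: "generates B T A"
    using generating_set by blast
  \<comment> \<open>Scaling by \<open>1/u\<close> divides \<open>C a i\<close> by \<open>u^(q^i - 1)\<close>. So \<open>u\<close> has to be the largest among roots of
     order \<open>q^i - 1\<close> of the coefficients \<open>C a i\<close>.\<close>
  define I where "I = (SIGMA a:B. {1..deg a})"
  have finI: "finite I" using B by (simp add: I_def)
  have qi: "q ^ i - 1 \<ge> 1" if "i \<ge> 1" for i
  proof -
    have "q ^ 1 \<le> q ^ i" using q_ge_2 that by (intro power_increasing) auto
    then show ?thesis using q_ge_2 by simp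
  qed
  have "\<forall>p\<in>I. \<exists>v. v ^ (q ^ snd p - 1) = C (fst p) (snd p)"
  proof
    fix p assume "p \<in> I"
    then have "snd p \<ge> 1" by (auto simp: I_def)
    then show "\<exists>v. v ^ (q ^ snd p - 1) = C (fst p) (snd p)" by (intro ultrapower_root qi)
  qed
  then obtain v where v: "\<And>a i. (a, i) \<in> I \<Longrightarrow> v (a, i) ^ (q ^ i - 1) = C a i" by (metis fst_conv snd_conv)
  have "\<exists>p\<in>I. v p \<noteq> 0"
  proof (rule ccontr)
    assume neg: "\<not> ?thesis"
    have "C a i \<in> V" if a: "a \<in> B" for a i
    proof (cases "(a, i) \<in> I")
      case True
      have v0: "v (a, i) = 0" using neg True by simp
      have "i \<ge> 1" using True by (simp add: I_def)
      then have "v (a, i) ^ (q ^ i - 1) = 0" unfolding v0 using qi[of i] by (intro zero_power) simp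
      then have "C a i = 0" unfolding v[OF True] .
      then show ?thesis using VR by (simp add: closed_subringD)
    next
      case False
      then have "i = 0 \<or> i > deg a" using a by (auto simp: I_def)
      then show ?thesis
      proof
        assume "i = 0" then show ?thesis using C_0[of a] a B V(2) by (auto simp: R_def)
      next
        assume "i > deg a" then show ?thesis using C_gt[of a i] a B VR by (auto simp: closed_subringD)
      qed
    qed
    then have "C b j \<in> V" by (rule twisted_hom_values_in_subring[OF C A VR B(2) _ B(3) gen b])
    with V(3) show False by simp
  qed
  then obtain p where "p \<in> I" "v p \<noteq> 0" by auto
  then obtain r where r: "r \<in> I" "v r \<noteq> 0" "\<And>p. p \<in> I \<Longrightarrow> v p / v r \<in> V"
    using valuation_ring_dominant[where f = v, OF V(1) finI] by metis
  obtain a0 i0 where "r = (a0, i0)" by (cases r)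
  with r have p0: "(a0, i0) \<in> I" "v (a0, i0) \<noteq> 0" and dom: "\<And>p. p \<in> I \<Longrightarrow> v p / v (a0, i0) \<in> V"
    by auto
  define u where "u = v (a0, i0)"
  define C' where "C' a i = C a i * inverse u ^ (q ^ i - 1)" for a i
  have u: "u \<noteq> 0" using p0 by (simp add: u_def)
  have C': "twisted_hom q A C'" unfolding C'_def using q_ge_2 by (intro twisted_hom_scale C) auto
  have C'I: "C' a i = (v (a, i) / u) ^ (q ^ i - 1)" if "(a, i) \<in> I" for a i
    unfolding C'_def v[OF that, symmetric] by (simp add: divide_inverse power_mult_distrib)
  have C'_0: "C' a 0 = ultra_const (to_ac a)" if "a \<in> A" for a
    using C_0[OF that] by (simp add: C'_def)
  have C'_V: "C' a i \<in> V" if a: "a \<in> A" for a i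
  proof (rule twisted_hom_values_in_subring[OF C' A VR B(2) _ B(3) gen a])
    fix a i assume a: "a \<in> B"
    show "C' a i \<in> V"
    proof (cases "(a, i) \<in> I")
      case True
      then show ?thesis using dom[OF True] VR unfolding C'I[OF True] u_def by (intro closed_subring_power)
    next
      case False
      then have "i = 0 \<or> i > deg a" using a by (auto simp: I_def)
      then show ?thesis
      proof
        assume "i = 0" then show ?thesis using C'_0[of a] a B V(2) by (auto simp: R_def)
      next
        assume "i > deg a" then show ?thesis using C_gt[of a i] a B VR by (auto simp: closed_subringD C'_def)
      qed
    qed
  qed
  interpret V: twisted_reduction q A V C'
  proof
    show "q \<ge> 2" by (rule q_ge_2)
    show "closed_subring A" by (rule A)
    show "(x + y) ^ q = x ^ q + y ^ q" for x y :: "'l alg_closure ultrapower"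
      by (rule power_additive_ultrapower[OF vanishing_binomials_alg_closure[OF van]])
    show "valuation_ring V" by (rule V)
    show "twisted_hom q A C'" by (rule C')
    show "C' a i \<in> V" if "a \<in> A" for a i by (rule C'_V[OF that])
    show "C' a 0 \<notin> nonunits V" if a: "a \<in> A" "a \<noteq> 0" for a
    proof -
      have "ultra_const (to_ac a) \<noteq> 0" using a
        by (auto simp: ultra_const_def of_seq_eq_iff simp flip: of_seq_simps(6))
      moreover have "inverse (ultra_const (to_ac a)) \<in> V" using V(2) by (auto simp: R_def uc)
      ultimately show ?thesis using C'_0[OF a(1)] by (simp add: nonunits_iff[OF V(1)])
    qed
    have "C' a0 i0 = 1" using C'I[OF p0(1)] u by (simp add: u_def)
    then show "\<exists>b\<in>A. \<exists>i\<ge>1. C' b i \<notin> nonunits V"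
      using p0(1) B(2) one_not_nonunit[OF V(1)]
      by (intro bexI[of _ a0] exI[of _ i0]) (auto simp: I_def)
  qed
  \<comment> \<open>The reduction has full degree at \<open>T\<close>, so its leading coefficient is a unit. Since
     \<open>\<Sum>i. C T i = 0\<close>, the scaled polynomial for \<open>T\<close> vanishes at \<open>u\<close>, and thus \<open>u\<close> is integral.\<close>
  define d where "d = deg T"
  have lead: "C' T d \<notin> nonunits V"
  proof
    assume mem: "C' T d \<in> nonunits V"
    have "C' T i \<in> nonunits V" if "i \<ge> d" for i
      using that mem C_gt[OF T(1), of i] zero_nonunit[OF V(1)]
      by (cases "i = d") (auto simp: C'_def d_def)
    then have low: "T \<in> V.low (Suc (d - 1))" using T deg_T by (auto simp: V.low_def d_def)
    obtain W where W: "finite W" "W \<subseteq> A" "card W = residue_card A T"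
      "\<And>w w' s. w \<in> W \<Longrightarrow> w' \<in> W \<Longrightarrow> s \<in> A \<Longrightarrow> w - w' = T * s \<Longrightarrow> w = w'"
      using residue_representatives[OF A T(1)] residue_card_deg[OF D T] q_ge_2
      by (metis zero_less_power gr0I not_numeral_le_zero)
    have "card W \<le> q ^ (d - 1)" by (rule V.card_residues_le[OF low T(2) W(1,2,4)])
    moreover have "card W = q ^ d" using W(3) residue_card_deg[OF D T] by (simp add: d_def)
    ultimately show False using q_ge_2 deg_T by (simp add: d_def)
  qed
  have sum0: "(\<Sum>i\<le>d. C' T i * u ^ q ^ i) = 0"
  proof -
    have c0: "(\<Sum>i\<le>d. c n T i) = 0" for n
    proof -
      have "\<alpha> n * (\<Sum>i\<le>d. c n T i) = (\<Sum>i\<le>d. to_ac (tc (\<Psi> n) T i) * \<alpha> n ^ q ^ i)"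
        unfolding sum_distrib_left c_def
      proof (rule sum.cong)
        fix i
        have "\<alpha> n * \<alpha> n ^ (q ^ i - 1) = \<alpha> n ^ q ^ i"
          using q_ge_2 by (metis One_nat_def Suc_pred not_gr_zero not_numeral_le_zero power_Suc zero_less_power)
        then show "\<alpha> n * (to_ac (tc (\<Psi> n) T i) * \<alpha> n ^ (q ^ i - 1)) = to_ac (tc (\<Psi> n) T i) * \<alpha> n ^ q ^ i"
          by (metis mult.left_commute)
      qed simp
      also have "\<dots> = 0" using root[of n] unfolding poly_drinfeld_to_ac[OF \<Psi> T] d_def .
      finally show ?thesis using \<alpha>[of n] by simp
    qed
    have "(\<Sum>i\<le>d. C' T i * u ^ q ^ i) = u * (\<Sum>i\<le>d. C T i)"
      unfolding sum_distrib_left C'_def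
    proof (rule sum.cong)
      fix i
      have "u ^ q ^ i = u * u ^ (q ^ i - 1)"
        using q_ge_2 by (metis One_nat_def Suc_pred not_gr_zero not_numeral_le_zero power_Suc zero_less_power)
      then show "C T i * inverse u ^ (q ^ i - 1) * u ^ q ^ i = u * C T i"
        using u by (simp add: power_inverse)
    qed simp
    also have "(\<Sum>i\<le>d. C T i) = 0" unfolding C_def of_seq_sum c0 by (rule of_seq_simps)
    finally show ?thesis by simp
  qed
  have "u \<in> V"
  proof (rule ccontr)
    assume nu: "u \<notin> V"
    then have iu: "inverse u \<in> nonunits V" by (rule inverse_nonunit[OF V(1)])
    have "0 = (\<Sum>i\<le>d. C' T i * u ^ q ^ i) * inverse u ^ q ^ d" by (simp add: sum0)
    also have "\<dots> = (\<Sum>i<d. C' T i * u ^ q ^ i * inverse u ^ q ^ d) + C' T d * u ^ q ^ d * inverse u ^ q ^ d"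
      unfolding lessThan_Suc_atMost[symmetric] sum.lessThan_Suc distrib_right sum_distrib_right ..
    also have "C' T d * u ^ q ^ d * inverse u ^ q ^ d = C' T d" using u by (simp add: power_inverse)
    finally have "C' T d = - (\<Sum>i<d. C' T i * u ^ q ^ i * inverse u ^ q ^ d)"
      by (simp only: eq_neg_iff_add_eq_0 add.commute)
    moreover have "\<dots> \<in> nonunits V"
    proof (intro nonunits_uminus nonunits_sum V(1))
      fix i assume "i \<in> {..<d}"
      then have lt: "q ^ i < q ^ d" using q_ge_2 by simp
      define e where "e = q ^ d - q ^ i - 1"
      have e: "q ^ d = q ^ i + e + 1" using lt by (simp add: e_def)
      have "C' T i * u ^ q ^ i * inverse u ^ q ^ d = (C' T i * inverse u ^ e) * inverse u"
        unfolding e power_add using u by (simp add: power_inverse)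
      also have "\<dots> \<in> nonunits V"
        using iu nonunits_subset[of V] C'_V[OF T(1), of i] VR
        by (intro nonunits_mult[OF V(1)] closed_subringD(6)[OF VR] closed_subring_power) auto
      finally show "C' T i * u ^ q ^ i * inverse u ^ q ^ d \<in> nonunits V" .
    qed
    ultimately show False using lead by simp
  qed
  then have "C' b j * u ^ (q ^ j - 1) \<in> V"
    by (intro closed_subringD(6)[OF VR] closed_subring_power C'_V b VR)
  also have "C' b j * u ^ (q ^ j - 1) = C b j" using u by (simp add: C'_def power_inverse)
  finally show False using V(3) by simp
qed

end

section \<open>Northcott's theorem for preperiodic points\<close>

definition closed_subfield :: "'a::field set \<Rightarrow> bool" where
  "closed_subfield F \<longleftrightarrow> closed_subring F \<and> (\<forall>x\<in>F. inverse x \<in> F)"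

definition algebraic_of_degree :: "'a::field set \<Rightarrow> nat \<Rightarrow> 'a \<Rightarrow> bool" where
  "algebraic_of_degree F n x \<longleftrightarrow> (\<exists>p\<in>polys_over F. p \<noteq> 0 \<and> degree p \<le> n \<and> poly p x = 0)"

text \<open>The last property replaces divisibility by \<open>\<mu>\<close>: a polynomial over \<open>F\<close> that vanishes at \<open>u\<close> vanishes
  at the conjugates of \<open>u\<close>.\<close>
lemma minimal_polynomial:
  assumes F: "closed_subfield F" and u: "algebraic_of_degree F n u"
  obtains \<mu> where "\<mu> \<in> polys_over F" "lead_coeff \<mu> = 1" "degree \<mu> \<le> n" "poly \<mu> u = 0"
    "\<And>p z. p \<in> polys_over F \<Longrightarrow> poly p u = 0 \<Longrightarrow> poly \<mu> z = 0 \<Longrightarrow> poly p z = 0"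
proof -
  have R: "closed_subring F" and inv: "\<And>x. x \<in> F \<Longrightarrow> inverse x \<in> F"
    using F by (auto simp: closed_subfield_def)
  define P where "P p \<longleftrightarrow> p \<in> polys_over F \<and> p \<noteq> 0 \<and> poly p u = 0" for p
  obtain p0 where p0: "P p0" "degree p0 \<le> n" using u by (auto simp: algebraic_of_degree_def P_def)
  obtain m where m: "P m" "\<And>p. P p \<Longrightarrow> degree m \<le> degree p"
    using ex_has_least_nat[of P p0 degree] p0 by auto
  define \<mu> where "\<mu> = smult (inverse (lead_coeff m)) m"
  have lm: "lead_coeff m \<in> F" using m by (auto simp: P_def polys_over_def)
  have \<mu>F: "\<mu> \<in> polys_over F" unfolding \<mu>_def using m by (intro smult_in_polys_over R inv lm) (auto simp: P_def)
  have l1: "lead_coeff \<mu> = 1" using m by (simp add: \<mu>_def P_def)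
  have d: "degree \<mu> = degree m" using m by (simp add: \<mu>_def P_def)
  have root: "poly \<mu> u = 0" using m by (simp add: \<mu>_def P_def)
  have min: "degree \<mu> \<le> degree p" if "p \<in> polys_over F" "p \<noteq> 0" "poly p u = 0" for p
    using m(2)[of p] that by (simp add: P_def d)
  have "poly p z = 0" if "p \<in> polys_over F" "poly p u = 0" "poly \<mu> z = 0" for p z
    using that(1,2)
  proof (induction "degree p" arbitrary: p rule: less_induct)
    case less
    show ?case
    proof (cases "p = 0")
      case False
      define e where "e = degree p - degree \<mu>"
      define r where "r = p - monom (lead_coeff p) e * \<mu>"
      have le: "degree \<mu> \<le> degree p" using min False less.prems by auto
      have pos: "degree \<mu> > 0"
      proof (rule ccontr)
        assume "\<not> degree \<mu> > 0"
        then obtain a where "\<mu> = [:a:]" by (metis degree_eq_zeroE gr0I)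
        with l1 root show False by simp
      qed
      have lp: "lead_coeff p \<in> F" using less.prems(1) by (simp add: polys_over_def)
      have rF: "r \<in> polys_over F" unfolding r_def
        by (intro polys_over_closed R less.prems(1) monom_in_polys_over lp \<mu>F)
      have "degree (monom (lead_coeff p) e * \<mu>) \<le> degree p"
        using degree_mult_le[of "monom (lead_coeff p) e" \<mu>] degree_monom_le[of "lead_coeff p" e] le
        by (simp add: e_def)
      then have "degree r \<le> degree p" unfolding r_def by (intro degree_diff_le) auto
      moreover have "coeff r (degree p) = 0"
        using le l1 by (simp add: r_def coeff_monom_mult e_def)
      ultimately have "degree r < degree p"
        using pos le by (metis eq_zero_or_degree_less leading_coeff_0_iff le_neq_implies_less degree_0 order_less_le_trans)
      moreover have "poly r u = 0" using less.prems root by (simp add: r_def)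
      ultimately have "poly r z = 0" by (intro less.hyps rF)
      then show ?thesis using that(3) by (simp add: r_def)
    qed simp
  qed
  moreover have "degree \<mu> \<le> n" using m(2)[OF p0(1)] p0(2) d by simp
  ultimately show thesis using that[OF \<mu>F l1 _ root] by blast
qed

text \<open>Expand \<open>e^n \<mu> = \<Prod>z. (e X - e z)\<close>.\<close>
lemma coeffs_of_split_poly:
  fixes \<mu> :: "'a::alg_closed_field poly"
  assumes V: "closed_subring V" and e: "e \<in> V" and monic: "lead_coeff \<mu> = 1"
    and roots: "\<And>z. poly \<mu> z = 0 \<Longrightarrow> e * z \<in> V"
  shows "e ^ degree \<mu> * coeff \<mu> i \<in> V"
proof -
  have "\<mu> \<noteq> 0" using monic by auto
  then obtain Z where Z: "size Z = degree \<mu>" "\<mu> = (\<Prod>x\<in>#Z. [:-x, 1:])"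
    using alg_closed_imp_factorization[of \<mu>] monic by auto
  have "poly \<mu> x = 0" if "x \<in># Z" for x
    using that unfolding Z(2) poly_prod_mset by (auto simp: image_iff intro!: bexI[of _ x])
  then have "\<forall>x\<in>#Z. e * x \<in> V" using roots by auto
  then have "smult (e ^ size Z) (\<Prod>x\<in>#Z. [:-x, 1:]) \<in> polys_over V"
  proof (induction Z)
    case empty then show ?case using polys_over_closed(1)[OF V] by (simp add: one_pCons)
  next
    case (add x Z)
    have eq: "smult (e ^ size (add_mset x Z)) (\<Prod>x\<in>#add_mset x Z. [:-x, 1:])
       = [:- (e * x), e:] * smult (e ^ size Z) (\<Prod>x\<in>#Z. [:-x, 1:])"
    proof -
      have "[:- (e * x), e:] = smult e [:-x, 1:]" by simp
      then show ?thesis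
        by (simp only: image_mset_add_mset prod_mset.add_mset mult_smult_left mult_smult_right
            smult_smult size_add_mset power_Suc mult.commute[of "e ^ size Z" e])
    qed
    have lin: "[:- (e * x), e:] \<in> polys_over V"
      using add.prems e V by (intro pCons_in_polys_over) (auto simp: closed_subringD polys_over_def)
    have IH: "smult (e ^ size Z) (\<Prod>x\<in>#Z. [:-x, 1:]) \<in> polys_over V" using add by simp
    show ?case unfolding eq by (rule polys_over_closed(6)[OF V lin IH])
  qed
  then show ?thesis unfolding Z(1) Z(2)[symmetric] by (simp add: polys_over_def)
qed

lemma finite_polys_bounded:
  fixes C :: "'a::zero set"
  assumes "finite C"
  shows "finite {p :: 'a poly. degree p \<le> n \<and> (\<forall>i. coeff p i \<in> C)}"
proof -
  have "p \<in> Poly ` {xs. set xs \<subseteq> C \<and> length xs = Suc n}" if "degree p \<le> n" "\<forall>i. coeff p i \<in> C" for p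
  proof
    show "p = Poly (map (coeff p) [0..<Suc n])"
      by (rule poly_eqI) (use that(1) in \<open>auto simp: coeff_Poly_eq nth_default_def coeff_eq_0 simp del: upt_Suc\<close>)
    show "map (coeff p) [0..<Suc n] \<in> {xs. set xs \<subseteq> C \<and> length xs = Suc n}"
      using that(2) by (auto simp del: upt_Suc)
  qed
  then show ?thesis
    by (intro finite_subset[OF _ finite_imageI[OF finite_lists_length_eq[OF assms, of "Suc n"], of Poly]]) auto
qed

text \<open>
  The model is \<open>F = k(T)\<close> with \<open>R = k[T]\<close> and with \<open>R'\<close> the local ring at infinity. Denominators in
  \<open>R\<close> and \<open>R'\<close> bound the poles of a function away from infinity and at infinity, and \<open>fin\<close> says
  that there are finitely many functions with bounded poles.
\<close>
locale northcott_field =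
  fixes F R R' :: "'a::alg_closed_field set"
  assumes F: "closed_subfield F"
    and R: "closed_subring R" "R \<subseteq> F" and R': "closed_subring R'" "R' \<subseteq> F"
    and frac: "\<And>x. x \<in> F \<Longrightarrow> \<exists>b\<in>R. b \<noteq> 0 \<and> b * x \<in> R" "\<And>x. x \<in> F \<Longrightarrow> \<exists>b\<in>R'. b \<noteq> 0 \<and> b * x \<in> R'"
    and normal: "\<And>x. x \<in> F \<Longrightarrow> integral_over R x \<Longrightarrow> x \<in> R" "\<And>x. x \<in> F \<Longrightarrow> integral_over R' x \<Longrightarrow> x \<in> R'"
    and fin: "\<And>e e'. e \<in> R \<Longrightarrow> e \<noteq> 0 \<Longrightarrow> e' \<in> R' \<Longrightarrow> e' \<noteq> 0 \<Longrightarrow> finite {x\<in>F. e * x \<in> R \<and> e' * x \<in> R'}"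
begin

text \<open>The conjugates of \<open>u\<close> satisfy the same integral equation, so the coefficients of the minimal
  polynomial lie in all valuation rings above \<open>S\<close>, up to the denominator.\<close>
lemma min_poly_coeffs:
  assumes S: "closed_subring S" "S \<subseteq> F" "\<And>x. x \<in> F \<Longrightarrow> integral_over S x \<Longrightarrow> x \<in> S"
    and e: "e \<in> S" and int: "integral_over S (e * u)"
    and \<mu>: "\<mu> \<in> polys_over F" "lead_coeff \<mu> = 1" "degree \<mu> \<le> n"
    and min: "\<And>p z. p \<in> polys_over F \<Longrightarrow> poly p u = 0 \<Longrightarrow> poly \<mu> z = 0 \<Longrightarrow> poly p z = 0"
  shows "e ^ n * coeff \<mu> i \<in> S"
proof -
  have FR: "closed_subring F" using F by (simp add: closed_subfield_def)
  obtain p where p: "p \<in> polys_over S" "lead_coeff p = 1" "poly p (e * u) = 0"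
    using int by (auto simp: integral_over_def)
  define p' where "p' = pcompose p [:0, e:]"
  have p': "p' \<in> polys_over F"
    using p(1) S(2) e FR unfolding p'_def polys_over_def
    by (auto simp: coeff_pcompose_linear intro!: closed_subringD(6)[OF FR] closed_subring_power[OF FR])
  have ez: "integral_over S (e * z)" if "poly \<mu> z = 0" for z
  proof -
    have "poly p' u = 0" using p(3) by (simp add: p'_def poly_pcompose mult.commute)
    then have "poly p' z = 0" using min[OF p' _ that] by simp
    then have "poly p (e * z) = 0" by (simp add: p'_def poly_pcompose mult.commute)
    then show ?thesis using p by (auto simp: integral_over_def)
  qed
  have eF: "e \<in> F" "coeff \<mu> i \<in> F" using e S(2) \<mu>(1) by (auto simp: polys_over_def)
  have "e ^ degree \<mu> * coeff \<mu> i \<in> S"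
  proof (rule S(3))
    show "e ^ degree \<mu> * coeff \<mu> i \<in> F" by (intro closed_subringD(6)[OF FR] closed_subring_power FR eF)
    show "integral_over S (e ^ degree \<mu> * coeff \<mu> i)"
      unfolding integral_over_iff_valuation_rings[OF S(1)]
    proof (intro allI impI, elim conjE)
      fix V assume V: "valuation_ring V" "S \<subseteq> V"
      show "e ^ degree \<mu> * coeff \<mu> i \<in> V"
      proof (rule coeffs_of_split_poly)
        show "closed_subring V" by (rule valuation_ringD[OF V(1)])
        show "e \<in> V" using e V by auto
        show "lead_coeff \<mu> = 1" by (rule \<mu>)
        show "e * z \<in> V" if "poly \<mu> z = 0" for z
          using ez[OF that] V integral_over_iff_valuation_rings[OF S(1)] by blast
      qed
    qed
  qed
  then have "e ^ (n - degree \<mu>) * (e ^ degree \<mu> * coeff \<mu> i) \<in> S"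
    by (rule closed_subringD(6)[OF S(1) closed_subring_power[OF S(1) e]])
  then show ?thesis using \<mu>(3) by (simp add: mult.assoc[symmetric] power_add[symmetric])
qed

theorem finite_bounded_degree_and_denominators:
  assumes e: "e \<in> R" "e \<noteq> 0" and e': "e' \<in> R'" "e' \<noteq> 0"
  shows "finite {u. algebraic_of_degree F n u \<and> integral_over R (e * u) \<and> integral_over R' (e' * u)}"
    (is "finite ?S")
proof -
  define C where "C = {x\<in>F. e ^ n * x \<in> R \<and> e' ^ n * x \<in> R'}"
  have "finite C" unfolding C_def using e e' R R' by (intro fin) (auto intro: closed_subring_power)
  define P where "P = {p :: 'a poly. degree p \<le> n \<and> (\<forall>i. coeff p i \<in> C)}"
  have "finite P" unfolding P_def by (rule finite_polys_bounded[OF \<open>finite C\<close>])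
  have "?S \<subseteq> (\<Union>p\<in>P - {0}. {x. poly p x = 0})"
  proof (clarify)
    fix u assume u: "algebraic_of_degree F n u" "integral_over R (e * u)" "integral_over R' (e' * u)"
    obtain \<mu> where \<mu>: "\<mu> \<in> polys_over F" "lead_coeff \<mu> = 1" "degree \<mu> \<le> n" "poly \<mu> u = 0"
      "\<And>p z. p \<in> polys_over F \<Longrightarrow> poly p u = 0 \<Longrightarrow> poly \<mu> z = 0 \<Longrightarrow> poly p z = 0"
      using minimal_polynomial[OF F u(1)] by metis
    have "e ^ n * coeff \<mu> i \<in> R" for i
      by (rule min_poly_coeffs[OF R normal(1) e(1) u(2) \<mu>(1,2,3,5)])
    moreover have "e' ^ n * coeff \<mu> i \<in> R'" for i
      by (rule min_poly_coeffs[OF R' normal(2) e'(1) u(3) \<mu>(1,2,3,5)])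
    ultimately have "\<mu> \<in> P" using \<mu> by (auto simp: P_def C_def polys_over_def)
    moreover have "\<mu> \<noteq> 0" using \<mu>(2) by auto
    ultimately show "u \<in> (\<Union>p\<in>P - {0}. {x. poly p x = 0})" using \<mu>(4) by auto
  qed
  moreover have "finite (\<Union>p\<in>P - {0}. {x. poly p x = 0})"
    using \<open>finite P\<close> by (auto intro!: poly_roots_finite)
  ultimately show ?thesis by (rule finite_subset)
qed

end

lemma clear_denominator:
  fixes F :: "'a::field set"
  assumes F: "closed_subfield F" and R: "closed_subring R"
    and frac: "\<And>x. x \<in> F \<Longrightarrow> \<exists>b\<in>R. b \<noteq> 0 \<and> b * x \<in> R"
    and g: "algebraic_of_degree F n g"
  obtains e where "e \<in> R" "e \<noteq> 0" "integral_over R (e * g)"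
proof -
  obtain \<mu> where \<mu>: "\<mu> \<in> polys_over F" "lead_coeff \<mu> = 1" "poly \<mu> g = 0"
    using minimal_polynomial[OF F g] by metis
  have "\<exists>e\<in>R. e \<noteq> 0 \<and> (\<forall>i<m. e * coeff \<mu> i \<in> R)" for m
  proof (induction m)
    case 0 then show ?case using R by (intro bexI[of _ 1]) (auto simp: closed_subringD)
  next
    case (Suc m)
    then obtain e where e: "e \<in> R" "e \<noteq> 0" "\<forall>i<m. e * coeff \<mu> i \<in> R" by auto
    obtain b where b: "b \<in> R" "b \<noteq> 0" "b * coeff \<mu> m \<in> R" using frac \<mu>(1) by (auto simp: polys_over_def)
    have "(b * e) * coeff \<mu> i \<in> R" if "i < Suc m" for i
    proof (cases "i = m")
      case True
      have "e * (b * coeff \<mu> m) \<in> R" using e b R by (auto intro: closed_subringD)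
      then show ?thesis using True by (simp add: mult.assoc mult.left_commute)
    next
      case False
      then have "b * (e * coeff \<mu> i) \<in> R" using e b R that by (auto intro: closed_subringD(6))
      then show ?thesis by (simp add: mult.assoc)
    qed
    then show ?case using e b R by (intro bexI[of _ "b * e"]) (auto intro: closed_subringD)
  qed
  then obtain e where e: "e \<in> R" "e \<noteq> 0" "\<And>i. i < degree \<mu> \<Longrightarrow> e * coeff \<mu> i \<in> R" by blast
  define d where "d = degree \<mu>"
  define p where "p = smult (e ^ d) (pcompose \<mu> [:0, inverse e:])"
  have cp: "coeff p i = e ^ d * inverse e ^ i * coeff \<mu> i" for i
    by (simp add: p_def coeff_pcompose_linear)
  have dp: "degree p = d"
    using e(2) by (simp add: p_def d_def degree_pcompose)
  have "lead_coeff p = 1" unfolding dp cp using \<mu>(2) e(2) by (simp add: d_def power_inverse)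
  moreover have "p \<in> polys_over R" unfolding polys_over_def
  proof safe
    fix i
    consider "i < d" | "i = d" | "i > d" by linarith
    then show "coeff p i \<in> R"
    proof cases
      case 1
      define m where "m = d - i - 1"
      have m: "d = i + m + 1" using 1 by (simp add: m_def)
      have "coeff p i = e ^ m * (e * coeff \<mu> i)"
        unfolding cp m using e(2) by (simp add: power_add power_inverse)
      moreover have "e ^ m * (e * coeff \<mu> i) \<in> R"
        by (rule closed_subringD(6)[OF R closed_subring_power[OF R e(1)] e(3)]) (use 1 in \<open>simp add: d_def\<close>)
      ultimately show ?thesis by simp
    next
      case 2 then show ?thesis using \<open>lead_coeff p = 1\<close> dp R by (simp add: closed_subringD)
    next
      case 3 then show ?thesis using dp R by (simp add: coeff_eq_0 closed_subringD)
    qed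
  qed
  moreover have "poly p (e * g) = 0"
  proof -
    have "e * g * inverse e = g" using e(2) by (simp add: field_simps)
    moreover have "poly p (e * g) = e ^ d * poly \<mu> (e * g * inverse e)"
      by (simp add: p_def poly_pcompose)
    ultimately show ?thesis by (simp only: \<mu>(3) mult_zero_right)
  qed
  ultimately have "integral_over R (e * g)" by (auto simp: integral_over_def)
  with e that show thesis by blast
qed

lemma clear_denominators:
  fixes F :: "'a::field set"
  assumes F: "closed_subfield F" and R: "closed_subring R"
    and frac: "\<And>x. x \<in> F \<Longrightarrow> \<exists>b\<in>R. b \<noteq> 0 \<and> b * x \<in> R"
    and G: "finite G" "\<And>g. g \<in> G \<Longrightarrow> algebraic_of_degree F n g"
  obtains e where "e \<in> R" "e \<noteq> 0" "\<And>V g. valuation_ring V \<Longrightarrow> R \<subseteq> V \<Longrightarrow> g \<in> G \<Longrightarrow> e * g \<in> V"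
proof -
  have "\<exists>e\<in>R. e \<noteq> 0 \<and> (\<forall>V g. valuation_ring V \<longrightarrow> R \<subseteq> V \<longrightarrow> g \<in> G \<longrightarrow> e * g \<in> V)"
    using G
  proof (induction G rule: finite_induct)
    case empty then show ?case using R by (intro bexI[of _ 1]) (auto simp: closed_subringD)
  next
    case (insert g G)
    then obtain e where e: "e \<in> R" "e \<noteq> 0" "\<And>V g. valuation_ring V \<Longrightarrow> R \<subseteq> V \<Longrightarrow> g \<in> G \<Longrightarrow> e * g \<in> V"
      by auto
    obtain b where b: "b \<in> R" "b \<noteq> 0" "integral_over R (b * g)"
      using clear_denominator[OF F R frac] insert.prems by (metis insertI1)
    have "b * e * h \<in> V" if V: "valuation_ring V" "R \<subseteq> V" and h: "h \<in> insert g G" for V h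
    proof (cases "h = g")
      case True
      have "b * g \<in> V" using b(3) V integral_over_iff_valuation_rings[OF R] by blast
      then have "e * (b * g) \<in> V" using e(1) V valuation_ringD[OF V(1)] by (auto intro: closed_subringD(6))
      then show ?thesis using True by (simp add: ac_simps)
    next
      case False
      then have "e * h \<in> V" using e(3) V h by auto
      then have "b * (e * h) \<in> V" using b(1) V valuation_ringD[OF V(1)] by (auto intro: closed_subringD(6))
      then show ?thesis by (simp add: ac_simps)
    qed
    then show ?case using e b R by (intro bexI[of _ "b * e"]) (auto intro: closed_subringD)
  qed
  then show thesis using that by blast
qed

text \<open>If \<open>x\<close> is larger than all these elements in absolute value, the leading term of \<open>f(x)\<close> dominates
  the others and is larger than \<open>x\<close>.\<close>
definition escape_radii :: "'a::field poly \<Rightarrow> 'a set" where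
  "escape_radii f = insert 1 (insert (1 / lead_coeff f) ((\<lambda>j. coeff f j / lead_coeff f) ` {..<degree f})) - {0}"

text \<open>
  A point beyond the escape radii is mapped to a strictly larger one, again beyond the escape radii.
  So its orbit is infinite.
\<close>
lemma preperiodic_bounded:
  fixes f :: "'a::field poly"
  assumes f: "degree f \<ge> 2" and V: "valuation_ring V"
    and Z: "finite Z" "\<And>x. x \<in> Z \<Longrightarrow> poly f x \<in> Z" and u: "u \<in> Z"
  shows "\<exists>g\<in>escape_radii f. u / g \<in> V"
proof (rule ccontr)
  assume neg: "\<not> ?thesis"
  note VR = valuation_ringD[OF V]
  define Q where "Q = degree f"
  define l where "l = lead_coeff f"
  have l: "l \<noteq> 0" using f by (auto simp: l_def)
  define large where "large x \<longleftrightarrow> (\<forall>g\<in>escape_radii f. g / x \<in> nonunits V) \<and> x \<noteq> 0" for x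
  have large_u: "large u"
  proof -
    have "u \<noteq> 0" using neg VR by (auto simp: escape_radii_def closed_subringD)
    moreover have "g / u \<in> nonunits V" if "g \<in> escape_radii f" for g
      using inverse_nonunit[OF V, of "u / g"] neg that by (simp add: inverse_divide)
    ultimately show ?thesis by (simp add: large_def)
  qed
  have step: "large (poly f x) \<and> x / poly f x \<in> nonunits V" if x: "large x" for x
  proof -
    have x0: "x \<noteq> 0" using x by (simp add: large_def)
    have "1 \<in> escape_radii f" "1 / l \<in> escape_radii f" using l by (auto simp: escape_radii_def l_def)
    then have "1 / x \<in> nonunits V" "1 / l / x \<in> nonunits V" using x unfolding large_def by blast+
    then have ix: "inverse x \<in> nonunits V" and il: "inverse l * inverse x \<in> nonunits V"
      by (simp_all add: divide_inverse)
    then have ixV: "inverse x \<in> V" using nonunits_subset by auto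
    define w where "w = (\<Sum>j<Q. coeff f j / l * x ^ j * inverse x ^ Q)"
    have w: "w \<in> nonunits V" unfolding w_def
    proof (rule nonunits_sum[OF V])
      fix j assume "j \<in> {..<Q}"
      then have j: "j < Q" by simp
      define m where "m = Q - j - 1"
      have m: "Q = j + m + 1" using j by (simp add: m_def)
      have "coeff f j / l / x \<in> nonunits V"
      proof (cases "coeff f j = 0")
        case True then show ?thesis using zero_nonunit[OF V] by simp
      next
        case False
        then have "coeff f j / l \<in> escape_radii f" using j l by (auto simp: escape_radii_def l_def Q_def)
        then show ?thesis using x by (auto simp: large_def)
      qed
      then have "inverse x ^ m * (coeff f j / l / x) \<in> nonunits V"
        using ixV VR by (intro nonunits_mult[OF V] closed_subring_power)
      also have "inverse x ^ m * (coeff f j / l / x) = coeff f j / l * x ^ j * inverse x ^ Q"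
        unfolding m power_add using x0 by (simp add: power_inverse divide_inverse)
      finally show "coeff f j / l * x ^ j * inverse x ^ Q \<in> nonunits V" .
    qed
    have fx: "poly f x = l * x ^ Q * (1 + w)"
    proof -
      have "poly f x = (\<Sum>j<Q. coeff f j * x ^ j) + l * x ^ Q"
        unfolding poly_altdef Q_def[symmetric] lessThan_Suc_atMost[symmetric] sum.lessThan_Suc
        by (simp add: l_def Q_def)
      also have "(\<Sum>j<Q. coeff f j * x ^ j) = l * x ^ Q * w"
        unfolding w_def sum_distrib_left using l x0 by (intro sum.cong) (auto simp: field_simps)
      finally show ?thesis by (simp add: algebra_simps)
    qed
    have "1 + w \<notin> nonunits V" using nonunits_diff[OF V _ w, of "1 + w"] one_not_nonunit[OF V] by auto
    then have w1: "1 + w \<noteq> 0" "inverse (1 + w) \<in> V" by (auto simp: nonunits_iff[OF V])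
    have quot: "x / poly f x \<in> nonunits V"
    proof -
      define m where "m = Q - 2"
      have m: "Q = m + 2" using f by (simp add: m_def Q_def)
      have "inverse (1 + w) * inverse x ^ m * (inverse l * inverse x) \<in> nonunits V"
        using w1 ixV VR by (intro nonunits_mult[OF V _ il] closed_subringD(6) closed_subring_power)
      also have "inverse (1 + w) * inverse x ^ m * (inverse l * inverse x) = x / poly f x"
      proof -
        have "inverse y * inverse x ^ m * (inverse l * inverse x) = x / (l * (x ^ m * x ^ 2) * y)"
          if "y \<noteq> 0" for y
          using that x0 l by (simp add: field_simps power2_eq_square)
        from this[OF w1(1)] show ?thesis unfolding fx m power_add .
      qed
      finally show ?thesis .
    qed
    moreover have "poly f x \<noteq> 0" using fx l x0 w1 by simp
    moreover have "g / poly f x \<in> nonunits V" if "g \<in> escape_radii f" for g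
    proof -
      have "(g / x) * (x / poly f x) \<in> nonunits V"
        using x that quot nonunits_subset[of V] by (intro nonunits_mult[OF V]) (auto simp: large_def)
      then show ?thesis using x0 by simp
    qed
    ultimately show ?thesis by (simp add: large_def)
  qed
  define orb where "orb n = ((poly f) ^^ n) u" for n
  have large: "large (orb n)" for n by (induction n) (auto simp: orb_def large_u step)
  have oZ: "orb n \<in> Z" for n by (induction n) (auto simp: orb_def u Z)
  have lt: "orb n / orb (n + Suc m) \<in> nonunits V" for n m
  proof (induction m)
    case 0 then show ?case using step[OF large[of n]] by (simp add: orb_def)
  next
    case (Suc m)
    have "(orb n / orb (n + Suc m)) * (orb (n + Suc m) / orb (n + Suc (Suc m))) \<in> nonunits V"
      using step[OF large[of "n + Suc m"]] Suc nonunits_subset[of V]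
      by (intro nonunits_mult[OF V]) (auto simp: orb_def)
    then show ?case using large[of "n + Suc m"] by (simp add: large_def)
  qed
  have "orb n \<noteq> orb m" if nm: "n < m" for n m
  proof
    assume "orb n = orb m"
    moreover obtain j where "m = n + Suc j" using less_imp_Suc_add[OF nm] by auto
    ultimately have "orb n / orb n \<in> nonunits V" using lt[of n j] by simp
    then show False using large[of n] one_not_nonunit[OF V] by (simp add: large_def)
  qed
  then have "inj orb" by (metis injI linorder_neqE_nat)
  moreover have "range orb \<subseteq> Z" using oZ by auto
  ultimately show False using Z(1) by (metis finite_imageD finite_subset infinite_UNIV_nat)
qed

context northcott_field
begin

text \<open>The escape radii are elements of a finite extension of \<open>F\<close>, so one denominator makes all
  preperiodic points integral over \<open>R\<close>, and another one over \<open>R'\<close>.\<close>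
theorem finite_preperiodic:
  assumes f: "degree f \<ge> 2" "\<And>g. g \<in> escape_radii f \<Longrightarrow> \<exists>m. algebraic_of_degree F m g"
  shows "finite {u. algebraic_of_degree F n u \<and> (\<exists>Z. finite Z \<and> (\<forall>x\<in>Z. poly f x \<in> Z) \<and> u \<in> Z)}"
    (is "finite ?S")
proof -
  have G: "finite (escape_radii f)" by (simp add: escape_radii_def)
  obtain m where m: "\<And>g. g \<in> escape_radii f \<Longrightarrow> algebraic_of_degree F (m g) g" using f(2) by metis
  have G': "algebraic_of_degree F (sum m (escape_radii f)) g" if "g \<in> escape_radii f" for g
    using m[OF that] member_le_sum[of g "escape_radii f" m] G that
    by (fastforce simp: algebraic_of_degree_def)
  obtain e where e: "e \<in> R" "e \<noteq> 0" "\<And>V g. valuation_ring V \<Longrightarrow> R \<subseteq> V \<Longrightarrow> g \<in> escape_radii f \<Longrightarrow> e * g \<in> V"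
    using clear_denominators[OF F R(1) frac(1) G G'] by metis
  obtain e' where e': "e' \<in> R'" "e' \<noteq> 0" "\<And>V g. valuation_ring V \<Longrightarrow> R' \<subseteq> V \<Longrightarrow> g \<in> escape_radii f \<Longrightarrow> e' * g \<in> V"
    using clear_denominators[OF F R'(1) frac(2) G G'] by metis
  have int: "integral_over S (d * u)"
    if S: "closed_subring S" and d: "\<And>V g. valuation_ring V \<Longrightarrow> S \<subseteq> V \<Longrightarrow> g \<in> escape_radii f \<Longrightarrow> d * g \<in> V"
      and Z: "finite Z" "\<forall>x\<in>Z. poly f x \<in> Z" "u \<in> Z" for S d u Z
    unfolding integral_over_iff_valuation_rings[OF S]
  proof (intro allI impI, elim conjE)
    fix V assume V: "valuation_ring V" "S \<subseteq> V"
    obtain g where g: "g \<in> escape_radii f" "u / g \<in> V"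
      using preperiodic_bounded[OF f(1) V(1) Z(1) _ Z(3)] Z(2) by blast
    have "(d * g) * (u / g) \<in> V" by (rule closed_subringD(6)[OF valuation_ringD[OF V(1)] d[OF V g(1)] g(2)])
    moreover have "g \<noteq> 0" using g by (simp add: escape_radii_def)
    ultimately show "d * u \<in> V" by simp
  qed
  show ?thesis
  proof (rule finite_subset[OF _ finite_bounded_degree_and_denominators[OF e(1,2) e'(1,2), of n]], safe)
    fix u Z assume Z: "finite Z" "\<forall>x\<in>Z. poly f x \<in> Z" "u \<in> Z"
    show "integral_over R (e * u)" by (rule int[OF R(1) e(3) Z])
    show "integral_over R' (e' * u)" by (rule int[OF R'(1) e'(3) Z])
  qed
qed

end

section \<open>The rational function field \<open>k(T)\<close>\<close>

lemma polynomial_division: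
  assumes k: "closed_subfield k" and a: "a \<in> polys_over k" and b: "b \<in> polys_over k" "b \<noteq> 0"
  obtains s r where "s \<in> polys_over k" "r \<in> polys_over k" "a = b * s + r" "r = 0 \<or> degree r < degree b"
proof -
  have R: "closed_subring k" and inv: "\<And>x. x \<in> k \<Longrightarrow> inverse x \<in> k"
    using k by (auto simp: closed_subfield_def)
  have "\<exists>s\<in>polys_over k. \<exists>r\<in>polys_over k. a = b * s + r \<and> (r = 0 \<or> degree r < degree b)"
    using a
  proof (induction "degree a" arbitrary: a rule: less_induct)
    case less
    show ?case
    proof (cases "a = 0 \<or> degree a < degree b")
      case True
      then show ?thesis using less.prems polys_over_closed(2)[OF R]
        by (intro bexI[of _ 0] bexI[of _ a]) auto
    next
      case False
      define l where "l = lead_coeff a * inverse (lead_coeff b)"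
      define e where "e = degree a - degree b"
      define a' where "a' = a - monom l e * b"
      have l: "l \<in> k" unfolding l_def using less.prems b R inv by (auto simp: polys_over_def intro!: closed_subringD(6))
      have m: "monom l e \<in> polys_over k" by (rule monom_in_polys_over[OF R l])
      have a': "a' \<in> polys_over k" unfolding a'_def by (intro polys_over_closed R less.prems m b)
      have "degree (monom l e * b) \<le> degree a"
        using degree_mult_le[of "monom l e" b] degree_monom_le[of l e] False unfolding e_def by linarith
      then have d: "degree a' \<le> degree a" unfolding a'_def by (intro degree_diff_le) auto
      have c: "coeff a' (degree a) = 0" using False b by (simp add: a'_def coeff_monom_mult e_def l_def)
      show ?thesis
      proof (cases "degree a = 0")
        case True
        then have "a' = 0" using c d by (metis leading_coeff_0_iff le_zero_eq)
        then show ?thesis using m polys_over_closed(2)[OF R]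
          by (intro bexI[of _ "monom l e"] bexI[of _ 0]) (auto simp: a'_def mult.commute)
      next
        case False
        have "degree a' < degree a"
        proof (cases "a' = 0")
          case False
          then show ?thesis using c d by (metis leading_coeff_0_iff le_neq_implies_less)
        qed (use False in simp)
        from less.hyps[OF this a'] obtain s r
          where sr: "s \<in> polys_over k" "r \<in> polys_over k" "a' = b * s + r" "r = 0 \<or> degree r < degree b" by blast
        have "a = b * (monom l e + s) + r" using sr(3) by (simp add: a'_def algebra_simps)
        moreover have "monom l e + s \<in> polys_over k" by (intro polys_over_closed R m sr)
        ultimately show ?thesis using sr by blast
      qed
    qed
  qed
  then show thesis using that by blast
qed

definition rational_functions :: "'a::field set \<Rightarrow> 'a \<Rightarrow> 'a set" where
  "rational_functions k T = {poly a T / poly b T | a b. a \<in> polys_over k \<and> b \<in> polys_over k \<and> b \<noteq> 0}"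

definition regular_at_infinity :: "'a::field set \<Rightarrow> 'a \<Rightarrow> 'a set" where
  "regular_at_infinity k T = {poly a T / poly b T | a b.
     a \<in> polys_over k \<and> b \<in> polys_over k \<and> b \<noteq> 0 \<and> degree a \<le> degree b}"

locale transcendental_element =
  fixes k :: "'a::field set" and T :: 'a
  assumes fin_k: "finite k" and k: "closed_subfield k"
    and trans: "\<And>p. p \<in> polys_over k \<Longrightarrow> poly p T = 0 \<Longrightarrow> p = 0"
begin

lemma kR: "closed_subring k" using k by (simp add: closed_subfield_def)

lemmas polys_closed = polys_over_closed[OF kR]

lemma eval_inj: "p \<in> polys_over k \<Longrightarrow> q \<in> polys_over k \<Longrightarrow> poly p T = poly q T \<Longrightarrow> p = q"
  using trans[of "p - q"] polys_closed(3) by simp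

lemma poly_T_nonzero: "b \<in> polys_over k \<Longrightarrow> b \<noteq> 0 \<Longrightarrow> poly b T \<noteq> 0"
  using trans by blast

lemma rational_functions_subfield: "closed_subfield (rational_functions k T)"
  unfolding closed_subfield_def closed_subring_def
proof (intro conjI ballI)
  show "1 \<in> rational_functions k T" unfolding rational_functions_def
    using polys_closed(1) by (auto intro!: exI[of _ 1])
  fix x assume "x \<in> rational_functions k T"
  then obtain a b where ab: "x = poly a T / poly b T" "a \<in> polys_over k" "b \<in> polys_over k" "b \<noteq> 0"
    by (auto simp: rational_functions_def)
  show "inverse x \<in> rational_functions k T"
  proof (cases "a = 0")
    case True
    then have "inverse x = poly 0 T / poly 1 T" by (simp add: ab)
    then show ?thesis using polys_closed(1,2) one_neq_zero unfolding rational_functions_def by blast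
  next
    case False
    moreover have "inverse x = poly b T / poly a T" by (simp add: ab)
    ultimately show ?thesis using ab unfolding rational_functions_def by blast
  qed
  fix y assume "y \<in> rational_functions k T"
  then obtain c d where cd: "y = poly c T / poly d T" "c \<in> polys_over k" "d \<in> polys_over k" "d \<noteq> 0"
    by (auto simp: rational_functions_def)
  note nz = poly_T_nonzero[OF ab(3,4)] poly_T_nonzero[OF cd(3,4)]
  have "x - y = poly (a * d - c * b) T / poly (b * d) T"
    using nz by (simp add: ab cd field_simps)
  then show "x - y \<in> rational_functions k T" unfolding rational_functions_def
    using ab cd polys_closed by (intro CollectI exI[of _ "a * d - c * b"] exI[of _ "b * d"]) auto
  have "x * y = poly (a * c) T / poly (b * d) T" by (simp add: ab cd)
  then show "x * y \<in> rational_functions k T" unfolding rational_functions_def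
    using ab cd polys_closed by (intro CollectI exI[of _ "a * c"] exI[of _ "b * d"]) auto
qed

lemma regular_at_infinity_subring: "closed_subring (regular_at_infinity k T)"
  unfolding closed_subring_def
proof (intro conjI ballI)
  show "1 \<in> regular_at_infinity k T" unfolding regular_at_infinity_def
    using polys_closed(1) by (auto intro!: exI[of _ 1])
  fix x y assume "x \<in> regular_at_infinity k T" "y \<in> regular_at_infinity k T"
  then obtain a b c d where ab: "x = poly a T / poly b T" "a \<in> polys_over k" "b \<in> polys_over k" "b \<noteq> 0" "degree a \<le> degree b"
    and cd: "y = poly c T / poly d T" "c \<in> polys_over k" "d \<in> polys_over k" "d \<noteq> 0" "degree c \<le> degree d"
    unfolding regular_at_infinity_def by blast
  note nz = poly_T_nonzero[OF ab(3,4)] poly_T_nonzero[OF cd(3,4)]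
  have bd: "degree (b * d) = degree b + degree d" using ab cd by (intro degree_mult_eq)
  have "x - y = poly (a * d - c * b) T / poly (b * d) T"
    using nz by (simp add: ab cd field_simps)
  moreover have "degree (a * d - c * b) \<le> degree (b * d)"
    using degree_mult_le[of a d] degree_mult_le[of c b] ab(5) cd(5) unfolding bd
    by (intro degree_diff_le) linarith+
  ultimately show "x - y \<in> regular_at_infinity k T" unfolding regular_at_infinity_def
    using ab cd polys_closed by (intro CollectI exI[of _ "a * d - c * b"] exI[of _ "b * d"]) auto
  have "x * y = poly (a * c) T / poly (b * d) T" by (simp add: ab cd)
  moreover have "degree (a * c) \<le> degree (b * d)"
    using degree_mult_le[of a c] ab(5) cd(5) unfolding bd by linarith
  ultimately show "x * y \<in> regular_at_infinity k T" unfolding regular_at_infinity_def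
    using ab cd polys_closed by (intro CollectI exI[of _ "a * c"] exI[of _ "b * d"]) auto
qed

lemma kT_subset: "adjoin k T \<subseteq> rational_functions k T"
proof
  fix x assume "x \<in> adjoin k T"
  then obtain a where "a \<in> polys_over k" "x = poly a T" by (auto simp: adjoin_def)
  then show "x \<in> rational_functions k T" unfolding rational_functions_def
    using polys_closed(1) by (intro CollectI exI[of _ a] exI[of _ 1]) auto
qed

lemma regular_subset: "regular_at_infinity k T \<subseteq> rational_functions k T"
  unfolding regular_at_infinity_def rational_functions_def by blast

lemma regular_or_inverse:
  assumes "x \<in> rational_functions k T"
  shows "x \<in> regular_at_infinity k T \<or> inverse x \<in> regular_at_infinity k T"
proof -
  obtain a b where ab: "x = poly a T / poly b T" "a \<in> polys_over k" "b \<in> polys_over k" "b \<noteq> 0"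
    using assms by (auto simp: rational_functions_def)
  show ?thesis
  proof (cases "degree a \<le> degree b")
    case True then show ?thesis using ab unfolding regular_at_infinity_def by blast
  next
    case False
    then have "a \<noteq> 0" "degree b \<le> degree a" by auto
    moreover have "inverse x = poly b T / poly a T" by (simp add: ab)
    ultimately show ?thesis using ab unfolding regular_at_infinity_def by blast
  qed
qed

text \<open>
  Subtracting a polynomial, assume that \<open>y = r/b\<close> has \<open>degree r < degree b\<close>. Integrality provides a common
  denominator \<open>b^n\<close> of all powers of \<open>y\<close>. But \<open>b^n y^j\<close> has negative degree for large \<open>j\<close>, so it is a
  polynomial only if \<open>y = 0\<close>.
\<close>
lemma kT_normal:
  assumes x: "x \<in> rational_functions k T" and int: "integral_over (adjoin k T) x"
  shows "x \<in> adjoin k T"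
proof -
  define S where "S = adjoin k T"
  have S: "closed_subring S" unfolding S_def by (rule adjoin_subring(1)[OF kR])
  have mem: "poly p T \<in> S" if "p \<in> polys_over k" for p using that by (simp add: S_def adjoin_def)
  obtain a b where ab: "x = poly a T / poly b T" "a \<in> polys_over k" "b \<in> polys_over k" "b \<noteq> 0"
    using x by (auto simp: rational_functions_def)
  obtain s r where sr: "s \<in> polys_over k" "r \<in> polys_over k" "a = b * s + r" "r = 0 \<or> degree r < degree b"
    using polynomial_division[OF k ab(2-4)] by blast
  define y where "y = poly r T / poly b T"
  have nz: "poly b T \<noteq> 0" by (rule poly_T_nonzero[OF ab(3,4)])
  have xy: "x = poly s T + y" using nz by (simp add: ab(1) sr(3) y_def add_divide_distrib)
  have "integral_over S y" unfolding integral_over_iff_valuation_rings[OF S]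
  proof (intro allI impI, elim conjE)
    fix V assume V: "valuation_ring V" "S \<subseteq> V"
    have "x \<in> V" using int V integral_over_iff_valuation_rings[OF S] by (auto simp: S_def)
    moreover have "poly s T \<in> V" using mem[OF sr(1)] V by auto
    ultimately have "x - poly s T \<in> V" by (rule closed_subringD(3)[OF valuation_ringD[OF V(1)]])
    then show "y \<in> V" by (simp add: xy)
  qed
  then obtain p where p: "p \<in> polys_over S" "lead_coeff p = 1" "poly p y = 0"
    by (auto simp: integral_over_def)
  define n where "n = degree p"
  have eq: "y ^ n = - (\<Sum>i<n. coeff p i * y ^ i)"
    using monic_poly_split[OF p(2), of y] p(3) by (simp add: n_def eq_neg_iff_add_eq_0)
  have bounded: "poly b T ^ n * y ^ j \<in> S" for j
  proof (induction j rule: less_induct)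
    case (less j)
    show ?case
    proof (cases "j < n")
      case True
      define l where "l = n - j"
      have nl: "n = l + j" using True by (simp add: l_def)
      have "poly b T ^ n * y ^ j = poly b T ^ l * poly r T ^ j"
        unfolding nl power_add using nz by (simp add: y_def power_divide)
      then show ?thesis using mem[OF ab(3)] mem[OF sr(2)]
        by (simp add: closed_subringD(6)[OF S] closed_subring_power[OF S])
    next
      case False
      then have j: "y ^ j = y ^ (j - n) * y ^ n" by (simp add: power_add[symmetric])
      have "poly b T ^ n * y ^ j = - (\<Sum>i<n. coeff p i * (poly b T ^ n * y ^ (i + (j - n))))"
        unfolding j eq by (simp add: sum_distrib_left power_add mult_ac)
      also have "\<dots> \<in> S"
      proof (intro closed_subringD(4)[OF S] closed_subring_sum[OF S])
        fix i assume "i \<in> {..<n}"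
        then have "i + (j - n) < j" using False by auto
        then show "coeff p i * (poly b T ^ n * y ^ (i + (j - n))) \<in> S"
          using p(1) by (intro closed_subringD(6)[OF S _ less]) (simp add: polys_over_def)
      qed
      finally show ?thesis .
    qed
  qed
  have "r = 0"
  proof (rule ccontr)
    assume r: "r \<noteq> 0"
    define j where "j = n * degree b + 1"
    obtain w where w: "w \<in> polys_over k" "poly b T ^ n * y ^ j = poly w T"
      using bounded[of j] by (auto simp: S_def adjoin_def)
    have "poly (b ^ n * r ^ j) T = poly (w * b ^ j) T"
      using w(2) nz by (simp add: y_def power_divide field_simps)
    then have eqp: "b ^ n * r ^ j = w * b ^ j"
      by (intro eval_inj polys_closed(6) closed_subring_power[OF closed_subring_polys_over[OF kR]] ab sr w)
    have "w \<noteq> 0" using eqp r ab(4) by auto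
    then have "n * degree b + j * degree r = degree w + j * degree b"
      using arg_cong[OF eqp, of degree] r ab(4) by (simp add: degree_mult_eq degree_power_eq)
    moreover have "j * (degree r + 1) \<le> j * degree b" using sr(4) r by (intro mult_le_mono2) auto
    ultimately show False by (simp add: j_def)
  qed
  then have "x = poly s T" using xy by (simp add: y_def)
  then show ?thesis using mem[OF sr(1)] by (simp add: S_def)
qed

lemma finite_bounded_functions:
  assumes e: "e \<in> adjoin k T" "e \<noteq> 0" and e': "e' \<in> regular_at_infinity k T" "e' \<noteq> 0"
  shows "finite {x\<in>rational_functions k T. e * x \<in> adjoin k T \<and> e' * x \<in> regular_at_infinity k T}"
proof -
  obtain E where E: "E \<in> polys_over k" "e = poly E T" using e by (auto simp: adjoin_def)
  obtain p s where ps: "e' = poly p T / poly s T" "p \<in> polys_over k" "s \<in> polys_over k" "s \<noteq> 0"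
    using e' by (auto simp: regular_at_infinity_def)
  have nz: "E \<noteq> 0" "p \<noteq> 0" using e e' E ps by auto
  define N where "N = degree E + degree s"
  define Q where "Q = {a. degree a \<le> N \<and> (\<forall>i. coeff a i \<in> k)}"
  have "x \<in> (\<lambda>a. poly a T / e) ` Q"
    if x: "e * x \<in> adjoin k T" "e' * x \<in> regular_at_infinity k T" for x
  proof -
    obtain a where a: "a \<in> polys_over k" "e * x = poly a T" using x by (auto simp: adjoin_def)
    obtain b c where bc: "e' * x = poly b T / poly c T" "b \<in> polys_over k" "c \<in> polys_over k" "c \<noteq> 0" "degree b \<le> degree c"
      using x by (auto simp: regular_at_infinity_def)
    note nz' = poly_T_nonzero[OF ps(3,4)] poly_T_nonzero[OF bc(3,4)]
    have "e' * poly a T = e * (e' * x)" unfolding a(2)[symmetric] by (simp add: ac_simps)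
    then have "poly p T / poly s T * poly a T = poly E T * (poly b T / poly c T)"
      unfolding bc(1) by (simp only: ps(1) E(2))
    then have "poly (p * a * c) T = poly (E * b * s) T" using nz' by (simp add: field_simps)
    then have eq: "p * a * c = E * b * s" by (intro eval_inj polys_closed(6) ps a bc E)
    have "degree a \<le> N"
    proof (cases "a = 0")
      case False
      then have "b \<noteq> 0" using eq nz bc by auto
      then have "degree p + degree a + degree c = degree E + degree b + degree s"
        using arg_cong[OF eq, of degree] False nz ps(4) bc(4) by (simp add: degree_mult_eq)
      then show ?thesis using bc(5) by (simp add: N_def)
    qed simp
    then have "a \<in> Q" using a by (simp add: Q_def polys_over_def)
    moreover have "x = poly a T / e" using a(2) e(2) by (simp add: field_simps)
    ultimately show ?thesis by blast
  qed
  then show ?thesis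
    by (intro finite_subset[OF _ finite_imageI[OF finite_polys_bounded[OF fin_k, of N], of "\<lambda>a. poly a T / e"]])
       (auto simp: Q_def)
qed

end

lemma northcott_field_rational_functions:
  fixes k :: "'a::alg_closed_field set"
  assumes "transcendental_element k T"
  shows "northcott_field (rational_functions k T) (adjoin k T) (regular_at_infinity k T)"
proof -
  interpret transcendental_element k T by fact
  show ?thesis
  proof
    show "closed_subfield (rational_functions k T)" by (rule rational_functions_subfield)
    show "closed_subring (adjoin k T)" by (rule adjoin_subring(1)[OF kR])
    show "adjoin k T \<subseteq> rational_functions k T" by (rule kT_subset)
    show "closed_subring (regular_at_infinity k T)" by (rule regular_at_infinity_subring)
    show "regular_at_infinity k T \<subseteq> rational_functions k T" by (rule regular_subset)
    show "\<exists>b\<in>adjoin k T. b \<noteq> 0 \<and> b * x \<in> adjoin k T" if x: "x \<in> rational_functions k T" for x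
    proof -
      obtain a b where ab: "x = poly a T / poly b T" "a \<in> polys_over k" "b \<in> polys_over k" "b \<noteq> 0"
        using x by (auto simp: rational_functions_def)
      then show ?thesis using poly_T_nonzero[OF ab(3,4)]
        by (intro bexI[of _ "poly b T"]) (auto simp: adjoin_def)
    qed
    show "\<exists>b\<in>regular_at_infinity k T. b \<noteq> 0 \<and> b * x \<in> regular_at_infinity k T"
      if x: "x \<in> rational_functions k T" for x
    proof (cases "x \<in> regular_at_infinity k T")
      case True
      then show ?thesis using closed_subringD(1)[OF regular_at_infinity_subring]
        by (intro bexI[of _ 1]) auto
    next
      case False
      then have "inverse x \<in> regular_at_infinity k T" "x \<noteq> 0"
        using regular_or_inverse[OF x] closed_subringD(2)[OF regular_at_infinity_subring] by auto
      then show ?thesis using closed_subringD(1)[OF regular_at_infinity_subring]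
        by (intro bexI[of _ "inverse x"]) auto
    qed
    show "x \<in> adjoin k T" if "x \<in> rational_functions k T" "integral_over (adjoin k T) x" for x
      using that by (rule kT_normal)
    show "x \<in> regular_at_infinity k T"
      if "x \<in> rational_functions k T" "integral_over (regular_at_infinity k T) x" for x
      using regular_or_inverse[OF that(1)]
        integral_in_subring_if_inverse_mem[OF regular_at_infinity_subring _ that(2)] by blast
    show "finite {x\<in>rational_functions k T. e * x \<in> adjoin k T \<and> e' * x \<in> regular_at_infinity k T}"
      if "e \<in> adjoin k T" "e \<noteq> 0" "e' \<in> regular_at_infinity k T" "e' \<noteq> 0" for e e'
      using that by (rule finite_bounded_functions)
  qed
qed

section \<open>Finite extensions\<close>

definition span_over :: "'a::field set \<Rightarrow> 'a set \<Rightarrow> 'a set" where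
  "span_over F B = {\<Sum>b\<in>B. f b * b | f. \<forall>b\<in>B. f b \<in> F}"

lemma span_over_closed:
  assumes F: "closed_subring F" and B: "finite B"
  shows "x \<in> span_over F B \<Longrightarrow> y \<in> span_over F B \<Longrightarrow> x + y \<in> span_over F B"
    "a \<in> F \<Longrightarrow> x \<in> span_over F B \<Longrightarrow> a * x \<in> span_over F B"
    "b \<in> B \<Longrightarrow> b \<in> span_over F B" "0 \<in> span_over F B"
proof -
  show "0 \<in> span_over F B" unfolding span_over_def
    using F by (intro CollectI exI[of _ "\<lambda>b. 0"]) (auto simp: closed_subringD)
  assume b: "b \<in> B"
  have "b = (\<Sum>c\<in>B. if c = b then c else 0)" using B b by simp
  also have "\<dots> = (\<Sum>c\<in>B. (if c = b then 1 else 0) * c)" by (rule sum.cong) auto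
  finally have "b = (\<Sum>c\<in>B. (if c = b then 1 else 0) * c)" .
  then show "b \<in> span_over F B" unfolding span_over_def
    using F by (intro CollectI exI[of _ "\<lambda>c. if c = b then 1 else 0"]) (auto simp: closed_subringD)
next
  assume x: "x \<in> span_over F B"
  then obtain f where f: "x = (\<Sum>b\<in>B. f b * b)" "\<forall>b\<in>B. f b \<in> F" by (auto simp: span_over_def)
  show "a * x \<in> span_over F B" if "a \<in> F" unfolding span_over_def
    using f F that by (intro CollectI exI[of _ "\<lambda>b. a * f b"]) (auto simp: sum_distrib_left mult.assoc closed_subringD)
  assume "y \<in> span_over F B"
  then obtain g where g: "y = (\<Sum>b\<in>B. g b * b)" "\<forall>b\<in>B. g b \<in> F" by (auto simp: span_over_def)
  show "x + y \<in> span_over F B" unfolding span_over_def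
    using f g F by (intro CollectI exI[of _ "\<lambda>b. f b + g b"]) (auto simp: sum.distrib distrib_right closed_subringD)
qed

lemma span_over_subset:
  assumes F: "closed_subring F" and B: "finite B" and sub: "B \<subseteq> W"
    and add: "\<And>x y. x \<in> W \<Longrightarrow> y \<in> W \<Longrightarrow> x + y \<in> W" and mult: "\<And>a x. a \<in> F \<Longrightarrow> x \<in> W \<Longrightarrow> a * x \<in> W" and 0: "0 \<in> W"
  shows "span_over F B \<subseteq> W"
proof
  fix x assume "x \<in> span_over F B"
  then obtain f where f: "x = (\<Sum>b\<in>B. f b * b)" "\<forall>b\<in>B. f b \<in> F" by (auto simp: span_over_def)
  have "(\<Sum>b\<in>C. f b * b) \<in> W" if "C \<subseteq> B" for C
    using finite_subset[OF that B] that
    by (induction C rule: finite_induct) (use f(2) sub add mult 0 in auto)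
  then show "x \<in> W" using f(1) by simp
qed

text \<open>Gaussian elimination of one generator at the price of one vector.\<close>
lemma linear_dependence:
  assumes F: "closed_subfield F" and "finite B" "finite I" "card B < card I"
    and "\<And>i. i \<in> I \<Longrightarrow> v i \<in> span_over F B"
  shows "\<exists>h. (\<forall>i\<in>I. h i \<in> F) \<and> (\<exists>i\<in>I. h i \<noteq> 0) \<and> (\<Sum>i\<in>I. h i * v i) = 0"
  using assms(2-)
proof (induction B arbitrary: I v rule: finite_induct)
  case empty
  have "I \<noteq> {}" using empty by auto
  moreover have "v i = 0" if "i \<in> I" for i using empty.prems(3)[OF that] by (simp add: span_over_def)
  ultimately show ?case using F
    by (intro exI[of _ "\<lambda>i. 1"]) (auto simp: closed_subfield_def closed_subringD)
next
  case (insert b B)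
  have R: "closed_subring F" and inv: "\<And>x. x \<in> F \<Longrightarrow> inverse x \<in> F"
    using F by (auto simp: closed_subfield_def)
  have "\<forall>i\<in>I. \<exists>f w. f \<in> F \<and> w \<in> span_over F B \<and> v i = f * b + w"
  proof
    fix i assume "i \<in> I"
    then obtain f where f: "v i = (\<Sum>c\<in>insert b B. f c * c)" "\<forall>c\<in>insert b B. f c \<in> F"
      using insert.prems(3) by (auto simp: span_over_def)
    then show "\<exists>f w. f \<in> F \<and> w \<in> span_over F B \<and> v i = f * b + w"
      using insert.hyps by (intro exI[of _ "f b"] exI[of _ "\<Sum>c\<in>B. f c * c"]) (auto simp: span_over_def)
  qed
  then obtain f w where fw: "\<And>i. i \<in> I \<Longrightarrow> f i \<in> F" "\<And>i. i \<in> I \<Longrightarrow> w i \<in> span_over F B"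
    "\<And>i. i \<in> I \<Longrightarrow> v i = f i * b + w i" by metis
  show ?case
  proof (cases "\<exists>i0\<in>I. f i0 \<noteq> 0")
    case False
    then have "v i \<in> span_over F B" if "i \<in> I" for i using fw(2,3)[OF that] that by auto
    then show ?thesis using insert by (intro insert.IH) auto
  next
    case True
    then obtain i0 where i0: "i0 \<in> I" "f i0 \<noteq> 0" by auto
    define J where "J = I - {i0}"
    define t where "t i = f i * inverse (f i0)" for i
    have t: "t i \<in> F" if "i \<in> I" for i unfolding t_def using fw(1) i0 that by (intro closed_subringD(6)[OF R] inv)
    have vJ: "v i - t i * v i0 \<in> span_over F B" if i: "i \<in> I" for i
    proof -
      have "v i - t i * v i0 = w i + (- t i) * w i0"
        using fw(3)[OF i] fw(3)[OF i0(1)] i0(2) by (simp add: t_def field_simps)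
      moreover have "(- t i) * w i0 \<in> span_over F B"
        by (rule span_over_closed(2)[OF R insert.hyps(1) closed_subringD(4)[OF R t[OF i]] fw(2)[OF i0(1)]])
      ultimately show ?thesis using span_over_closed(1)[OF R insert.hyps(1) fw(2)[OF i]] by metis
    qed
    have "card B < card J" using insert i0 by (simp add: J_def)
    then obtain h where h: "\<forall>i\<in>J. h i \<in> F" "\<exists>i\<in>J. h i \<noteq> 0" "(\<Sum>i\<in>J. h i * (v i - t i * v i0)) = 0"
      using insert.IH[of J "\<lambda>i. v i - t i * v i0"] insert.prems(1) vJ by (auto simp: J_def)
    define h' where "h' i = (if i = i0 then - (\<Sum>i\<in>J. h i * t i) else h i)" for i
    have "(\<Sum>i\<in>I. h' i * v i) = h' i0 * v i0 + (\<Sum>i\<in>J. h' i * v i)"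
      unfolding J_def using insert.prems(1) i0 by (intro sum.remove)
    also have "(\<Sum>i\<in>J. h' i * v i) = (\<Sum>i\<in>J. h i * v i)"
      by (rule sum.cong) (auto simp: h'_def J_def)
    also have "h' i0 * v i0 + (\<Sum>i\<in>J. h i * v i) = (\<Sum>i\<in>J. h i * (v i - t i * v i0))"
      by (simp add: h'_def right_diff_distrib sum_subtractf sum_distrib_right mult.assoc)
    finally have "(\<Sum>i\<in>I. h' i * v i) = 0" using h(3) by simp
    moreover have "\<forall>i\<in>I. h' i \<in> F" using h(1) t R
      by (auto simp: h'_def J_def intro!: closed_subringD(4,6)[OF R] closed_subring_sum[OF R])
    moreover have "\<exists>i\<in>I. h' i \<noteq> 0" using h(2) by (auto simp: h'_def J_def)
    ultimately show ?thesis by blast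
  qed
qed

lemma algebraic_of_degree_card:
  assumes F: "closed_subfield F" and B: "finite B" and x: "\<And>i. x ^ i \<in> span_over F B"
  shows "algebraic_of_degree F (card B) x"
proof -
  obtain h where h: "\<forall>i\<in>{..card B}. h i \<in> F" "\<exists>i\<in>{..card B}. h i \<noteq> 0" "(\<Sum>i\<in>{..card B}. h i * x ^ i) = 0"
    using linear_dependence[OF F B, of "{..card B}" "\<lambda>i. x ^ i"] x by auto
  define p where "p = (\<Sum>i\<le>card B. monom (h i) i)"
  have c: "coeff p i = (if i \<le> card B then h i else 0)" for i
    by (auto simp: p_def coeff_sum if_distrib cong: if_cong)
  have "p \<noteq> 0" using h(2) c by (metis atMost_iff coeff_0)
  moreover have "p \<in> polys_over F" using h(1) F by (auto simp: polys_over_def c closed_subfield_def closed_subringD)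
  moreover have "degree p \<le> card B" by (rule degree_le) (simp add: c)
  moreover have "poly p x = 0" using h(3) by (simp add: p_def poly_sum poly_monom)
  ultimately show ?thesis unfolding algebraic_of_degree_def by blast
qed

section \<open>The ring of regular functions\<close>

lemma field_L_simps [simp]:
  "carrier field_L = UNIV" "x \<otimes>\<^bsub>field_L\<^esub> y = x * y" "x \<oplus>\<^bsub>field_L\<^esub> y = x + y"
  "\<one>\<^bsub>field_L\<^esub> = 1" "\<zero>\<^bsub>field_L\<^esub> = 0"
  by (simp_all add: ring_of_type_algebra_def)

lemma closed_subring_of_subring:
  fixes H :: "'l::field set"
  assumes H: "subring H field_L"
  shows "closed_subring H"
proof -
  interpret L: field "field_L :: 'l ring" by (rule field_from_type_algebra)
  have m: "\<ominus>\<^bsub>field_L\<^esub> x = - x" for x :: 'l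
    using L.minus_equality[of "- x" x] by simp
  have neg: "- x \<in> H" if "x \<in> H" for x using subringE(5)[OF H that] m by simp
  have "x - y \<in> H" if "x \<in> H" "y \<in> H" for x y
    using subringE(7)[OF H that(1) neg[OF that(2)]] by simp
  then show ?thesis using subringE(3,6)[OF H] by (auto simp: closed_subring_def)
qed

lemma closed_subfield_of_subfield:
  fixes H :: "'l::field set"
  assumes H: "subfield H field_L"
  shows "closed_subfield H"
proof -
  interpret L: field "field_L :: 'l ring" by (rule field_from_type_algebra)
  have R: "closed_subring H" by (rule closed_subring_of_subring[OF subfieldE(1)[OF H]])
  have "inverse x \<in> H" if x: "x \<in> H" for x
  proof (cases "x = 0")
    case True then show ?thesis using R by (simp add: closed_subringD)
  next
    case False
    then have "x \<in> H - {\<zero>\<^bsub>field_L\<^esub>}" using x by simp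
    from L.subfield_m_inv(1,2)[OF H this] show ?thesis by (auto dest!: inverse_unique)
  qed
  then show ?thesis using R by (auto simp: closed_subfield_def)
qed

text \<open>A maximal ideal is prime, so its complement is closed under products.\<close>
lemma closed_subring_localization:
  fixes R :: "'l::field set"
  assumes R: "subring R field_L" and m: "maximalideal \<mm> (ring_on R)"
  shows "closed_subring (localization R \<mm>)" "R \<subseteq> localization R \<mm>"
proof -
  interpret L: field "field_L :: 'l ring" by (rule field_from_type_algebra)
  have cR: "closed_subring R" by (rule closed_subring_of_subring[OF R])
  interpret cring "ring_on R"
    using L.subcring_iff[of R] L.subcringI'[OF R] by simp
  interpret primeideal \<mm> "ring_on R" by (rule maximalideal_prime[OF m])
  have sub: "\<mm> \<subseteq> R" using a_subset by simp
  have prime: "a \<in> \<mm> \<or> b \<in> \<mm>" if "a \<in> R" "b \<in> R" "a * b \<in> \<mm>" for a b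
    using I_prime[of a b] that by simp
  have one: "1 \<notin> \<mm>"
  proof
    assume "1 \<in> \<mm>"
    then have "\<one>\<^bsub>ring_on R\<^esub> \<in> \<mm>" by simp
    from one_imp_carrier[OF this] I_notcarr show False by simp
  qed
  have zero: "0 \<in> \<mm>" using additive_subgroup.zero_closed[OF additive_subgroup_axioms] by simp
  have mult: "s * t \<in> R - \<mm>" if "s \<in> R - \<mm>" "t \<in> R - \<mm>" for s t
    using that prime[of s t] closed_subringD(6)[OF cR, of s t] by auto
  have nz: "s \<noteq> 0" if "s \<in> R - \<mm>" for s using that zero by auto
  show RL: "R \<subseteq> localization R \<mm>"
  proof
    fix a assume "a \<in> R"
    moreover have "a = a / 1" by simp
    ultimately show "a \<in> localization R \<mm>"
      using one closed_subringD(1)[OF cR] unfolding localization_def by blast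
  qed
  show "closed_subring (localization R \<mm>)"
    unfolding closed_subring_def
  proof (intro conjI ballI)
    show "1 \<in> localization R \<mm>" using RL closed_subringD(1)[OF cR] by auto
    fix x y assume "x \<in> localization R \<mm>" "y \<in> localization R \<mm>"
    then obtain a s b t where x: "x = a / s" "a \<in> R" "s \<in> R - \<mm>" and y: "y = b / t" "b \<in> R" "t \<in> R - \<mm>"
      unfolding localization_def by blast
    have st: "s * t \<in> R - \<mm>" using mult x y by blast
    have "x - y = (a * t - b * s) / (s * t)" using nz[OF x(3)] nz[OF y(3)] by (simp add: x y field_simps)
    moreover have "a * t - b * s \<in> R" using x y cR by (auto intro!: closed_subringD(3,6)[OF cR])
    ultimately show "x - y \<in> localization R \<mm>" using st unfolding localization_def by blast
    have "x * y = (a * b) / (s * t)" by (simp add: x y)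
    moreover have "a * b \<in> R" using x y by (intro closed_subringD(6)[OF cR])
    ultimately show "x * y \<in> localization R \<mm>" using st unfolding localization_def by blast
  qed
qed

lemma regular_functions_ring:
  fixes k :: "'l::field set" and n t Pinf
  defines "A \<equiv> regular_functions_away_from k n t Pinf"
  shows "closed_subring A" "k \<subseteq> A"
proof -
  interpret L: field "field_L :: 'l ring" by (rule field_from_type_algebra)
  have F: "closed_subring (function_field k n t)"
    unfolding function_field_def
    by (rule closed_subring_of_subring[OF subfieldE(1)[OF L.generate_field_is_subfield]]) simp
  have kF: "k \<subseteq> function_field k n t"
    unfolding function_field_def by (auto intro: generate_field.incl)
  have P: "closed_subring P \<and> k \<subseteq> P" if P: "P \<in> closed_points k n t" for P
  proof -
    obtain i \<mm> where i: "P = localization (affine_chart k n t i) \<mm>"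
      "maximalideal \<mm> (ring_on (affine_chart k n t i))"
      using P by (auto simp: closed_points_def)
    have ch: "subring (affine_chart k n t i) field_L"
      unfolding affine_chart_def by (rule L.generate_ring_is_subring) simp
    have "k \<subseteq> affine_chart k n t i"
      unfolding affine_chart_def by (auto intro: generate_ring.incl)
    then show ?thesis using closed_subring_localization[OF ch i(2)] i(1) by auto
  qed
  show "closed_subring A" unfolding closed_subring_def A_def regular_functions_away_from_def
    using F P by (auto simp: closed_subringD(1,3,6))
  show "k \<subseteq> A" unfolding A_def regular_functions_away_from_def using kF P by blast
qed

section \<open>Twists and isomorphism classes\<close>

lemma poly_map_to_ac: "poly (map_poly to_ac p) (to_ac x) = to_ac (poly p x)"
  by (induction p) (simp_all add: map_poly_pCons)

lemma poly_map_to_ac_pcompose: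
  "poly (map_poly to_ac (pcompose p r)) x = poly (map_poly to_ac p) (poly (map_poly to_ac r) x)"
proof -
  have add: "map_poly to_ac (f + g) = map_poly to_ac f + map_poly to_ac g" for f g :: "'a poly"
    by (rule poly_eqI) (simp add: coeff_map_poly)
  have mult: "map_poly to_ac (f * g) = map_poly to_ac f * map_poly to_ac g" for f g :: "'a poly"
    by (rule poly_eqI) (simp add: coeff_map_poly coeff_mult to_ac_sum)
  show ?thesis
    by (induction p) (simp_all add: pcompose_pCons map_poly_pCons add mult)
qed

lemma degree_map_to_ac [simp]: "degree (map_poly to_ac p) = degree p"
  by (rule degree_map_poly) simp

lemma algebraic_of_degree_to_ac:
  assumes "algebraic_of_degree F n x" "to_ac ` F \<subseteq> G"
  shows "algebraic_of_degree G n (to_ac x)"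
proof -
  obtain p where p: "p \<in> polys_over F" "p \<noteq> 0" "degree p \<le> n" "poly p x = 0"
    using assms(1) by (auto simp: algebraic_of_degree_def)
  have "map_poly to_ac p \<noteq> 0"
    using p(2) by (metis coeff_map_poly leading_coeff_0_iff to_ac_0 to_ac_eq_0_iff coeff_0)
  moreover have "map_poly to_ac p \<in> polys_over G"
    using p(1) assms(2) by (auto simp: polys_over_def coeff_map_poly)
  ultimately show ?thesis unfolding algebraic_of_degree_def using p
    by (intro bexI[of _ "map_poly to_ac p"]) (simp_all add: poly_map_to_ac)
qed

text \<open>Substitute \<open>X^m\<close> in an equation for \<open>u^m\<close>.\<close>
lemma algebraic_of_degree_root:
  fixes F :: "'a::field set"
  assumes F: "closed_subring F" and m: "m \<ge> 1" and w: "algebraic_of_degree F n (u ^ m)"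
  shows "algebraic_of_degree F (n * m) u"
proof -
  obtain p where p: "p \<in> polys_over F" "p \<noteq> 0" "degree p \<le> n" "poly p (u ^ m) = 0"
    using w by (auto simp: algebraic_of_degree_def)
  have pc: "pcompose p' (monom 1 m) \<in> polys_over F" if "p' \<in> polys_over F" for p'
    using that
  proof (induction p')
    case 0 then show ?case by (simp add: polys_over_closed[OF F])
  next
    case (pCons a p')
    have "a \<in> F" "p' \<in> polys_over F"
      using pCons.prems by (auto simp: polys_over_def coeff_pCons split: nat.splits)
    then show ?case unfolding pcompose_pCons
      using pCons.IH F by (intro polys_over_closed monom_in_polys_over pCons_in_polys_over)
        (auto simp: closed_subringD polys_over_closed)
  qed
  have "degree (pcompose p (monom 1 m)) = degree p * m"
    by (simp add: degree_pcompose degree_monom_eq)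
  moreover have "pcompose p (monom 1 m) \<noteq> 0"
    using p(2) m by (simp add: pcompose_eq_0_iff degree_monom_eq)
  moreover have "poly (pcompose p (monom 1 m)) u = 0" using p(4) by (simp add: poly_pcompose poly_monom)
  ultimately show ?thesis unfolding algebraic_of_degree_def using p(3) pc[OF p(1)]
    by (intro bexI[of _ "pcompose p (monom 1 m)"]) auto
qed

lemma finite_image_factor:
  assumes "finite (f ` Y)" and "\<And>x y. x \<in> Y \<Longrightarrow> y \<in> Y \<Longrightarrow> f x = f y \<Longrightarrow> g x = g y"
  shows "finite (g ` Y)"
proof -
  have "g ` Y \<subseteq> (\<lambda>z. g (SOME x. x \<in> Y \<and> f x = z)) ` (f ` Y)"
  proof
    fix v assume "v \<in> g ` Y"
    then obtain x where x: "x \<in> Y" "v = g x" by auto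
    define x' where "x' = (SOME x'. x' \<in> Y \<and> f x' = f x)"
    have "x' \<in> Y \<and> f x' = f x" unfolding x'_def by (rule someI[of _ x]) (use x in simp)
    then have "v = g x'" using assms(2) x by metis
    then show "v \<in> (\<lambda>z. g (SOME x. x \<in> Y \<and> f x = z)) ` (f ` Y)" using x by (auto simp: x'_def)
  qed
  then show ?thesis by (rule finite_subset[OF _ finite_imageI[OF assms(1)]])
qed

lemma finite_image_fibres:
  assumes "finite (f ` Y)" and "\<And>y. y \<in> Y \<Longrightarrow> finite (g ` {x\<in>Y. f x = f y})"
  shows "finite (g ` Y)"
proof -
  have "g ` Y = (\<Union>z\<in>f ` Y. g ` {x\<in>Y. f x = z})" by auto
  moreover have "finite (g ` {x\<in>Y. f x = z})" if "z \<in> f ` Y" for z using that assms(2) by auto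
  ultimately show ?thesis using assms(1) by (metis (no_types, lifting) finite_UN_I)
qed

context constant_field
begin

definition normalise :: "'l \<Rightarrow> ('l \<Rightarrow> 'l poly) \<Rightarrow> 'l \<Rightarrow> 'l poly" where
  "normalise \<alpha> \<phi> a = smult (inverse \<alpha>) (pcompose (\<phi> a) [:0, \<alpha>:])"

lemma normalise_iso:
  assumes D: "drinfeld_module k A 1 \<phi>" and \<alpha>: "\<alpha> \<noteq> 0"
  shows "(\<phi>, normalise \<alpha> \<phi>) \<in> drinfeld_iso k A 1"
proof -
  have c: "coeff (normalise \<alpha> \<phi> a) i = inverse \<alpha> * \<alpha> ^ i * coeff (\<phi> a) i" for a i
    by (simp add: normalise_def coeff_pcompose_linear)
  have deg: "degree (normalise \<alpha> \<phi> a) = degree (\<phi> a)" for a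
    using \<alpha> by (simp add: normalise_def degree_pcompose)
  have lin: "pcompose [:0, \<alpha>:] p = smult \<alpha> p" for p by (simp add: pcompose_pCons)
  have mult: "normalise \<alpha> \<phi> (a * b) = pcompose (normalise \<alpha> \<phi> a) (normalise \<alpha> \<phi> b)"
    if "\<phi> (a * b) = pcompose (\<phi> a) (\<phi> b)" for a b
  proof -
    have "pcompose (pcompose (\<phi> a) [:0, \<alpha>:]) (normalise \<alpha> \<phi> b) = pcompose (\<phi> a) (pcompose (\<phi> b) [:0, \<alpha>:])"
      using \<alpha> by (simp add: pcompose_assoc[symmetric] lin normalise_def)
    then show ?thesis by (simp add: normalise_def that pcompose_smult pcompose_assoc)
  qed
  have "drinfeld_module k A 1 (normalise \<alpha> \<phi>)"
    unfolding drinfeld_module_def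
  proof (intro conjI ballI impI)
    fix a assume a: "a \<in> A"
    show "normalise \<alpha> \<phi> a \<in> linear_polys (card k)"
      using D a by (auto simp: linear_polys_def c drinfeld_module_def)
    { fix b assume b: "b \<in> A"
      show "normalise \<alpha> \<phi> (a + b) = normalise \<alpha> \<phi> a + normalise \<alpha> \<phi> b"
        using D a b by (simp add: drinfeld_module_def normalise_def pcompose_add smult_add_right)
      show "normalise \<alpha> \<phi> (a * b) = pcompose (normalise \<alpha> \<phi> a) (normalise \<alpha> \<phi> b)"
        using D a b by (intro mult) (simp add: drinfeld_module_def) }
    assume a0: "a \<noteq> 0"
    show "coeff (normalise \<alpha> \<phi> a) 1 = a" using D a a0 \<alpha> by (simp add: c drinfeld_module_def)
    show "degree (normalise \<alpha> \<phi> a) = card (carrier (ring_on A Quot (PIdl\<^bsub>ring_on A\<^esub> a))) ^ 1"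
      using D a a0 unfolding deg by (simp add: drinfeld_module_def)
  next
    fix c assume "c \<in> k"
    then show "normalise \<alpha> \<phi> c = [:0, c:]"
      using D \<alpha> by (simp add: drinfeld_module_def normalise_def pcompose_pCons)
  qed simp
  then show ?thesis using D \<alpha>
    by (auto simp: drinfeld_iso_def normalise_def intro!: exI[of _ \<alpha>])
qed

definition one_torsion :: "('l \<Rightarrow> 'l poly) set" where
  "one_torsion = {\<phi>. drinfeld_module k A 1 \<phi> \<and> 1 \<in> torsion A \<phi>}"

text \<open>Dividing by a torsion point turns it into \<open>1\<close>, so modules with torsion point \<open>1\<close> represent all
  classes. Modules that agree on \<open>A\<close> are isomorphic by \<open>u = 1\<close>.\<close>
lemma finite_classes:
  assumes fin: "finite ((\<lambda>\<phi>. restrict \<phi> A) ` one_torsion)"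
  shows "finite ({\<phi>. drinfeld_module k A 1 \<phi> \<and> torsion A \<phi> \<noteq> {0}} // drinfeld_iso k A 1)"
proof -
  define cl where "cl \<phi> = drinfeld_iso k A 1 `` {\<phi>}" for \<phi>
  note eq = equiv_drinfeld_iso[of k A 1]
  have "finite (cl ` one_torsion)"
  proof (rule finite_image_factor[OF fin])
    fix \<phi> \<psi> assume *: "\<phi> \<in> one_torsion" "\<psi> \<in> one_torsion" "restrict \<phi> A = restrict \<psi> A"
    then have "\<phi> a = \<psi> a" if "a \<in> A" for a using that by (metis restrict_apply')
    then have "(\<phi>, \<psi>) \<in> drinfeld_iso k A 1"
      using * by (auto simp: drinfeld_iso_def one_torsion_def intro!: exI[of _ 1])
    then show "cl \<phi> = cl \<psi>" unfolding cl_def by (rule equiv_class_eq[OF eq])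
  qed
  moreover have "{\<phi>. drinfeld_module k A 1 \<phi> \<and> torsion A \<phi> \<noteq> {0}} // drinfeld_iso k A 1 \<subseteq> cl ` one_torsion"
  proof
    fix C assume "C \<in> {\<phi>. drinfeld_module k A 1 \<phi> \<and> torsion A \<phi> \<noteq> {0}} // drinfeld_iso k A 1"
    then obtain \<phi> where \<phi>: "drinfeld_module k A 1 \<phi>" "torsion A \<phi> \<noteq> {0}" "C = cl \<phi>"
      by (auto simp: quotient_def cl_def)
    have "0 \<in> torsion A \<phi>"
    proof -
      have "poly (\<phi> 1) 0 = 0"
        using drinfeld_linear[OF \<phi>(1) closed_subringD(1)[OF A]] q_ge_2
        by (auto simp: linear_polys_def poly_0_coeff_0)
      then show ?thesis using closed_subringD(1)[OF A] by (auto simp: torsion_def intro!: bexI[of _ 1])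
    qed
    then obtain \<alpha> where "\<alpha> \<in> torsion A \<phi>" and \<alpha>: "\<alpha> \<noteq> 0" using \<phi>(2) by blast
    then obtain a where a: "a \<in> A" "a \<noteq> 0" "poly (\<phi> a) \<alpha> = 0" by (auto simp: torsion_def)
    have iso: "(\<phi>, normalise \<alpha> \<phi>) \<in> drinfeld_iso k A 1" by (rule normalise_iso[OF \<phi>(1) \<alpha>])
    have "poly (normalise \<alpha> \<phi> a) 1 = 0" using a by (simp add: normalise_def poly_pcompose)
    then have "normalise \<alpha> \<phi> \<in> one_torsion"
      using iso a by (auto simp: one_torsion_def drinfeld_iso_def torsion_def)
    moreover have "C = cl (normalise \<alpha> \<phi>)" unfolding \<phi>(3) cl_def by (rule equiv_class_eq[OF eq iso])
    ultimately show "C \<in> cl ` one_torsion" by blast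
  qed
  ultimately show ?thesis by (auto intro: finite_subset)
qed

lemma drinfeld_eqI:
  assumes "drinfeld_module k A 1 \<phi>" "drinfeld_module k A 1 \<psi>" "a \<in> A" "\<And>i. tc \<phi> a i = tc \<psi> a i"
  shows "\<phi> a = \<psi> a"
proof -
  define N where "N = max (degree (\<phi> a)) (degree (\<psi> a))"
  have "\<phi> a = (\<Sum>i\<le>N. monom (coeff (\<phi> a) (q ^ i)) (q ^ i))"
    by (rule linear_poly_expansion[OF drinfeld_linear[OF assms(1,3)] q_ge_2]) (simp add: N_def)
  also have "\<dots> = (\<Sum>i\<le>N. monom (coeff (\<psi> a) (q ^ i)) (q ^ i))"
    using assms(4) by (simp add: tc_def)
  also have "\<dots> = \<psi> a"
    by (rule linear_poly_expansion[OF drinfeld_linear[OF assms(2,3)] q_ge_2, symmetric]) (simp add: N_def)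
  finally show ?thesis .
qed

lemma finite_one_torsion_if_units:
  assumes units: "\<And>a. a \<in> A \<Longrightarrow> a \<noteq> 0 \<Longrightarrow> deg a = 0"
  shows "finite ((\<lambda>\<phi>. restrict \<phi> A) ` one_torsion)"
proof -
  have "restrict \<phi> A = restrict (\<lambda>a. [:0, a:]) A" if D: "drinfeld_module k A 1 \<phi>" for \<phi>
  proof (rule restrict_ext)
    fix a assume a: "a \<in> A"
    have t0: "tc \<phi> a 0 = a" by (rule drinfeld_tc_0[OF D a])
    have c0: "coeff (\<phi> a) 0 = 0"
      using drinfeld_linear[OF D a] q_ge_2 by (auto simp: linear_polys_def)
    have "degree (\<phi> a) \<le> 1"
    proof (cases "a = 0")
      case True
      have "tc \<phi> 0 i = 0" for i
        using twisted_homD(3)[OF drinfeld_twisted_hom[OF D] A a a] .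
      then have "\<phi> 0 = 0"
        using linear_poly_expansion[OF drinfeld_linear[OF D a] q_ge_2, of "degree (\<phi> a)"] True
        by (simp add: tc_def)
      then show ?thesis using True by simp
    next
      case False
      then show ?thesis using drinfeld_degree[OF D a] residue_card_deg[OF D a] units[OF a] by simp
    qed
    then show "\<phi> a = [:0, a:]"
      using t0 c0 by (intro poly_eqI) (auto simp: tc_def coeff_pCons coeff_eq_0 split: nat.splits)
  qed
  then have "(\<lambda>\<phi>. restrict \<phi> A) ` one_torsion \<subseteq> {restrict (\<lambda>a. [:0, a:]) A}"
    by (auto simp: one_torsion_def)
  then show ?thesis by (rule finite_subset) simp
qed

end

context drinfeld
begin

lemma transcendental_k_T: "transcendental_element k T"
proof
  show "finite k" by (rule fin_k)
  show "closed_subfield k" using k k_inv by (simp add: closed_subfield_def)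
  show "p = 0" if "p \<in> polys_over k" "poly p T = 0" for p using that by (rule T_transcendental)
qed

lemma transcendental_to_ac: "transcendental_element (to_ac ` k) (to_ac T)"
proof
  show "finite (to_ac ` k)" using fin_k by simp
  have ks: "x - y \<in> k" "x * y \<in> k" "inverse x \<in> k" "1 \<in> k" if "x \<in> k" "y \<in> k" for x y
    using k k_inv that by (auto simp: closed_subringD)
  show "closed_subfield (to_ac ` k)"
    unfolding closed_subfield_def closed_subring_def
  proof (intro conjI ballI)
    show "1 \<in> to_ac ` k" using closed_subringD(1)[OF k] by (metis imageI to_ac_1)
    fix x assume x: "x \<in> to_ac ` k"
    then show "inverse x \<in> to_ac ` k" using ks(3) by (auto simp flip: to_ac_inverse)
    fix y assume y: "y \<in> to_ac ` k"
    show "x - y \<in> to_ac ` k" using x y ks(1) by (auto simp flip: to_ac_diff)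
    show "x * y \<in> to_ac ` k" using x y ks(2) by (auto simp flip: to_ac_mult)
  qed
  fix p assume p: "p \<in> polys_over (to_ac ` k)" "poly p (to_ac T) = 0"
  define r where "r = map_poly of_ac p"
  have pr: "p = map_poly to_ac r"
  proof (rule poly_eqI)
    fix i
    have "coeff p i \<in> to_ac ` k" using p(1) by (simp add: polys_over_def)
    then show "coeff p i = coeff (map_poly to_ac r) i" by (auto simp: r_def coeff_map_poly)
  qed
  have "coeff r i \<in> k" for i
  proof -
    have "coeff p i \<in> to_ac ` k" using p(1) by (simp add: polys_over_def)
    then show ?thesis by (auto simp: r_def coeff_map_poly)
  qed
  then have "r \<in> polys_over k" by (simp add: polys_over_def)
  moreover have "poly r T = 0" using p(2) unfolding pr poly_map_to_ac by simp
  ultimately have "r = 0" by (rule T_transcendental)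
  then show "p = 0" by (simp add: pr)
qed

lemma to_ac_rational_functions:
  "to_ac ` rational_functions k T \<subseteq> rational_functions (to_ac ` k) (to_ac T)"
proof (rule image_subsetI)
  fix x assume "x \<in> rational_functions k T"
  then obtain a b where ab: "x = poly a T / poly b T" "a \<in> polys_over k" "b \<in> polys_over k" "b \<noteq> 0"
    by (auto simp: rational_functions_def)
  have "to_ac x = poly (map_poly to_ac a) (to_ac T) / poly (map_poly to_ac b) (to_ac T)"
    by (simp add: ab poly_map_to_ac)
  moreover have "map_poly to_ac a \<in> polys_over (to_ac ` k)" "map_poly to_ac b \<in> polys_over (to_ac ` k)"
    using ab by (auto simp: polys_over_def coeff_map_poly)
  moreover have "map_poly to_ac b \<noteq> 0"
    using ab(4) by (metis coeff_map_poly leading_coeff_0_iff to_ac_0 to_ac_eq_0_iff coeff_0)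
  ultimately show "to_ac x \<in> rational_functions (to_ac ` k) (to_ac T)"
    unfolding rational_functions_def by blast
qed

text \<open>
  The set \<open>B\<close> that generates \<open>A\<close> over \<open>k[T]\<close> also spans the fraction field over \<open>k(T)\<close>, since every
  nonzero \<open>s \<in> A\<close> divides a nonzero element of \<open>k[T]\<close> in \<open>A\<close>. So \<open>L\<close> has finite dimension over \<open>k(T)\<close>.
\<close>
lemma bounded_algebraic_degree:
  assumes fin: "ring.finite_dimension field_L (fraction_field A) UNIV"
  obtains n where "\<And>x :: 'l. algebraic_of_degree (rational_functions k T) n x"
proof -
  interpret L: field "field_L :: 'l ring" by (rule field_from_type_algebra)
  interpret TE: transcendental_element k T by (rule transcendental_k_T)
  define F where "F = rational_functions k T"
  have F: "closed_subfield F" unfolding F_def by (rule TE.rational_functions_subfield)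
  then have FR: "closed_subring F" and inv: "\<And>x. x \<in> F \<Longrightarrow> inverse x \<in> F"
    by (auto simp: closed_subfield_def)
  have kTF: "adjoin k T \<subseteq> F" unfolding F_def by (rule TE.kT_subset)
  have TF: "T \<in> F" using kTF adjoin_subring(3)[OF k] by auto
  obtain B where B: "finite B" "B \<subseteq> A" "T \<in> B"
    and gen: "generates B T A"
    using generating_set by blast
  note sB = span_over_closed[OF FR B(1)]
  have AB: "A \<subseteq> span_over F B"
    by (rule generatesD[OF gen]) (use sB TF in auto)
  have KB: "fraction_field A \<subseteq> span_over F B"
  proof
    fix x assume "x \<in> fraction_field A"
    then obtain a s where as: "x = a / s" "a \<in> A" "s \<in> A" "s \<noteq> 0"
      by (auto simp: fraction_field_def localization_def)
    obtain s' p where s': "s' \<in> A" "p \<in> polys_over k" "p \<noteq> 0" "s * s' = poly p T"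
      using multiple_in_kT[OF as(3,4)] by blast
    have "poly p T \<noteq> 0" using s' T_transcendental by blast
    then have "x = inverse (poly p T) * (a * s')"
      unfolding s'(4)[symmetric] using as by (simp add: field_simps)
    moreover have "inverse (poly p T) \<in> F" using s'(2) kTF by (intro inv) (auto simp: adjoin_def)
    moreover have "a * s' \<in> span_over F B" using AB as s' A by (auto simp: closed_subringD)
    ultimately show "x \<in> span_over F B" using sB(2) by simp
  qed
  have "\<exists>C. finite C \<and> E \<subseteq> span_over F C"
    if "L.dimension m K E" "K \<subseteq> span_over F B" for m K E
    using that
  proof (induction rule: L.dimension.induct[consumes 1])
    case (zero_dim K)
    then show ?case by (intro exI[of _ "{}"]) (simp add: span_over_def)
  next
    case (Suc_dim v E m K)
    then obtain C where C: "finite C" "E \<subseteq> span_over F C" by auto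
    define C' where "C' = C \<union> (\<lambda>b. b * v) ` B"
    have C': "finite C'" using C B by (simp add: C'_def)
    note sC = span_over_closed[OF FR C']
    have 1: "span_over F C \<subseteq> span_over F C'"
      by (rule span_over_subset[OF FR C(1)]) (use sC in \<open>auto simp: C'_def\<close>)
    have "b * v \<in> span_over F C'" if "b \<in> B" for b
      using that by (intro sC(3)) (auto simp: C'_def)
    then have "span_over F B \<subseteq> {x. x * v \<in> span_over F C'}"
      by (intro span_over_subset[OF FR B(1)])
         (use sC(1,2,4) in \<open>auto simp: distrib_right mult.assoc\<close>)
    then have 2: "x * v \<in> span_over F C'" if "x \<in> K" for x using that Suc_dim.prems by auto
    have "c * v + e \<in> span_over F C'" if "c \<in> K" "e \<in> E" for c e
      using that C(2) 1 by (intro sC(1) 2) auto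
    then have "L.line_extension K v E \<subseteq> span_over F C'"
      by (auto simp: L.line_extension_mem_iff)
    then show ?case using C' by blast
  qed
  then obtain C where C: "finite C" "UNIV \<subseteq> span_over F C"
    using fin KB by (metis L.finite_dimension_def)
  show thesis
    by (rule that[of "card C", folded F_def], rule algebraic_of_degree_card[OF F C(1)]) (use C(2) in auto)
qed

text \<open>
  Choose zeros \<open>\<alpha> \<psi>\<close> of \<open>\<psi> T\<close>. Finitely many values of \<open>\<tau>\<close> describe the modules after scaling by \<open>\<alpha> \<psi>\<close>.
  If \<open>\<tau> \<psi> = \<tau> \<phi>0\<close>, then \<open>\<psi>\<close> is the twist of \<open>\<phi>0\<close> by \<open>u \<psi> = \<alpha> \<phi>0 / \<alpha> \<psi>\<close>. The torsion point \<open>1\<close> of \<open>\<psi>\<close>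
  corresponds to the torsion point \<open>u \<psi>\<close> of \<open>\<phi>0\<close>, and comparison of the leading coefficients at \<open>T\<close> shows
  that \<open>(u \<psi>)^(q^d - 1)\<close> lies in \<open>L\<close>. So Northcott's theorem leaves finitely many \<open>u \<psi>\<close>, which determine \<open>\<psi>\<close>.
\<close>
theorem finite_one_torsion:
  assumes fin: "ring.finite_dimension field_L (fraction_field A) UNIV"
  shows "finite ((\<lambda>\<phi>. restrict \<phi> A) ` one_torsion)"
proof -
  obtain n where n: "\<And>x :: 'l. algebraic_of_degree (rational_functions k T) n x"
    using bounded_algebraic_degree[OF fin] by blast
  define F where "F = rational_functions (to_ac ` k) (to_ac T)"
  have alg: "algebraic_of_degree F n (to_ac x)" for x
    unfolding F_def by (rule algebraic_of_degree_to_ac[OF n to_ac_rational_functions])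
  interpret N: northcott_field F "adjoin (to_ac ` k) (to_ac T)" "regular_at_infinity (to_ac ` k) (to_ac T)"
    unfolding F_def by (rule northcott_field_rational_functions[OF transcendental_to_ac])
  have FR: "closed_subring F" using N.F by (simp add: closed_subfield_def)
  define d where "d = deg T"
  have qpos: "q ^ i \<ge> 1" for i using q_ge_2 by simp
  have qd: "q ^ d \<ge> 2"
    using self_le_power[of q d] q_ge_2 deg_T by (simp add: d_def)
  obtain B where B: "finite B" "B \<subseteq> A" "T \<in> B"
    and gen: "generates B T A"
    using generating_set by blast
  have root: "\<exists>\<alpha>. \<alpha> \<noteq> 0 \<and> poly (map_poly to_ac (\<psi> T)) \<alpha> = 0" if \<psi>: "drinfeld_module k A 1 \<psi>" for \<psi>
  proof -
    define p where "p = map_poly to_ac (\<psi> T)"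
    have c0: "coeff p 0 = 0"
      using drinfeld_linear[OF \<psi> T(1)] q_ge_2 by (auto simp: p_def coeff_map_poly linear_polys_def)
    obtain a r where pr: "p = pCons a r" by (cases p)
    have p: "p = pCons 0 r" using pr c0 by simp
    have "coeff p 1 = to_ac T" using drinfeld_tc_0[OF \<psi> T(1)] by (simp add: p_def coeff_map_poly tc_def)
    then have r0: "poly r 0 \<noteq> 0" using T(2) by (simp add: p poly_0_coeff_0)
    have "degree p = q ^ d"
      using drinfeld_degree[OF \<psi> T] residue_card_deg[OF \<psi> T] by (simp add: p_def d_def)
    then have "degree r > 0" using qd unfolding p by (simp split: if_splits)
    then obtain z where "poly r z = 0" using alg_closed_imp_poly_has_root by blast
    then show ?thesis using r0 by (intro exI[of _ z]) (auto simp: p_def[symmetric] p)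
  qed
  then obtain \<alpha> where \<alpha>: "\<And>\<psi>. drinfeld_module k A 1 \<psi> \<Longrightarrow> \<alpha> \<psi> \<noteq> 0"
    "\<And>\<psi>. drinfeld_module k A 1 \<psi> \<Longrightarrow> poly (map_poly to_ac (\<psi> T)) (\<alpha> \<psi>) = 0" by metis
  define nc where "nc \<psi> b i = to_ac (tc \<psi> b i) * \<alpha> \<psi> ^ (q ^ i - 1)" for \<psi> b i
  define I where "I = (SIGMA b:B. {..deg b})"
  define \<tau> where "\<tau> \<psi> = restrict (\<lambda>(b, i). nc \<psi> b i) I" for \<psi>
  have fin_\<tau>: "finite (\<tau> ` one_torsion)"
  proof (rule finite_subset)
    define S where "S = (\<lambda>(b, j). {to_ac (tc \<psi> b j) * \<alpha> ^ (q ^ j - 1) | \<psi> \<alpha>.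
      drinfeld_module k A 1 \<psi> \<and> \<alpha> \<noteq> 0 \<and> poly (map_poly to_ac (\<psi> T)) \<alpha> = 0})"
    have "nc \<psi> b i \<in> S (b, i)" if "\<psi> \<in> one_torsion" for \<psi> b i
    proof -
      have "drinfeld_module k A 1 \<psi>" using that by (simp add: one_torsion_def)
      then show ?thesis using \<alpha>[of \<psi>] unfolding S_def nc_def by blast
    qed
    then show "\<tau> ` one_torsion \<subseteq> PiE I S" by (auto simp: \<tau>_def)
    show "finite (PiE I S)"
    proof (rule finite_PiE)
      show "finite I" using B by (simp add: I_def)
      show "finite (S p)" if "p \<in> I" for p
        using that B finite_normalised_coefficients by (auto simp: S_def I_def)
    qed
  qed
  show ?thesis
  proof (rule finite_image_fibres[OF fin_\<tau>])
    fix \<phi>0 assume \<phi>0: "\<phi>0 \<in> one_torsion"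
    then have D0: "drinfeld_module k A 1 \<phi>0" by (simp add: one_torsion_def)
    define Y where "Y = {\<psi>\<in>one_torsion. \<tau> \<psi> = \<tau> \<phi>0}"
    define u where "u \<psi> = \<alpha> \<phi>0 / \<alpha> \<psi>" for \<psi>
    have twist: "to_ac (tc \<psi> a i) = to_ac (tc \<phi>0 a i) * u \<psi> ^ (q ^ i - 1)"
      if \<psi>: "\<psi> \<in> Y" and a: "a \<in> A" for \<psi> a i
    proof -
      have D\<psi>: "drinfeld_module k A 1 \<psi>" using \<psi> by (simp add: Y_def one_torsion_def)
      define c1 where "c1 a i = to_ac (tc \<psi> a i)" for a i
      define c2 where "c2 a i = to_ac (tc \<phi>0 a i) * u \<psi> ^ (q ^ i - 1)" for a i
      have h1: "twisted_hom q A c1" unfolding c1_def by (intro twisted_hom_to_ac drinfeld_twisted_hom D\<psi>)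
      have h2: "twisted_hom q A c2" unfolding c2_def using q_ge_2
        by (intro twisted_hom_scale twisted_hom_to_ac drinfeld_twisted_hom D0) auto
      define S where "S = {a\<in>A. \<forall>i. c1 a i = c2 a i}"
      have "A \<subseteq> S"
      proof (rule generatesD[OF gen])
        show "B \<subseteq> S"
        proof
          fix b assume b: "b \<in> B"
          then have bA: "b \<in> A" using B by auto
          have "c1 b i = c2 b i" for i
          proof (cases "i \<le> deg b")
            case True
            then have bi: "(b, i) \<in> I" using b by (simp add: I_def)
            have "\<tau> \<psi> (b, i) = \<tau> \<phi>0 (b, i)" using \<psi> by (simp add: Y_def)
            then have "nc \<psi> b i = nc \<phi>0 b i" using bi by (simp add: \<tau>_def)
            then show ?thesis using \<alpha>(1)[OF D\<psi>]
              by (simp add: nc_def c1_def c2_def u_def power_divide field_simps)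
          next
            case False
            show ?thesis
            proof (cases "b = 0")
              case True
              then show ?thesis using twisted_homD(3)[OF h1 A bA bA] twisted_homD(3)[OF h2 A bA bA] by simp
            next
              case b0: False
              show ?thesis using tc_lead(2)[OF D\<psi> bA b0, of i] tc_lead(2)[OF D0 bA b0, of i] False
                by (simp add: c1_def c2_def)
            qed
          qed
          then show "b \<in> S" using bA by (simp add: S_def)
        qed
        show "x + y \<in> S" if "x \<in> S" "y \<in> S" for x y
          using that A by (auto simp: S_def twisted_homD(4)[OF h1 A] twisted_homD(4)[OF h2 A] closed_subringD)
        show "T * x \<in> S" if "x \<in> S" for x
        proof -
          have "T \<in> S" using \<open>B \<subseteq> S\<close> B(3) by auto
          then show ?thesis using that A
            by (auto simp: S_def twisted_homD(2)[OF h1 A] twisted_homD(2)[OF h2 A] closed_subringD)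
        qed
      qed
      then show ?thesis using a by (auto simp: S_def c1_def c2_def)
    qed
    \<comment> \<open>The finite set \<open>Z\<close> needed for the orbit of a torsion point is the kernel of \<open>\<phi>0 a\<close>; it is stable
       under \<open>\<phi>0 T\<close> because \<open>A\<close> is commutative.\<close>
    define f where "f = map_poly to_ac (\<phi>0 T)"
    have df: "degree f = q ^ d"
      using drinfeld_degree[OF D0 T] residue_card_deg[OF D0 T] by (simp add: f_def d_def)
    have "finite {x. algebraic_of_degree F (n * (q ^ d - 1)) x \<and>
        (\<exists>Z. finite Z \<and> (\<forall>x\<in>Z. poly f x \<in> Z) \<and> x \<in> Z)}"
    proof (rule N.finite_preperiodic)
      show "degree f \<ge> 2" using df qd by simp
      fix g assume "g \<in> escape_radii f"
      then have "g \<in> range to_ac"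
        unfolding escape_radii_def f_def
        by (auto simp: coeff_map_poly simp flip: to_ac_1 to_ac_divide)
      then show "\<exists>m. algebraic_of_degree F m g" using alg by auto
    qed
    moreover have "u ` Y \<subseteq> {x. algebraic_of_degree F (n * (q ^ d - 1)) x \<and>
        (\<exists>Z. finite Z \<and> (\<forall>x\<in>Z. poly f x \<in> Z) \<and> x \<in> Z)}"
    proof (rule image_subsetI, rule CollectI, rule conjI)
      fix \<psi> assume \<psi>: "\<psi> \<in> Y"
      then have D\<psi>: "drinfeld_module k A 1 \<psi>" by (simp add: Y_def one_torsion_def)
      have "u \<psi> ^ (q ^ d - 1) = to_ac (tc \<psi> T d / tc \<phi>0 T d)"
        using twist[OF \<psi> T(1), of d] tc_lead(1)[OF D0 T] by (simp add: d_def field_simps)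
      then have "algebraic_of_degree F n (u \<psi> ^ (q ^ d - 1))" using alg by (simp only:)
      then show "algebraic_of_degree F (n * (q ^ d - 1)) (u \<psi>)"
        using qd by (intro algebraic_of_degree_root[OF FR]) auto
      obtain a where a: "a \<in> A" "a \<noteq> 0" "poly (\<psi> a) 1 = 0"
        using \<psi> by (auto simp: Y_def one_torsion_def torsion_def)
      define g where "g = map_poly to_ac (\<phi>0 a)"
      define Z where "Z = {x. poly g x = 0}"
      have "g \<noteq> 0"
      proof
        assume "g = 0"
        then have "coeff g 1 = 0" by simp
        then show False using drinfeld_tc_0[OF D0 a(1)] a(2) by (simp add: g_def coeff_map_poly tc_def)
      qed
      then have "finite Z" unfolding Z_def by (rule poly_roots_finite)
      moreover have "poly f x \<in> Z" if "x \<in> Z" for x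
      proof -
        have "pcompose (\<phi>0 a) (\<phi>0 T) = pcompose (\<phi>0 T) (\<phi>0 a)"
          using D0 a T unfolding drinfeld_module_def by (metis mult.commute)
        then have "poly g (poly f x) = poly f (poly g x)"
          unfolding g_def f_def poly_map_to_ac_pcompose[symmetric] by simp
        also have "\<dots> = poly f 0" using that by (simp add: Z_def)
        also have "\<dots> = 0" using drinfeld_linear[OF D0 T(1)] q_ge_2
          by (auto simp: f_def poly_0_coeff_0 coeff_map_poly linear_polys_def)
        finally show ?thesis by (simp add: Z_def)
      qed
      moreover have "u \<psi> \<in> Z"
      proof -
        have "poly g (u \<psi>) = (\<Sum>i\<le>deg a. to_ac (tc \<phi>0 a i) * u \<psi> ^ q ^ i)"
          unfolding g_def by (rule poly_drinfeld_to_ac[OF D0 a(1,2)])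
        also have "\<dots> = (\<Sum>i\<le>deg a. u \<psi> * to_ac (tc \<psi> a i))"
        proof (rule sum.cong)
          fix i
          have "u \<psi> ^ q ^ i = u \<psi> * u \<psi> ^ (q ^ i - 1)"
            using qpos[of i] by (metis le_add_diff_inverse power_Suc plus_1_eq_Suc)
          then show "to_ac (tc \<phi>0 a i) * u \<psi> ^ q ^ i = u \<psi> * to_ac (tc \<psi> a i)"
            unfolding twist[OF \<psi> a(1)] by simp
        qed simp
        also have "\<dots> = u \<psi> * poly (map_poly to_ac (\<psi> a)) (to_ac 1)"
          using poly_drinfeld_to_ac[OF D\<psi> a(1,2), of 1] by (simp add: sum_distrib_left)
        also have "\<dots> = 0" unfolding poly_map_to_ac a(3) by simp
        finally show ?thesis by (simp add: Z_def)
      qed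
      ultimately show "\<exists>Z. finite Z \<and> (\<forall>x\<in>Z. poly f x \<in> Z) \<and> u \<psi> \<in> Z" by blast
    qed
    ultimately have "finite (u ` Y)" by (rule finite_subset[rotated])
    then have "finite ((\<lambda>\<phi>. restrict \<phi> A) ` Y)"
    proof (rule finite_image_factor)
      fix \<psi> \<psi>' assume *: "\<psi> \<in> Y" "\<psi>' \<in> Y" "u \<psi> = u \<psi>'"
      show "restrict \<psi> A = restrict \<psi>' A"
      proof (rule restrict_ext)
        fix a assume a: "a \<in> A"
        show "\<psi> a = \<psi>' a"
        proof (rule drinfeld_eqI[OF _ _ a])
          show "drinfeld_module k A 1 \<psi>" "drinfeld_module k A 1 \<psi>'" using * by (auto simp: Y_def one_torsion_def)
          fix i
          have "to_ac (tc \<psi> a i) = to_ac (tc \<psi>' a i)"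
            using twist[OF *(1) a] twist[OF *(2) a] *(3) by simp
          then show "tc \<psi> a i = tc \<psi>' a i" by simp
        qed
      qed
    qed
    then show "finite ((\<lambda>\<phi>. restrict \<phi> A) ` {\<psi>\<in>one_torsion. \<tau> \<psi> = \<tau> \<phi>0})" by (simp add: Y_def)
  qed
qed

end

theorem theorem2:
  fixes k A K Pinf :: "'l::field set" and n :: nat and t :: "nat \<Rightarrow> 'l"
  assumes "finite k"
    and "nonsingular_projective_curve k n t"
    and "Pinf \<in> closed_points k n t"
    and "A = regular_functions_away_from k n t Pinf"
    and "K = fraction_field A"
    and "ring.finite_dimension field_L K UNIV"
  shows "finite ({\<phi>. drinfeld_module k A 1 \<phi> \<and> torsion A \<phi> \<noteq> {0}} // drinfeld_iso k A 1)"
proof -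
  have "subfield k field_L"
    using assms(2) by (simp add: nonsingular_projective_curve_def projective_curve_def)
  then have k: "closed_subfield k" by (rule closed_subfield_of_subfield)
  interpret constant_field k A
    using assms(1) k regular_functions_ring[of k n t Pinf] unfolding assms(4) closed_subfield_def
    by unfold_locales auto
  show ?thesis
  proof (rule finite_classes)
    show "finite ((\<lambda>\<phi>. restrict \<phi> A) ` one_torsion)"
    proof (cases "one_torsion = {}")
      case False
      then obtain \<phi> where D: "drinfeld_module k A 1 \<phi>" by (auto simp: one_torsion_def)
      show ?thesis
      proof (cases "\<exists>T\<in>A. T \<noteq> 0 \<and> deg T \<ge> 1")
        case True
        then obtain T where T: "T \<in> A" "T \<noteq> 0" "deg T \<ge> 1" by auto
        interpret drinfeld k A \<phi> T by unfold_locales (rule D T)+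
        show ?thesis using assms(5,6) by (intro finite_one_torsion) simp
      next
        case False
        then show ?thesis by (intro finite_one_torsion_if_units) (auto simp: not_le)
      qed
    qed simp
  qed
qed

end
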